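(* Let $q\in[1/2,1)$. Assume that $Y=m(\mathbf X)+\varepsilon$, where $\varepsilon$ is a centred Gaussian noise with finite variance $\sigma^2$, independent of $\mathbf X$; that $\mathbf X$ has a density on $[0,1]^d$ bounded from below (by a positive constant) and from above; and that $m$ is continuous on $[0,1]^d$. Then, provided $a_n\to\infty$ and $a_n/n\to0$ as $n\to\infty$, the infinite $q$ quantile random forest is $\mathbb{L}^2$ consistent, that is, $R(m_{\infty,n})\to0$ as $n\to\infty$.
   Context: Data: $\mathcal{D}_n=((\mathbf X_1,Y_1),\dots,(\mathbf X_n,Y_n))$ is a sample of independent $[0,1]^d\times\mathbb{R}$-valued random variables distributed as $(\mathbf X,Y)$ with $\mathbb{E}[Y^2]<\infty$; $\mathbf X$ denotes also a fresh copy independent of $\mathcal D_n$, and $m(\mathbf x)=\mathbb{E}[Y\mid\mathbf X=\mathbf x]$. $q$ quantile tree ($q\in[1/2,1)$, subsample size $a_n\in\{1,\dots,n\}$). The random parameter $\Theta$, independent of $\mathcal{D}_n$ and $\mathbf X$, encodes all the randomness below; the construction of the partition depends only on $\Theta$ and the $\mathbf X_i$'s. 1. Select $a_n$ points of $\mathcal{D}_n$ uniformly without replacement; only these are used in what follows. Start with the partition $\mathcal{P}=\{[0,1]^d\}$. 2. While some cell $A\in\mathcal{P}$ contains strictly more than two (selected) points: choose a coordinate $j$ uniformly in $\{1,\dots,d\}$; let $N$ be the number of data points in $A$ and select $q_n\in[1-q,q]\cap(1/N,1-1/N)$ ($q_n$ may be pre-specified by the user or randomly chosen); cut $A$ along the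 $j$-th coordinate at the position of the empirical $q_n$-quantile of the $j$-th coordinates of the points in $A$; replace $A$ in $\mathcal{P}$ by the two resulting cells. The data point on which the split is performed is not sent down to the resulting cells (it is discarded). Here the empirical $q'$-quantile of ordered points $X_{(1)}<X_{(2)}<\cdots$ with empirical distribution function $F$ is the only $X_{(\ell)}$ such that $F(X_{(\ell-1)})\le q'<F(X_{(\ell)})$. 3. For each cell containing exactly two points: choose a coordinate $j$ uniformly in $\{1,\dots,d\}$, cut along the $j$-th direction in the middle of the two points, and replace the cell by the two resulting cells. At the end each cell contains exactly one point. The tree estimate $m_n(\mathbf x,\Theta)$ is the single $Y_i$ whose point lies in the cell $A_n(\mathbf x,\Theta)$ containing $\mathbf x$ of the final partition. The infinite $q$ quantile forest estimate is $m_{\infty,n}(\mathbf x)=\mathbb{E}_\Theta[m_n(\mathbf x,\Theta)]$, expectation with respect to $\Theta$ conditionally on $\mathcal{D}_n$. The risk is $R(m_{\infty,n})=\mathbb{E}[m_{\infty,n}(\mathbf X)-m(\mathbf X)]^2$, expectation over $\mathbf X$ and $\mathcal{D}_n$. *)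

theory Defs
  imports "HOL-Probability.Probability"
begin

text \<open>
  A node of a tree is a triple \<open>(h, A, I)\<close>: the history \<open>h\<close> of the cuts that lead to it (most
  recent cut first; an entry \<open>(j, b)\<close> is a cut along coordinate \<open>j\<close> of which the left (\<open>b = False\<close>)
  or the right (\<open>b = True\<close>) side was taken), the cell \<open>A\<close>, and the indices \<open>I\<close> of the selected data
  points that have been sent down to \<open>A\<close>.
\<close>

type_synonym 'd history = "('d \<times> bool) list"

text \<open>
  The values of the parameter \<open>q\<^sub>n\<close> in one tree: \<open>\<rho> h j I\<close> is used for the cell with history \<open>h\<close>
  and points \<open>I\<close> when the coordinate drawn for that cell is \<open>j\<close>.
\<close>

type_synonym 'd quantile_choice = "'d history \<Rightarrow> 'd \<Rightarrow> nat set \<Rightarrow> real"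

definition empirical_cdf :: "(nat \<Rightarrow> real ^ 'd) \<Rightarrow> nat set \<Rightarrow> 'd \<Rightarrow> real \<Rightarrow> real" where
  "empirical_cdf x I j t = real (card {i \<in> I. x i $ j \<le> t}) / real (card I)"

text \<open>
  The only order statistic \<open>X\<^sub>(\<^sub>l\<^sub>)\<close> with \<open>F X\<^sub>(\<^sub>l\<^sub>-\<^sub>1\<^sub>) \<le> p < F X\<^sub>(\<^sub>l\<^sub>)\<close>. As \<open>F\<close> is monotone, the first inequality is
  the same as \<open>F s \<le> p\<close> for all sample values \<open>s < X\<^sub>(\<^sub>l\<^sub>)\<close>, which also makes sense for \<open>l = 1\<close>.
\<close>

definition empirical_quantile :: "(nat \<Rightarrow> real ^ 'd) \<Rightarrow> nat set \<Rightarrow> 'd \<Rightarrow> real \<Rightarrow> real" where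
  "empirical_quantile x I j p =
     (THE c. c \<in> (\<lambda>i. x i $ j) ` I \<and>
             (\<forall>s \<in> (\<lambda>i. x i $ j) ` I. s < c \<longrightarrow> empirical_cdf x I j s \<le> p) \<and>
             p < empirical_cdf x I j c)"

definition cut_position ::
    "(nat \<Rightarrow> real ^ 'd) \<Rightarrow> 'd quantile_choice \<Rightarrow> 'd history \<Rightarrow> nat set \<Rightarrow> 'd \<Rightarrow> real" where
  "cut_position x \<rho> h I j =
     (if card I > 2 then empirical_quantile x I j (\<rho> h j I) else (\<Sum>i\<in>I. x i $ j) / 2)"

text \<open>
  All the nodes that occur while the tree is grown from the selected points \<open>S\<close>. Cells with more
  than two points are cut at an empirical quantile, cells with two points in the middle of the
  points. The coordinate for a cell is \<open>J v\<close>, with \<open>v\<close> its address in the infinite binary tree.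
  The strict inequalities on \<open>x i $ j\<close> discard the data point on which the cut is performed. What
  happens to ties and to the common boundary of two cells is a convention: both are null events
  for covariates that have a density.
\<close>

inductive_set tree_nodes ::
    "nat set \<Rightarrow> (nat \<Rightarrow> real ^ 'd) \<Rightarrow> (bool list \<Rightarrow> 'd) \<Rightarrow> 'd quantile_choice \<Rightarrow>
     ('d history \<times> (real ^ 'd) set \<times> nat set) set"
  for S :: "nat set" and x :: "nat \<Rightarrow> real ^ 'd" and J :: "bool list \<Rightarrow> 'd"
    and \<rho> :: "'d quantile_choice"
where
  root: "([], cbox 0 1, S) \<in> tree_nodes S x J \<rho>"
| left: "\<lbrakk>(h, A, I) \<in> tree_nodes S x J \<rho>; card I \<ge> 2;
          j = J (map snd h); c = cut_position x \<rho> h I j\<rbrakk> \<Longrightarrow>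
         ((j, False) # h, {z \<in> A. z $ j \<le> c}, {i \<in> I. x i $ j < c}) \<in> tree_nodes S x J \<rho>"
| right: "\<lbrakk>(h, A, I) \<in> tree_nodes S x J \<rho>; card I \<ge> 2;
          j = J (map snd h); c = cut_position x \<rho> h I j\<rbrakk> \<Longrightarrow>
         ((j, True) # h, {z \<in> A. z $ j > c}, {i \<in> I. x i $ j > c}) \<in> tree_nodes S x J \<rho>"

definition final_partition ::
    "nat set \<Rightarrow> (nat \<Rightarrow> real ^ 'd) \<Rightarrow> (bool list \<Rightarrow> 'd) \<Rightarrow> 'd quantile_choice \<Rightarrow>
     ((real ^ 'd) set \<times> nat set) set" where
  "final_partition S x J \<rho> = {(A, I). (\<exists>h. (h, A, I) \<in> tree_nodes S x J \<rho>) \<and> card I \<le> 1}"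

text \<open>
  The value \<open>0\<close> is a default for the null event that the cell of \<open>z\<close> contains no data point (ties).
\<close>

definition tree_estimate ::
    "nat set \<Rightarrow> (nat \<Rightarrow> (real ^ 'd) \<times> real) \<Rightarrow> (bool list \<Rightarrow> 'd) \<Rightarrow> 'd quantile_choice \<Rightarrow>
     real ^ 'd \<Rightarrow> real" where
  "tree_estimate S D J \<rho> z =
     (let in_cell = (\<lambda>i. \<exists>A. (A, {i}) \<in> final_partition S (\<lambda>i. fst (D i)) J \<rho> \<and> z \<in> A)
      in if \<exists>i. in_cell i then snd (D (THE i. in_cell i)) else 0)"

text \<open>
  The law of \<open>\<Theta> = (S, J, u)\<close>: a uniform subsample \<open>S\<close> of size \<open>a\<close> of the \<open>n\<close> indices, independent
  uniform coordinates \<open>J v\<close>, and the randomisation \<open>u\<close> of the choices of \<open>q\<^sub>n\<close>, whose law \<open>Q\<close> is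
  left free (a choice that ignores \<open>u\<close> is one that is pre-specified).
\<close>

definition theta_law ::
    "nat \<Rightarrow> nat \<Rightarrow> 'u measure \<Rightarrow> (nat set \<times> (bool list \<Rightarrow> 'd::finite) \<times> 'u) measure" where
  "theta_law n a Q =
     uniform_count_measure {S. S \<subseteq> {..<n} \<and> card S = a} \<Otimes>\<^sub>M
     ((\<Pi>\<^sub>M v\<in>UNIV. measure_pmf (pmf_of_set UNIV)) \<Otimes>\<^sub>M Q)"

text \<open>
  A way of selecting \<open>q\<^sub>n\<close>, as a function of the randomisation \<open>u\<close>, the selected points, the
  cuts made so far on the way to the cell, the current coordinate and the points in the cell.
  It does not see the coordinates that will be drawn for later cuts.
\<close>

type_synonym ('u, 'd) quantile_rule =
  "'u \<Rightarrow> nat set \<Rightarrow> (nat \<Rightarrow> real ^ 'd) \<Rightarrow> 'd quantile_choice"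

definition admissible_rule ::
    "real \<Rightarrow> nat \<Rightarrow> 'u measure \<Rightarrow> ('u, 'd::finite) quantile_rule \<Rightarrow> bool" where
  "admissible_rule q n Q \<kappa> \<longleftrightarrow>
     (\<forall>S h j I. S \<subseteq> {..<n} \<and> I \<subseteq> S \<and> card I > 2 \<longrightarrow>
        (\<lambda>(u, x). \<kappa> u S x h j I) \<in> borel_measurable (Q \<Otimes>\<^sub>M (\<Pi>\<^sub>M i\<in>S. borel)) \<and>
        (\<forall>u \<in> space Q. \<forall>x \<in> space (\<Pi>\<^sub>M i\<in>S. borel).
           \<kappa> u S x h j I \<in> {1 - q..q} \<inter> {1 / real (card I)<..<1 - 1 / real (card I)}))"

definition infinite_forest ::
    "nat \<Rightarrow> nat \<Rightarrow> 'u measure \<Rightarrow> ('u, 'd::finite) quantile_rule \<Rightarrow>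
     (nat \<Rightarrow> (real ^ 'd) \<times> real) \<Rightarrow> real ^ 'd \<Rightarrow> real" where
  "infinite_forest n a Q \<kappa> D z =
     (\<integral>(S, J, u). tree_estimate S D J (\<kappa> u S (restrict (\<lambda>i. fst (D i)) S)) z \<partial>theta_law n a Q)"

definition forest_risk ::
    "'w measure \<Rightarrow> (nat \<Rightarrow> 'w \<Rightarrow> (real ^ 'd) \<times> real) \<Rightarrow> ('w \<Rightarrow> real ^ 'd) \<Rightarrow> (real ^ 'd \<Rightarrow> real) \<Rightarrow>
     nat \<Rightarrow> nat \<Rightarrow> 'u measure \<Rightarrow> ('u, 'd::finite) quantile_rule \<Rightarrow> ennreal" where
  "forest_risk M D X m n a Q \<kappa> =
     (\<integral>\<^sup>+\<omega>. ennreal ((infinite_forest n a Q \<kappa> (\<lambda>i. D i \<omega>) (X \<omega>) - m (X \<omega>))\<^sup>2) \<partial>M)"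

text \<open>The library's \<open>indep_var\<close> requires both random variables to have the same type of values.\<close>

definition independent ::
    "'w measure \<Rightarrow> 'a measure \<Rightarrow> ('w \<Rightarrow> 'a) \<Rightarrow> 'b measure \<Rightarrow> ('w \<Rightarrow> 'b) \<Rightarrow> bool" where
  "independent M N U N' V \<longleftrightarrow>
     U \<in> M \<rightarrow>\<^sub>M N \<and> V \<in> M \<rightarrow>\<^sub>M N' \<and>
     prob_space.indep_set M (sets (vimage_algebra (space M) U N)) (sets (vimage_algebra (space M) V N'))"

text \<open>The degenerate case \<open>\<sigma> = 0\<close> is included.\<close>

definition centred_gaussian :: "'w measure \<Rightarrow> ('w \<Rightarrow> real) \<Rightarrow> real \<Rightarrow> bool" where
  "centred_gaussian M \<epsilon> \<sigma> \<longleftrightarrow>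
     (if \<sigma> = 0 then AE \<omega> in M. \<epsilon> \<omega> = 0 else distributed M lborel \<epsilon> (normal_density 0 \<sigma>))"

definition regression_function ::
    "'w measure \<Rightarrow> ('w \<Rightarrow> real ^ 'd) \<Rightarrow> ('w \<Rightarrow> real) \<Rightarrow> (real ^ 'd \<Rightarrow> real) \<Rightarrow> bool" where
  "regression_function M X Y m \<longleftrightarrow>
     (AE \<omega> in M. real_cond_exp M (vimage_algebra (space M) X borel) Y \<omega> = m (X \<omega>))"

end

(*
  The risk splits into a variance and a bias term. The forest averages the Y_i with weights W_i that
  depend on the covariates only, add up to at most 1 and are bounded by a_n / n, the probability that
  the i-th point is subsampled. So the noise contributes at most sigma^2 a_n / n.

  The bias is small if the cells of the trees are small. For a_n large, with probability close to 1
  the selected points are spread over all boxes of a fixed minimal size in proportion to their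
  volumes, up to constants. Both sides of a cut at an empirical quantile contain at least a fixed
  fraction of the points of the cell, hence of its volume, and so every cut shortens the side along
  which it is made by a fixed factor, on both sides and whatever the choice of q_n. As the coordinates
  are drawn uniformly and independently of the past, the expected length of each side of the cell of
  x decays geometrically with the number K of cuts, and K can be chosen as large as desired.
*)

theory Submission
  imports Defs
begin

text \<open>The values of q_n may depend on the randomisation and on the whole selected sample, and
  so may every cell. Two devices remove this dependence. Once subsample, sample and randomisation
  are frozen, the rule is a deterministic function and only the coordinate draws remain random; all
  geometric bounds are proved for an arbitrary such function. And regularity of the sample is
  required for all boxes simultaneously, which a finite grid makes possible provided that sides
  below some s are excluded. This threshold seems circular, as small cells are what has to be
  described. It is not: after K cuts a cell still holds a fraction \<beta>^K of the selected points,
  with \<beta> = (1 - q) / 2, whereas a slab of thickness s holds at most a fraction C s. If C s <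
  \<beta>^K, no cell of depth up to K is thinner than s. Hence the order of choices: K from the
  accuracy, then s, then the grid, and only then n. The bad samples depend on the subsample. Their
  indicators are averaged over the subsamples, so that one bound per subsample suffices, however
  many subsamples there are.\<close>

section \<open>Nodes of a quantile tree\<close>

text \<open>The quantile is the least sample value whose empirical distribution function F exceeds
  p; it exists because F = 1 > p at the largest sample value. Uniqueness: of two candidates the
  smaller one would satisfy both F \<le> p and p < F. Ties are allowed, since measurability has to
  be shown for every sample.\<close>

lemma empirical_quantile_char:
  fixes x :: "nat \<Rightarrow> real ^ 'd::finite" and j :: 'd
  assumes "finite I" "I \<noteq> {}" "p < 1"
  defines "c \<equiv> empirical_quantile x I j p"
  shows "c \<in> (\<lambda>i. x i $ j) ` I"
    and "\<And>i. i \<in> I \<Longrightarrow> x i $ j < c \<Longrightarrow> empirical_cdf x I j (x i $ j) \<le> p"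
    and "p < empirical_cdf x I j c"
proof -
  let ?A = "(\<lambda>i. x i $ j) ` I"
  let ?P = "\<lambda>c. c \<in> ?A \<and> (\<forall>s \<in> ?A. s < c \<longrightarrow> empirical_cdf x I j s \<le> p) \<and> p < empirical_cdf x I j c"
  define B where "B = {s \<in> ?A. p < empirical_cdf x I j s}"
  have "{i \<in> I. x i $ j \<le> Max ?A} = I"
    using assms by auto
  then have "empirical_cdf x I j (Max ?A) = 1"
    using assms by (simp add: empirical_cdf_def)
  then have "Max ?A \<in> B"
    using assms by (simp add: B_def)
  moreover have "finite B"
    using assms by (simp add: B_def)
  ultimately have "Min B \<in> B" "\<And>s. s \<in> B \<Longrightarrow> Min B \<le> s"
    by (metis Min_in empty_iff, simp)
  then have mB: "Min B \<in> ?A" "p < empirical_cdf x I j (Min B)"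
    using B_def by auto
  have "empirical_cdf x I j s \<le> p" if "s \<in> ?A" "s < Min B" for s
    using \<open>\<And>s. s \<in> B \<Longrightarrow> Min B \<le> s\<close>[of s] that unfolding B_def by fastforce
  with mB have "?P (Min B)"
    by blast
  moreover have "c1 = c2" if "?P c1" "?P c2" for c1 c2
    using that by (metis linorder_neqE not_less)
  ultimately have "\<exists>!c. ?P c"
    by blast
  then have "?P c"
    unfolding c_def empirical_quantile_def by (rule theI')
  then show "c \<in> (\<lambda>i. x i $ j) ` I" "p < empirical_cdf x I j c"
    "\<And>i. i \<in> I \<Longrightarrow> x i $ j < c \<Longrightarrow> empirical_cdf x I j (x i $ j) \<le> p"
    by auto
qed

text \<open>Serves measurability: minimality turns a sublevel set of the quantile into a finite
  combination of comparisons, free of the description operator.\<close>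

lemma empirical_quantile_le_iff:
  fixes x :: "nat \<Rightarrow> real ^ 'd::finite"
  assumes "finite I" "I \<noteq> {}" "p < 1"
  shows "empirical_quantile x I j p \<le> t \<longleftrightarrow>
    (\<exists>i\<in>I. p < empirical_cdf x I j (x i $ j) \<and> x i $ j \<le> t)"
  using empirical_quantile_char[OF assms, where x = x and j = j] by (force simp: not_less)

text \<open>Without ties, F(c) counts the points strictly below c and the cut point itself, whence
  the lower bound; F at the preceding order statistic counts exactly the points below c, whence the
  upper bound. The 1 in the last equation is the discarded point.\<close>

lemma card_below_quantile:
  fixes x :: "nat \<Rightarrow> real ^ 'd::finite" and j :: 'd
  assumes "finite I" "I \<noteq> {}" "0 \<le> p" "p < 1" "inj_on (\<lambda>i. x i $ j) I"
  defines "c \<equiv> empirical_quantile x I j p"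
  shows "real (card {i \<in> I. x i $ j < c}) \<le> p * real (card I)"
    and "p * real (card I) - 1 < real (card {i \<in> I. x i $ j < c})"
    and "card {i \<in> I. c < x i $ j} + card {i \<in> I. x i $ j < c} + 1 = card I"
proof -
  note q = empirical_quantile_char[OF assms(1,2,4), where x = x and j = j, folded c_def]
  have N: "real (card I) > 0"
    using assms by (simp add: card_gt_0_iff)
  obtain k where k: "k \<in> I" "x k $ j = c"
    using q(1) by auto
  let ?L = "{i \<in> I. x i $ j < c}" and ?R = "{i \<in> I. c < x i $ j}"
  have le: "{i \<in> I. x i $ j \<le> c} = insert k ?L"
    using k assms(5) by (auto simp: less_le inj_on_def)
  have cle: "card {i \<in> I. x i $ j \<le> c} = card ?L + 1"
    unfolding le using assms(1) k by simp
  show "p * real (card I) - 1 < real (card ?L)"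
    using q(3) N unfolding empirical_cdf_def cle by (simp add: field_simps)
  show "real (card ?L) \<le> p * real (card I)"
  proof (cases "?L = {}")
    case True
    show ?thesis unfolding True using assms(3) by simp
  next
    case False
    \<comment> \<open>The order statistic preceding c: its rank is \<open>card ?L\<close>.\<close>
    let ?s = "Max ((\<lambda>i. x i $ j) ` ?L)"
    have "?s \<in> (\<lambda>i. x i $ j) ` ?L"
      using False assms(1) by (intro Max_in) auto
    then obtain i where i: "i \<in> I" "x i $ j < c" "x i $ j = ?s"
      by auto
    have "{l \<in> I. x l $ j \<le> x i $ j} = ?L"
      using i assms(1) by (auto intro!: Max_ge)
    then show ?thesis
      using q(2)[OF i(1,2)] N by (simp add: empirical_cdf_def field_simps)
  qed
  have "I = ?R \<union> {i \<in> I. x i $ j \<le> c}"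
    by auto
  then have "card I = card ?R + card {i \<in> I. x i $ j \<le> c}"
    using assms(1) card_Un_disjoint[of ?R "{i \<in> I. x i $ j \<le> c}"] by (auto simp: disjoint_iff)
  then show "card ?R + card ?L + 1 = card I"
    using cle by simp
qed

text \<open>A history records the coordinates that were cut, so points and cell are functions of the
  history alone, without \<open>J\<close>. A fixed history can therefore be separated from the
  random draws later on.\<close>

primrec node_points ::
    "nat set \<Rightarrow> (nat \<Rightarrow> real ^ 'd) \<Rightarrow> 'd quantile_choice \<Rightarrow> 'd history \<Rightarrow> nat set" where
  "node_points S x \<rho> [] = S"
| "node_points S x \<rho> (e # h) =
     (let c = cut_position x \<rho> h (node_points S x \<rho> h) (fst e)
      in {i \<in> node_points S x \<rho> h. if snd e then c < x i $ fst e else x i $ fst e < c})"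

primrec node_cell ::
    "nat set \<Rightarrow> (nat \<Rightarrow> real ^ 'd) \<Rightarrow> 'd quantile_choice \<Rightarrow> 'd history \<Rightarrow> (real ^ 'd) set" where
  "node_cell S x \<rho> [] = cbox 0 1"
| "node_cell S x \<rho> (e # h) =
     (let c = cut_position x \<rho> h (node_points S x \<rho> h) (fst e)
      in {z \<in> node_cell S x \<rho> h. if snd e then c < z $ fst e else z $ fst e \<le> c})"

text \<open>The history of the cell of \<open>z\<close> after \<open>k\<close> cuts, or fewer if this cell becomes final earlier.\<close>

primrec walk ::
    "nat set \<Rightarrow> (nat \<Rightarrow> real ^ 'd) \<Rightarrow> 'd quantile_choice \<Rightarrow> real ^ 'd \<Rightarrow> (bool list \<Rightarrow> 'd) \<Rightarrow>
     nat \<Rightarrow> 'd history" where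
  "walk S x \<rho> z J 0 = []"
| "walk S x \<rho> z J (Suc k) =
     (let h = walk S x \<rho> z J k; j = J (map snd h)
      in if card (node_points S x \<rho> h) \<ge> 2
         then (j, cut_position x \<rho> h (node_points S x \<rho> h) j < z $ j) # h else h)"

lemma node_points_subset: "node_points S x \<rho> h \<subseteq> S"
  by (induction h) (auto simp: Let_def)

lemma node_points_Cons_subset: "node_points S x \<rho> (e # h) \<subseteq> node_points S x \<rho> h"
  by (auto simp: Let_def)

lemma finite_node_points: "finite S \<Longrightarrow> finite (node_points S x \<rho> h)"
  by (rule finite_subset[OF node_points_subset])

lemma tree_nodes_node:
  assumes "(h, A, I) \<in> tree_nodes S x J \<rho>"
  shows "A = node_cell S x \<rho> h \<and> I = node_points S x \<rho> h"
  using assms by induction (auto simp: Let_def)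

lemma walk_in_tree_nodes:
  fixes x :: "nat \<Rightarrow> real ^ 'd::finite" and J :: "bool list \<Rightarrow> 'd"
  assumes "z \<in> cbox 0 1"
  shows "(walk S x \<rho> z J k, node_cell S x \<rho> (walk S x \<rho> z J k), node_points S x \<rho> (walk S x \<rho> z J k))
      \<in> tree_nodes S x J \<rho> \<and> z \<in> node_cell S x \<rho> (walk S x \<rho> z J k)"
proof (induction k)
  case 0
  show ?case using assms by (simp add: tree_nodes.root)
next
  case (Suc k)
  note left = tree_nodes.left[OF conjunct1[OF Suc] _ refl refl]
  note right = tree_nodes.right[OF conjunct1[OF Suc] _ refl refl]
  show ?case
    using Suc left right by (auto simp: Let_def)
qed

text \<open>The two sides of a cut are disjoint, so the nodes containing \<open>z\<close> form a
  single branch. This makes the index in \<open>tree_estimate\<close> unique.\<close>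

lemma tree_nodes_walk:
  assumes "(h, A, I) \<in> tree_nodes S x J \<rho>" "z \<in> A"
  shows "h = walk S x \<rho> z J (length h)"
  using assms
proof induction
  case root
  then show ?case by simp
next
  case (left h A I j c)
  then have "h = walk S x \<rho> z J (length h)" by simp
  with left tree_nodes_node[OF left(1)] show ?case
    by (simp add: Let_def del: walk.simps(1))
next
  case (right h A I j c)
  then have "h = walk S x \<rho> z J (length h)" by simp
  with right tree_nodes_node[OF right(1)] show ?case
    by (simp add: Let_def)
qed

text \<open>After \<open>card S\<close> steps the walk has certainly stopped, because every cut
  removes at least one point.\<close>

definition final_points ::
    "nat set \<Rightarrow> (nat \<Rightarrow> real ^ 'd) \<Rightarrow> (bool list \<Rightarrow> 'd) \<Rightarrow> 'd quantile_choice \<Rightarrow> real ^ 'd \<Rightarrow> nat set"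
  where "final_points S x J \<rho> z = node_points S x \<rho> (walk S x \<rho> z J (card S))"

lemma walk_stationary:
  assumes "card (node_points S x \<rho> (walk S x \<rho> z J k)) \<le> 1" "k \<le> l"
  shows "walk S x \<rho> z J l = walk S x \<rho> z J k"
  using assms(2) by (induction rule: dec_induct) (use assms(1) in \<open>auto simp: Let_def\<close>)

lemma node_points_walk_mono:
  assumes "k \<le> l"
  shows "node_points S x \<rho> (walk S x \<rho> z J l) \<subseteq> node_points S x \<rho> (walk S x \<rho> z J k)"
  using assms by (induction rule: dec_induct) (auto simp: Let_def)

text \<open>One frozen realisation. Ties are permitted at this level, since the sum formula for the
  tree estimate has to hold for every data set.\<close>

locale quantile_tree =
  fixes S :: "nat set" and x :: "nat \<Rightarrow> real ^ 'd::finite" and \<rho> :: "'d quantile_choice"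
    and q :: real
  assumes finite_S: "finite S" and q: "1/2 \<le> q" "q < 1"
    and \<rho>: "\<And>h j I. I \<subseteq> S \<Longrightarrow> card I > 2 \<Longrightarrow>
      \<rho> h j I \<in> {1 - q..q} \<inter> {1 / real (card I)<..<1 - 1 / real (card I)}"
begin

lemma cut_position_in_image:
  assumes "I \<subseteq> S" "card I > 2"
  shows "cut_position x \<rho> h I j \<in> (\<lambda>i. x i $ j) ` I"
proof -
  have "finite I" "I \<noteq> {}"
    using assms finite_S finite_subset by auto
  then show ?thesis
    using assms q \<rho>[OF assms, of h j] empirical_quantile_char(1)[of I "\<rho> h j I" x]
    by (simp add: cut_position_def)
qed

text \<open>An empirical quantile is the coordinate of a point of the cell, and the strict
  inequalities send this point to neither side. For two points, the midpoint cannot have both of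
  them strictly on the same side.\<close>

lemma card_child_less:
  assumes "card (node_points S x \<rho> h) \<ge> 2"
  shows "card (node_points S x \<rho> (e # h)) < card (node_points S x \<rho> h)"
proof -
  let ?I = "node_points S x \<rho> h"
  obtain j b where e: "e = (j, b)"
    by (cases e)
  let ?c = "cut_position x \<rho> h ?I j"
  have sub: "?I \<subseteq> S" and fin: "finite ?I"
    by (auto simp: node_points_subset finite_node_points finite_S)
  have "\<exists>i\<in>?I. i \<notin> node_points S x \<rho> (e # h)"
  proof (cases "card ?I > 2")
    case True
    then show ?thesis
      using cut_position_in_image[OF sub True, of h j] e by (auto simp: Let_def)
  next
    case False
    with assms have "card ?I = 2" by simp
    then obtain k l where "?I = {k, l}" "k \<noteq> l"
      by (auto simp: card_2_iff)
    then show ?thesis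
      using e by (auto simp: Let_def cut_position_def)
  qed
  then show ?thesis
    by (intro psubset_card_mono fin) (auto simp: Let_def)
qed

lemma card_walk:
  "card (node_points S x \<rho> (walk S x \<rho> z J k)) \<le> max 1 (card S - k)"
proof (induction k)
  case (Suc k)
  let ?h = "walk S x \<rho> z J k"
  show ?case
    using card_child_less[of ?h "(J (map snd ?h), cut_position x \<rho> ?h (node_points S x \<rho> ?h) (J (map snd ?h)) < z $ J (map snd ?h))"] Suc
    by (auto simp: Let_def simp del: node_points.simps(2))
qed simp

text \<open>A final cell may be reached before step \<open>card S\<close>. From then on the walk is
  stationary, so the two depths can be compared at their maximum.\<close>

lemma in_final_cell_iff:
  assumes "z \<in> cbox 0 1"
  shows "(\<exists>A. (A, {i}) \<in> final_partition S x J \<rho> \<and> z \<in> A) \<longleftrightarrow> final_points S x J \<rho> z = {i}"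
proof
  assume "\<exists>A. (A, {i}) \<in> final_partition S x J \<rho> \<and> z \<in> A"
  then obtain A h where h: "(h, A, {i}) \<in> tree_nodes S x J \<rho>" "z \<in> A"
    by (auto simp: final_partition_def)
  have w: "walk S x \<rho> z J (length h) = h"
    using tree_nodes_walk[OF h] by simp
  have pts: "node_points S x \<rho> h = {i}"
    using tree_nodes_node[OF h(1)] by simp
  let ?l = "max (length h) (card S)"
  have "walk S x \<rho> z J ?l = walk S x \<rho> z J (length h)"
    by (rule walk_stationary) (auto simp: w pts)
  moreover have "walk S x \<rho> z J ?l = walk S x \<rho> z J (card S)"
    using card_walk[of z J "card S"] by (intro walk_stationary) auto
  ultimately show "final_points S x J \<rho> z = {i}"
    using w pts by (simp add: final_points_def)
next
  assume "final_points S x J \<rho> z = {i}"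
  then show "\<exists>A. (A, {i}) \<in> final_partition S x J \<rho> \<and> z \<in> A"
    using walk_in_tree_nodes[OF assms, of S x \<rho> J "card S"]
    by (auto simp: final_partition_def final_points_def)
qed

lemma final_points_subset: "final_points S x J \<rho> z \<subseteq> S"
  by (simp add: final_points_def node_points_subset)

end

text \<open>Makes the estimate linear in the responses. At most one summand survives, and if ties
  leave the cell of \<open>z\<close> without a point, both sides are 0.\<close>

lemma tree_estimate_eq_sum:
  assumes "quantile_tree S \<rho> q" "z \<in> cbox 0 1"
  shows "tree_estimate S D J \<rho> z =
    (\<Sum>i\<in>S. of_bool (final_points S (\<lambda>i. fst (D i)) J \<rho> z = {i}) * snd (D i))"
proof -
  interpret quantile_tree S "\<lambda>i. fst (D i)" \<rho> q by fact
  show ?thesis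
  proof (cases "\<exists>i. final_points S (\<lambda>i. fst (D i)) J \<rho> z = {i}")
    case True
    then obtain i where i: "final_points S (\<lambda>i. fst (D i)) J \<rho> z = {i}" by auto
    moreover have "i \<in> S"
      using i final_points_subset[of J z] by auto
    moreover have "{k \<in> S. i = k} = {i}"
      using \<open>i \<in> S\<close> by auto
    ultimately show ?thesis
      using finite_S by (simp add: tree_estimate_def in_final_cell_iff assms(2) of_bool_def
        if_distrib[of "\<lambda>t. t * _"] sum.If_cases Int_def cong: if_cong)
  next
    case False
    then show ?thesis
      by (simp add: tree_estimate_def in_final_cell_iff assms(2))
  qed
qed

section \<open>Balanced cuts for samples without ties\<close>

locale tie_free_tree = quantile_tree S x \<rho> q
  for S :: "nat set" and x :: "nat \<Rightarrow> real ^ 'd::finite" and \<rho> :: "'d quantile_choice" and q :: real +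
  assumes inj: "\<And>j. inj_on (\<lambda>i. x i $ j) S"
begin

text \<open>Write p for the chosen quantile level and N for the number of points. The left child has
  more than p N - 1 points, the right child at least N - 1 - p N; both numbers are at least (1 - q)
  N - 1 as p lies in [1 - q, q]. The open bounds 1 / N < p < 1 - 1 / N make both counts
  positive.\<close>

lemma card_child_ge:
  assumes "card (node_points S x \<rho> h) > 2"
  shows "real (card (node_points S x \<rho> (e # h))) \<ge> (1 - q) * card (node_points S x \<rho> h) - 1"
    and "card (node_points S x \<rho> (e # h)) \<ge> 1"
proof -
  let ?I = "node_points S x \<rho> h"
  obtain j b where e: "e = (j, b)"
    by (cases e)
  let ?p = "\<rho> h j ?I" and ?N = "real (card ?I)"
  have sub: "?I \<subseteq> S" and fin: "finite ?I"
    by (auto simp: node_points_subset finite_node_points finite_S)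
  have p: "1 - q \<le> ?p" "?p \<le> q" "1 / ?N < ?p" "?p < 1 - 1 / ?N" and ne: "?I \<noteq> {}"
    using \<rho>[OF sub assms, of h j] assms by auto
  have p01: "0 \<le> ?p" "?p < 1"
    using p q by auto
  have c: "cut_position x \<rho> h ?I j = empirical_quantile x ?I j ?p"
    using assms by (simp add: cut_position_def)
  note b = card_below_quantile[OF fin ne p01 inj_on_subset[OF inj sub], of j, folded c]
  let ?c = "cut_position x \<rho> h ?I j"
  have R: "real (card {i \<in> ?I. ?c < x i $ j}) = ?N - 1 - real (card {i \<in> ?I. x i $ j < ?c})"
    using b(3) by linarith
  have "?p * ?N \<le> q * ?N" "(1 - q) * ?N \<le> ?p * ?N" "?p * ?N \<le> q * ?N"
    using p by (auto intro: mult_right_mono)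
  moreover have "1 < ?p * ?N" "?p * ?N < ?N - 1"
    using p assms by (auto simp: field_simps)
  moreover have "node_points S x \<rho> (e # h) =
      (if b then {i \<in> ?I. ?c < x i $ j} else {i \<in> ?I. x i $ j < ?c})"
    by (auto simp: e Let_def)
  ultimately have "real (card (node_points S x \<rho> (e # h))) \<ge> (1 - q) * ?N - 1 \<and>
      real (card (node_points S x \<rho> (e # h))) > 0"
    using b(1,2) R unfolding left_diff_distrib mult_1 by (cases b) (simp_all only: if_True if_False, linarith+)
  then show "real (card (node_points S x \<rho> (e # h))) \<ge> (1 - q) * ?N - 1"
    and "card (node_points S x \<rho> (e # h)) \<ge> 1"
    by linarith+
qed

lemma card_child_2:
  assumes "card (node_points S x \<rho> h) = 2"
  shows "card (node_points S x \<rho> (e # h)) = 1"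
proof -
  let ?I = "node_points S x \<rho> h"
  obtain j b where e: "e = (j, b)"
    by (cases e)
  obtain k l where I: "?I = {k, l}" "k \<noteq> l"
    using assms by (auto simp: card_2_iff)
  have "x k $ j \<noteq> x l $ j"
    using inj[of j] I node_points_subset[of S x \<rho> h] by (auto simp: inj_on_def)
  moreover have "cut_position x \<rho> h ?I j = (x k $ j + x l $ j) / 2"
    using I by (simp add: cut_position_def)
  ultimately have "node_points S x \<rho> (e # h) = {if b = (x k $ j < x l $ j) then l else k}"
    using I by (auto simp: e Let_def)
  then show ?thesis by simp
qed

text \<open>Cells with more than two points have non-empty children, and a cell of two points is cut
  into singletons.\<close>

lemma card_walk_ge_1:
  assumes "S \<noteq> {}"
  shows "card (node_points S x \<rho> (walk S x \<rho> z J k)) \<ge> 1"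
proof (induction k)
  case 0
  show ?case using assms finite_S by (simp add: Suc_le_eq card_gt_0_iff)
next
  case (Suc k)
  let ?h = "walk S x \<rho> z J k"
  show ?case
    using Suc card_child_ge(2)[of ?h] card_child_2[of ?h]
    by (cases "card (node_points S x \<rho> ?h) > 2"; cases "card (node_points S x \<rho> ?h) = 2")
      (auto simp: Let_def simp del: node_points.simps(2))
qed

lemma final_points_singleton:
  assumes "S \<noteq> {}"
  shows "\<exists>i\<in>S. final_points S x J \<rho> z = {i}"
proof -
  have "card (final_points S x J \<rho> z) = 1"
    using card_walk_ge_1[OF assms, of z J "card S"] card_walk[of z J "card S"]
    by (simp add: final_points_def)
  then show ?thesis
    using final_points_subset[of J z] by (auto simp: card_1_singleton_iff)
qed

end

section \<open>Measurability of the selected point\<close>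

lemma borel_measurable_component [measurable (raw)]:
  fixes f :: "'a \<Rightarrow> real ^ 'd::finite"
  assumes "f \<in> borel_measurable M"
  shows "(\<lambda>w. f w $ j) \<in> borel_measurable M"
proof -
  have "(\<lambda>v :: real ^ 'd. v $ j) \<in> borel_measurable borel"
    by (intro borel_measurable_continuous_onI continuous_intros)
  from measurable_compose[OF assms this] show ?thesis .
qed

text \<open>Used in two ways: with \<open>J\<close> as the only variable, and jointly in the
  coordinate draws, the randomisation, the sample and the query point. Histories and point sets are
  discrete, so measurability passes from fixed ones to random ones by countable composition.\<close>

locale random_tree =
  fixes N :: "'w measure" and S :: "nat set" and x :: "'w \<Rightarrow> nat \<Rightarrow> real ^ 'd::finite"
    and J :: "'w \<Rightarrow> bool list \<Rightarrow> 'd" and \<rho> :: "'w \<Rightarrow> 'd quantile_choice" and z :: "'w \<Rightarrow> real ^ 'd"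
  assumes finite_S: "finite S"
    and x [measurable]: "\<And>i. i \<in> S \<Longrightarrow> (\<lambda>w. x w i) \<in> borel_measurable N"
    and J [measurable]: "\<And>v. (\<lambda>w. J w v) \<in> N \<rightarrow>\<^sub>M count_space UNIV"
    and \<rho> [measurable]: "\<And>h j I. I \<subseteq> S \<Longrightarrow> card I > 2 \<Longrightarrow> (\<lambda>w. \<rho> w h j I) \<in> borel_measurable N"
    and \<rho>_less: "\<And>h j I w. I \<subseteq> S \<Longrightarrow> card I > 2 \<Longrightarrow> w \<in> space N \<Longrightarrow> \<rho> w h j I < 1"
    and z [measurable]: "z \<in> borel_measurable N"
begin

lemma measurable_cut_position:
  assumes I: "I \<subseteq> S"
  shows "(\<lambda>w. cut_position (x w) (\<rho> w) h I j) \<in> borel_measurable N"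
proof (cases "card I > 2")
  case True
  have fin: "finite I" and ne: "I \<noteq> {}"
    using True I finite_S finite_subset by auto
  note [measurable] = x[OF subsetD[OF I]] \<rho>[OF I True]
  have cdf: "empirical_cdf (x w) I j t = (\<Sum>k\<in>I. of_bool (x w k $ j \<le> t)) / real (card I)" for w t
    using fin by (simp add: empirical_cdf_def Int_def)
  have "{w \<in> space N. empirical_quantile (x w) I j (\<rho> w h j I) \<le> t} \<in> sets N" for t
  proof -
    have "{w \<in> space N. empirical_quantile (x w) I j (\<rho> w h j I) \<le> t} =
      {w \<in> space N. \<exists>i\<in>I. \<rho> w h j I < empirical_cdf (x w) I j (x w i $ j) \<and> x w i $ j \<le> t}"
      by (intro Collect_cong conj_cong refl empirical_quantile_le_iff[OF fin ne \<rho>_less[OF I True]])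
    also have "\<dots> \<in> sets N"
      unfolding cdf using fin by measurable
    finally show ?thesis .
  qed
  then have "(\<lambda>w. empirical_quantile (x w) I j (\<rho> w h j I)) \<in> borel_measurable N"
    by (simp add: borel_measurable_iff_le)
  with True show ?thesis
    by (simp add: cut_position_def)
next
  case False
  note [measurable] = x[OF subsetD[OF I]]
  have "(\<lambda>w. (\<Sum>i\<in>I. x w i $ j) / 2) \<in> borel_measurable N"
    by measurable
  with False show ?thesis
    by (simp add: cut_position_def)
qed

text \<open>The point set of the parent takes finitely many values; for each fixed value
  \<open>I\<close>, membership in the child is decided by finitely many measurable
  comparisons.\<close>

lemma measurable_node_points:
  "(\<lambda>w. node_points S (x w) (\<rho> w) h) \<in> N \<rightarrow>\<^sub>M count_space (Pow S)"
proof (induction h)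
  case Nil
  then show ?case by simp
next
  case (Cons e h)
  let ?g = "\<lambda>I w. let c = cut_position (x w) (\<rho> w) h I (fst e)
      in {i \<in> I. if snd e then c < x w i $ fst e else x w i $ fst e < c}"
  have "?g I \<in> N \<rightarrow>\<^sub>M count_space (Pow S)" if "I \<in> Pow S" for I
  proof -
    have I: "I \<subseteq> S" "finite I"
      using that finite_S finite_subset by auto
    note [measurable] = x[OF subsetD[OF I(1)]] measurable_cut_position[OF I(1)]
    have eq: "?g I -` {A} \<inter> space N =
        {w \<in> space N. A \<subseteq> I \<and> (\<forall>i\<in>I. (if snd e then cut_position (x w) (\<rho> w) h I (fst e) < x w i $ fst e
          else x w i $ fst e < cut_position (x w) (\<rho> w) h I (fst e)) \<longleftrightarrow> i \<in> A)}" for A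
      by (auto simp: Let_def)
    have "?g I -` {A} \<inter> space N \<in> sets N" for A
      unfolding eq using I(2) by measurable
    then show ?thesis
      using finite_S I(1) by (auto simp: measurable_count_space_eq2 Let_def)
  qed
  then have "(\<lambda>w. ?g (node_points S (x w) (\<rho> w) h) w) \<in> N \<rightarrow>\<^sub>M count_space (Pow S)"
    by (rule measurable_compose_countable'[OF _ Cons, of ?g]) (assumption | intro countable_finite finite_Pow_iff[THEN iffD2] finite_S)+
  then show ?case
    by (simp only: node_points.simps)
qed

lemma measurable_walk:
  "(\<lambda>w. walk S (x w) (\<rho> w) (z w) (J w) k) \<in> N \<rightarrow>\<^sub>M count_space UNIV"
proof (induction k)
  case 0
  then show ?case by simp
next
  case (Suc k)
  let ?f = "\<lambda>h I j w. if card I \<ge> 2 then (j, cut_position (x w) (\<rho> w) h I j < z w $ j) # h else h"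
  let ?g = "\<lambda>h w. ?f h (node_points S (x w) (\<rho> w) h) (J w (map snd h)) w"
  have f: "?f h I j \<in> N \<rightarrow>\<^sub>M count_space UNIV" if "I \<in> Pow S" for h I j
  proof -
    have [measurable]: "(\<lambda>w. cut_position (x w) (\<rho> w) h I j) \<in> borel_measurable N"
      using that by (intro measurable_cut_position) auto
    have "(\<lambda>w. cut_position (x w) (\<rho> w) h I j < z w $ j) \<in> N \<rightarrow>\<^sub>M count_space UNIV"
      by measurable
    from measurable_compose[OF this, of "\<lambda>b. if card I \<ge> 2 then (j, b) # h else h" "count_space UNIV"]
    show ?thesis by simp
  qed
  have "?g h \<in> N \<rightarrow>\<^sub>M count_space UNIV" for h
  proof -
    have "(\<lambda>w. ?f h I (J w (map snd h)) w) \<in> N \<rightarrow>\<^sub>M count_space UNIV" if "I \<in> Pow S" for I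
      by (rule measurable_compose_countable'[OF f[OF that] J]) (rule countableI_type)
    then show ?thesis
      by (rule measurable_compose_countable'[OF _ measurable_node_points, of "\<lambda>I w. ?f h I (J w (map snd h)) w"])
        (assumption | intro countable_finite finite_Pow_iff[THEN iffD2] finite_S)+
  qed
  then have "(\<lambda>w. ?g (walk S (x w) (\<rho> w) (z w) (J w) k) w) \<in> N \<rightarrow>\<^sub>M count_space UNIV"
    by (rule measurable_compose_countable'[OF _ Suc, of ?g]) (rule countableI_type)
  then show ?case
    by (simp only: walk.simps Let_def)
qed

lemma measurable_final_points:
  "(\<lambda>w. final_points S (x w) (J w) (\<rho> w) (z w)) \<in> N \<rightarrow>\<^sub>M count_space (Pow S)"
  unfolding final_points_def
  by (rule measurable_compose_countable'[OF measurable_node_points measurable_walk]) (rule countableI_type)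

end

section \<open>Dependence on the selected covariates only\<close>

lemma cut_position_cong:
  assumes "\<And>i. i \<in> I \<Longrightarrow> x i = x' i"
  shows "cut_position x \<rho> h I j = cut_position x' \<rho> h I j"
proof -
  have "{i \<in> I. x i $ j \<le> t} = {i \<in> I. x' i $ j \<le> t}" for t
    using assms by auto
  then have "empirical_cdf x I j = empirical_cdf x' I j"
    by (simp add: empirical_cdf_def fun_eq_iff)
  moreover have "(\<lambda>i. x i $ j) ` I = (\<lambda>i. x' i $ j) ` I"
    using assms by auto
  ultimately show ?thesis
    using assms by (simp add: cut_position_def empirical_quantile_def)
qed

lemma node_points_cong:
  assumes "\<And>i. i \<in> S \<Longrightarrow> x i = x' i"
  shows "node_points S x \<rho> h = node_points S x' \<rho> h"
proof (induction h)
  case (Cons e h)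
  have eq: "x i = x' i" if "i \<in> node_points S x' \<rho> h" for i
    using that assms node_points_subset by blast
  have "cut_position x \<rho> h (node_points S x' \<rho> h) (fst e) =
      cut_position x' \<rho> h (node_points S x' \<rho> h) (fst e)"
    by (rule cut_position_cong) (rule eq)
  with Cons eq show ?case
    by (auto simp: Let_def)
qed simp

text \<open>Lets the full sample be exchanged for its restriction to \<open>{..<n}\<close>, where
  measurability is available.\<close>

lemma final_points_cong:
  assumes "\<And>i. i \<in> S \<Longrightarrow> x i = x' i"
  shows "final_points S x J \<rho> z = final_points S x' J \<rho> z"
proof -
  have pts: "node_points S x \<rho> h = node_points S x' \<rho> h" for h
    using assms by (rule node_points_cong)
  have cut: "cut_position x \<rho> h (node_points S x' \<rho> h) j =
      cut_position x' \<rho> h (node_points S x' \<rho> h) j" for h j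
    using assms node_points_subset by (intro cut_position_cong) blast
  have "walk S x \<rho> z J k = walk S x' \<rho> z J k" for k
    by (induction k) (simp_all add: Let_def pts cut)
  then show ?thesis
    by (simp add: final_points_def pts)
qed

section \<open>Shrinking cells\<close>

text \<open>\<open>node_lo\<close> and \<open>node_hi\<close> are the corners of the box of the
  cell. Only the positions of the faces are tracked; which faces belong to the cell does not affect
  the side lengths.\<close>

primrec node_lo ::
    "nat set \<Rightarrow> (nat \<Rightarrow> real ^ 'd) \<Rightarrow> 'd quantile_choice \<Rightarrow> 'd history \<Rightarrow> 'd \<Rightarrow> real" where
  "node_lo S x \<rho> [] = (\<lambda>_. 0)"
| "node_lo S x \<rho> (e # h) =
     (if snd e then (node_lo S x \<rho> h)(fst e := cut_position x \<rho> h (node_points S x \<rho> h) (fst e))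
      else node_lo S x \<rho> h)"

primrec node_hi ::
    "nat set \<Rightarrow> (nat \<Rightarrow> real ^ 'd) \<Rightarrow> 'd quantile_choice \<Rightarrow> 'd history \<Rightarrow> 'd \<Rightarrow> real" where
  "node_hi S x \<rho> [] = (\<lambda>_. 1)"
| "node_hi S x \<rho> (e # h) =
     (if snd e then node_hi S x \<rho> h
      else (node_hi S x \<rho> h)(fst e := cut_position x \<rho> h (node_points S x \<rho> h) (fst e)))"

text \<open>A cell contains all the selected points of its interior and no point outside its closure, but
  points on its faces may have been discarded: hence open boxes below and closed boxes above.\<close>

definition box_regular ::
    "nat set \<Rightarrow> (nat \<Rightarrow> real ^ 'd::finite) \<Rightarrow> real \<Rightarrow> real \<Rightarrow> real \<Rightarrow> bool" where
  "box_regular S x s c C \<longleftrightarrow>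
     (\<forall>l u :: 'd \<Rightarrow> real. (\<forall>j. 0 \<le> l j \<and> l j + s \<le> u j \<and> u j \<le> 1) \<longrightarrow>
        c * (\<Prod>j\<in>UNIV. u j - l j) * real (card S) \<le> real (card {i \<in> S. \<forall>j. l j < x i $ j \<and> x i $ j < u j}) \<and>
        real (card {i \<in> S. \<forall>j. l j \<le> x i $ j \<and> x i $ j \<le> u j}) \<le> C * (\<Prod>j\<in>UNIV. u j - l j) * real (card S))"

text \<open>The base (1 - q) / 2 is half of 1 - q: from N = 2 / (1 - q) points on, (1 - q) N - 1 is
  at least half of (1 - q) N, which absorbs the discarded point and the rounding.
  \<open>card_large\<close> guarantees that many points down to depth \<open>K\<close>.
  \<open>s_small\<close> says that a slab of thickness \<open>s\<close> holds too few points to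
  contain a cell of depth at most \<open>K\<close>.\<close>

locale regular_tree = tie_free_tree S x \<rho> q
  for S :: "nat set" and x :: "nat \<Rightarrow> real ^ 'd::finite" and \<rho> :: "'d quantile_choice" and q :: real +
  fixes s c C :: real and K :: nat
  assumes regular: "box_regular S x s c C"
    and x01: "\<And>i j. i \<in> S \<Longrightarrow> 0 \<le> x i $ j \<and> x i $ j \<le> 1"
    and s: "0 < s" "s \<le> 1" and cC: "0 < c" "0 < C"
    and s_small: "C * s < ((1 - q) / 2) ^ K"
    and card_large: "2 / (1 - q) \<le> ((1 - q) / 2) ^ K * real (card S)"
begin

abbreviation "\<beta> \<equiv> (1 - q) / 2"
abbreviation "pts \<equiv> node_points S x \<rho>"
abbreviation "lo \<equiv> node_lo S x \<rho>"
abbreviation "hi \<equiv> node_hi S x \<rho>"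
abbreviation "side h j \<equiv> hi h j - lo h j"

lemma \<beta>: "0 < \<beta>" "\<beta> < 1"
  using q by auto

lemma card_S_pos: "0 < real (card S)"
proof (rule ccontr)
  assume "\<not> ?thesis"
  then have "card S = 0" by simp
  moreover have "0 < 2 / (1 - q)" using q by simp
  ultimately show False using card_large by simp
qed

text \<open>The parts depend on each other and share one induction: the count keeps the cell above
  two points, so the next cut is at a quantile and hence runs through a point of the cell, which in
  turn keeps the faces ordered.\<close>

lemma node_inv:
  assumes "length h \<le> K"
  shows "(\<forall>j. 0 \<le> lo h j \<and> lo h j \<le> hi h j \<and> hi h j \<le> 1) \<and>
    {i \<in> S. \<forall>j. lo h j < x i $ j \<and> x i $ j < hi h j} \<subseteq> pts h \<and>
    pts h \<subseteq> {i \<in> S. \<forall>j. lo h j \<le> x i $ j \<and> x i $ j \<le> hi h j} \<and>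
    \<beta> ^ length h * real (card S) \<le> real (card (pts h)) \<and>
    (length h < K \<longrightarrow> (\<forall>e. \<beta> * real (card (pts h)) \<le> real (card (pts (e # h)))) \<and> card (pts h) > 2)"
  using assms
proof (induction h)
  \<comment> \<open>Proved apart, since both cases of the induction end with it.\<close>
  have step: "(\<forall>e. \<beta> * real (card (pts h)) \<le> real (card (pts (e # h)))) \<and> card (pts h) > 2"
    if "\<beta> ^ length h * real (card S) \<le> real (card (pts h))" "length h < K" for h
  proof -
    have "2 / (1 - q) \<le> \<beta> ^ K * real (card S)"
      by (rule card_large)
    also have "\<dots> \<le> \<beta> ^ length h * real (card S)"
      using \<beta> that by (intro mult_right_mono power_decreasing) auto
    also have "\<dots> \<le> real (card (pts h))"
      by (rule that)
    finally have N: "2 / (1 - q) \<le> real (card (pts h))" .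
    have "2 < 2 / (1 - q)"
      using q by (simp add: field_simps)
    then have N2: "card (pts h) > 2"
      using N by linarith
    have "2 \<le> (1 - q) * real (card (pts h))"
      using N q by (simp add: field_simps)
    then have "\<beta> * real (card (pts h)) \<le> (1 - q) * real (card (pts h)) - 1"
      by (simp add: field_simps)
    then show ?thesis
      using card_child_ge(1)[OF N2] N2 by (meson order_trans)
  qed
  {
    case Nil
    show ?case
      using x01 step[of "[]"] by auto
  next
    case (Cons e h)
    then have h: "length h < K"
      by simp
    obtain j b where e: "e = (j, b)"
      by (cases e)
    let ?c = "cut_position x \<rho> h (pts h) j"
    note IH = Cons.IH[OF less_imp_le[OF h]]
    from IH have inv: "\<And>j. 0 \<le> lo h j" "\<And>j. lo h j \<le> hi h j" "\<And>j. hi h j \<le> 1"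
      by blast+
    from IH have sub1: "i \<in> pts h" if "i \<in> S" "\<And>j. lo h j < x i $ j \<and> x i $ j < hi h j" for i
      using that by blast
    from IH have sub2: "i \<in> S" "lo h j \<le> x i $ j" "x i $ j \<le> hi h j" if "i \<in> pts h" for i j
      using that by blast+
    from IH h have N: "card (pts h) > 2" and Ne: "\<beta> * real (card (pts h)) \<le> real (card (pts (e # h)))"
      and IHN: "\<beta> ^ length h * real (card S) \<le> real (card (pts h))"
      by blast+
    obtain i where "i \<in> pts h" "x i $ j = ?c"
      using cut_position_in_image[OF node_points_subset N, of h j] by auto
    with sub2(2,3)[of i j] have c: "lo h j \<le> ?c" "?c \<le> hi h j"
      by auto
    have "\<beta> ^ length (e # h) * real (card S) = \<beta> * (\<beta> ^ length h * real (card S))"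
      by simp
    also have "\<dots> \<le> \<beta> * real (card (pts h))"
      using IHN \<beta> by (intro mult_left_mono) auto
    also note Ne
    finally have big: "\<beta> ^ length (e # h) * real (card S) \<le> real (card (pts (e # h)))" .
    have "\<forall>i. 0 \<le> lo (e # h) i \<and> lo (e # h) i \<le> hi (e # h) i \<and> hi (e # h) i \<le> 1"
      using inv c order_trans[OF inv(1) c(1)] order_trans[OF c(2) inv(3)] by (auto simp: e)
    moreover have "{i \<in> S. \<forall>j. lo (e # h) j < x i $ j \<and> x i $ j < hi (e # h) j} \<subseteq> pts (e # h)"
    proof
      fix i assume "i \<in> {i \<in> S. \<forall>j. lo (e # h) j < x i $ j \<and> x i $ j < hi (e # h) j}"
      then have i: "i \<in> S" "\<And>k. lo (e # h) k < x i $ k \<and> x i $ k < hi (e # h) k"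
        by auto
      have "lo h k < x i $ k \<and> x i $ k < hi h k" for k
        using i(2)[of k] c by (auto simp: e split: if_splits)
      then have "i \<in> pts h"
        using sub1 i by blast
      then show "i \<in> pts (e # h)"
        using i(2)[of j] by (auto simp: e Let_def)
    qed
    moreover have "pts (e # h) \<subseteq> {i \<in> S. \<forall>j. lo (e # h) j \<le> x i $ j \<and> x i $ j \<le> hi (e # h) j}"
    proof
      fix i assume i: "i \<in> pts (e # h)"
      then have "i \<in> pts h"
        using node_points_Cons_subset by blast
      then have "i \<in> S" "\<And>k. lo h k \<le> x i $ k \<and> x i $ k \<le> hi h k"
        using sub2 by blast+
      with i show "i \<in> {i \<in> S. \<forall>j. lo (e # h) j \<le> x i $ j \<and> x i $ j \<le> hi (e # h) j}"
        by (auto simp: e Let_def)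
    qed
    ultimately show ?case
      using big step[of "e # h"] by (simp del: node_points.simps node_lo.simps node_hi.simps)
  }
qed

text \<open>\<open>regular\<close> says nothing about boxes thinner than \<open>s\<close>, so a thin
  cell is compared with a slab of thickness exactly \<open>s\<close> that is full in the other
  directions. The slab holds fewer than \<beta>^K \<open>card S\<close> points, the cell at least
  that many.\<close>

lemma side_ge:
  assumes "length h \<le> K"
  shows "s \<le> side h j"
proof (rule ccontr)
  assume less: "\<not> ?thesis"
  \<comment> \<open>The minimum with \<open>1 - s\<close> pushes the slab back into the cube when
    the cell lies close to the upper face.\<close>
  define l u where "l = (\<lambda>i. if i = j then min (lo h j) (1 - s) else 0)"
    and "u = (\<lambda>i. if i = j then l j + s else 1)"
  note inv = node_inv[OF assms]
  have lu: "\<forall>j. 0 \<le> l j \<and> l j + s \<le> u j \<and> u j \<le> 1"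
    using inv s by (auto simp: l_def u_def)
  have ju: "lo h j \<ge> l j" "hi h j \<le> u j"
    using inv less by (auto simp: l_def u_def min_def)
  have "pts h \<subseteq> {i \<in> S. \<forall>j. l j \<le> x i $ j \<and> x i $ j \<le> u j}"
  proof
    fix i assume "i \<in> pts h"
    then have i: "i \<in> S" "lo h j \<le> x i $ j" "x i $ j \<le> hi h j"
      using inv by auto
    then have "l k \<le> x i $ k \<and> x i $ k \<le> u k" for k
      using ju x01[OF i(1), of k] by (cases "k = j") (auto simp: l_def u_def)
    then show "i \<in> {i \<in> S. \<forall>j. l j \<le> x i $ j \<and> x i $ j \<le> u j}"
      using i by auto
  qed
  then have "real (card (pts h)) \<le> real (card {i \<in> S. \<forall>j. l j \<le> x i $ j \<and> x i $ j \<le> u j})"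
    using finite_S by (intro of_nat_mono card_mono) auto
  also have "\<dots> \<le> C * (\<Prod>j\<in>UNIV. u j - l j) * real (card S)"
    using regular lu unfolding box_regular_def by blast
  also have "(\<Prod>j\<in>UNIV. u j - l j) = s"
    by (simp add: u_def l_def if_distrib[of "\<lambda>t. t - _"] cong: if_cong)
  also have "C * s * real (card S) < \<beta> ^ K * real (card S)"
    using s_small card_S_pos by simp
  also have "\<dots> \<le> \<beta> ^ length h * real (card S)"
    using \<beta> assms by (intro mult_right_mono power_decreasing) auto
  also have "\<dots> \<le> real (card (pts h))"
    using inv by blast
  finally show False by simp
qed

lemma node_card_bounds:
  assumes "length h \<le> K"
  shows "c * (\<Prod>j\<in>UNIV. side h j) * real (card S) \<le> real (card (pts h))"
    and "real (card (pts h)) \<le> C * (\<Prod>j\<in>UNIV. side h j) * real (card S)"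
proof -
  note inv = node_inv[OF assms]
  have lu: "\<forall>j. 0 \<le> lo h j \<and> lo h j + s \<le> hi h j \<and> hi h j \<le> 1"
    using inv side_ge[OF assms] by (auto simp: algebra_simps)
  have "c * (\<Prod>j\<in>UNIV. side h j) * real (card S) \<le> real (card {i \<in> S. \<forall>j. lo h j < x i $ j \<and> x i $ j < hi h j})"
    using regular lu unfolding box_regular_def by blast
  also have "real (card {i \<in> S. \<forall>j. lo h j < x i $ j \<and> x i $ j < hi h j}) \<le> real (card (pts h))"
    using inv finite_node_points[OF finite_S] by (intro of_nat_mono card_mono) auto
  finally show "c * (\<Prod>j\<in>UNIV. side h j) * real (card S) \<le> real (card (pts h))" by simp
  have "real (card (pts h)) \<le> real (card {i \<in> S. \<forall>j. lo h j \<le> x i $ j \<and> x i $ j \<le> hi h j})"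
    using inv finite_S by (intro of_nat_mono card_mono) auto
  also have "\<dots> \<le> C * (\<Prod>j\<in>UNIV. side h j) * real (card S)"
    using regular lu unfolding box_regular_def by blast
  finally show "real (card (pts h)) \<le> C * (\<Prod>j\<in>UNIV. side h j) * real (card S)" by simp
qed

text \<open>The sibling of a node receives a fixed fraction of the points, hence a fixed fraction of the
  volume: every cut shortens the side along which it is made, for both children.\<close>

lemma side_Cons:
  assumes "length h < K"
  shows "side (e # h) i \<le> (if i = fst e then 1 - \<beta> * c / C else 1) * side h i"
proof (cases "i = fst e")
  case True
  let ?e = "(i, \<not> snd e)"
  have sum: "side (e # h) i + side (?e # h) i = side h i"
    using True by auto
  have other: "side (?e # h) k = side h k" if "k \<noteq> i" for k
    using that by auto
  define P where "P = (\<Prod>k\<in>UNIV - {i}. side h k)"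
  have pos: "0 < side h k" for k
    using side_ge[of h k] s assms by auto
  have P: "P > 0"
    unfolding P_def using pos by (intro prod_pos) auto
  have V: "(\<Prod>k\<in>UNIV. side h k) = side h i * P" "(\<Prod>k\<in>UNIV. side (?e # h) k) = side (?e # h) i * P"
    unfolding P_def
    by (subst prod.remove[where x = i], simp, simp, simp)
      (subst prod.remove[where x = i], simp, simp, use other in \<open>auto intro!: prod.cong simp del: node_lo.simps node_hi.simps\<close>)
  \<comment> \<open>Both volumes contain the product \<open>P\<close> of the untouched sides, so the
    comparison of point counts leaves a comparison of lengths: the sibling keeps at least \<beta> c
    / C of the side of \<open>h\<close>, and the present node gets at most the rest.\<close>
  have "\<beta> * (c * (side h i * P) * real (card S)) \<le> \<beta> * real (card (pts h))"
    using node_card_bounds(1)[of h] assms \<beta> V(1) by (intro mult_left_mono) auto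
  also have "\<dots> \<le> real (card (pts (?e # h)))"
    using node_inv[of h] assms by (auto simp del: node_points.simps)
  also have "\<dots> \<le> C * (side (?e # h) i * P) * real (card S)"
    using node_card_bounds(2)[of "?e # h"] assms V(2) by (auto simp del: node_points.simps node_lo.simps node_hi.simps)
  finally have "(\<beta> * c * side h i) * (P * real (card S)) \<le> (C * side (?e # h) i) * (P * real (card S))"
    by (simp only: mult_ac)
  then have "\<beta> * c * side h i \<le> C * side (?e # h) i"
    using P card_S_pos by (subst (asm) mult_le_cancel_right_pos) auto
  then have "\<beta> * c / C * side h i \<le> side (?e # h) i"
    using cC by (simp add: field_simps del: node_lo.simps node_hi.simps)
  then show ?thesis
    using sum True by (simp add: left_diff_distrib del: node_lo.simps node_hi.simps)
qed auto

text \<open>The two count bounds at the root, whose box has volume 1, give c \<le> C. The upper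
  bound makes the shrinking factor nonnegative.\<close>

lemma ratio_bounds: "0 < \<beta> * c / C" "\<beta> * c / C \<le> 1"
proof -
  show "0 < \<beta> * c / C"
    using \<beta> cC by simp
  have "c * 1 * real (card S) \<le> C * 1 * real (card S)"
    using order_trans[OF node_card_bounds[of "[]"]] by simp
  then have "c \<le> C"
    using card_S_pos by simp
  then have "\<beta> * c \<le> 1 * C"
    using \<beta> cC by (intro mult_mono) auto
  then show "\<beta> * c / C \<le> 1"
    using cC by simp
qed

text \<open>The first \<open>K\<close> cuts do take place, since every cell on the way has more than
  two points.\<close>

lemma length_walk:
  "k \<le> K \<Longrightarrow> length (walk S x \<rho> z J k) = k"
proof (induction k)
  case (Suc k)
  then have "length (walk S x \<rho> z J k) < K" by simp
  then have "card (pts (walk S x \<rho> z J k)) > 2"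
    using node_inv[of "walk S x \<rho> z J k"] by simp
  with Suc show ?case
    by (simp add: Let_def)
qed simp

lemma side_walk_Suc:
  assumes "k < K"
  shows "side (walk S x \<rho> z J (Suc k)) j \<le>
    (if j = J (map snd (walk S x \<rho> z J k)) then 1 - \<beta> * c / C else 1) * side (walk S x \<rho> z J k) j"
proof -
  let ?h = "walk S x \<rho> z J k"
  have l: "length ?h < K"
    using length_walk[of k z J] assms by simp
  then have "card (pts ?h) > 2"
    using node_inv[of ?h] by simp
  then show ?thesis
    using side_Cons[OF l, of "(J (map snd ?h), cut_position x \<rho> ?h (pts ?h) (J (map snd ?h)) < z $ J (map snd ?h))" j]
    by (simp add: Let_def del: node_lo.simps node_hi.simps)
qed

lemma z_in_walk_box:
  assumes "z \<in> cbox 0 1"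
  shows "lo (walk S x \<rho> z J k) j \<le> z $ j \<and> z $ j \<le> hi (walk S x \<rho> z J k) j"
  using assms by (induction k arbitrary: j) (auto simp: Let_def mem_box_cart)

text \<open>Later cuts only shrink the cell, so the \<open>K\<close> cuts under control already
  bound the distance of \<open>z\<close> from the point finally selected.\<close>

lemma final_points_near:
  assumes "z \<in> cbox 0 1" "K \<le> card S" "i \<in> final_points S x J \<rho> z"
  shows "\<bar>x i $ j - z $ j\<bar> \<le> side (walk S x \<rho> z J K) j"
proof -
  have "i \<in> pts (walk S x \<rho> z J K)"
    using assms(3) subsetD[OF node_points_walk_mono[OF assms(2)]] by (simp add: final_points_def)
  then have "lo (walk S x \<rho> z J K) j \<le> x i $ j \<and> x i $ j \<le> hi (walk S x \<rho> z J K) j"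
    using node_inv[of "walk S x \<rho> z J K"] length_walk[of K z J] by auto
  then show ?thesis
    using z_in_walk_box[OF assms(1), of J K j] by linarith
qed

end

section \<open>Coordinate draws and expected side lengths\<close>

abbreviation coord_law :: "(bool list \<Rightarrow> 'd::finite) measure" where
  "coord_law \<equiv> \<Pi>\<^sub>M v\<in>UNIV. measure_pmf (pmf_of_set UNIV)"

lemma prob_space_coord_law: "prob_space coord_law"
  by (intro prob_space_PiM prob_space_measure_pmf)

lemma measurable_coord [measurable]: "(\<lambda>J. J v) \<in> coord_law \<rightarrow>\<^sub>M count_space UNIV"
  using measurable_component_singleton[of v UNIV "\<lambda>_. measure_pmf (pmf_of_set UNIV)"]
  by (simp cong: measurable_cong_sets)

text \<open>Independence of one draw from the others, in the form needed under an integral: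
  \<open>G\<close> ignores the draw at \<open>v\<close>, so Fubini for the infinite product split at
  \<open>v\<close> factors the integral.\<close>

lemma nn_integral_coord_law_split:
  fixes G :: "(bool list \<Rightarrow> 'd::finite) \<Rightarrow> ennreal"
  assumes [measurable]: "G \<in> borel_measurable coord_law"
    and G: "\<And>J y. G (J(v := y)) = G J"
  shows "(\<integral>\<^sup>+J. G J * \<phi> (J v) \<partial>coord_law) =
    (\<integral>\<^sup>+J. G J \<partial>coord_law) * (\<integral>\<^sup>+j. \<phi> j \<partial>measure_pmf (pmf_of_set UNIV))"
proof -
  let ?P = "measure_pmf (pmf_of_set (UNIV :: 'd set))"
  let ?R = "\<Pi>\<^sub>M v\<in>UNIV - {v}. ?P"
  have R: "prob_space ?R" and P: "prob_space ?P"
    by (intro prob_space_PiM prob_space_measure_pmf)+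
  interpret R: prob_space ?R by (rule R)
  interpret PR: pair_prob_space ?P ?R
    by (simp add: pair_prob_space_def pair_sigma_finite_def R P prob_space_imp_sigma_finite)
  have D: "distr (?P \<Otimes>\<^sub>M ?R) coord_law (\<lambda>(y, J). J(v := y)) = coord_law"
    using distr_pair_PiM_eq_PiM[of "UNIV - {v}" "\<lambda>_. ?P" v, OF P P] by (simp add: insert_absorb)
  have upd: "(\<lambda>(y, J). J(v := y)) \<in> ?P \<Otimes>\<^sub>M ?R \<rightarrow>\<^sub>M coord_law"
    using measurable_compose[OF measurable_pair_swap' measurable_add_dim[of v "UNIV - {v}" "\<lambda>_. ?P"]]
    by (simp add: insert_absorb split_beta')
  have int: "(\<integral>\<^sup>+J. F J \<partial>coord_law) = (\<integral>\<^sup>+y. (\<integral>\<^sup>+J. F (J(v := y)) \<partial>?R) \<partial>?P)"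
    if [measurable]: "F \<in> borel_measurable coord_law" for F
  proof -
    have "(\<integral>\<^sup>+J. F J \<partial>coord_law) = (\<integral>\<^sup>+w. F (case w of (y, J) \<Rightarrow> J(v := y)) \<partial>(?P \<Otimes>\<^sub>M ?R))"
      by (subst D[symmetric], subst nn_integral_distr[OF upd]) simp_all
    also have "\<dots> = (\<integral>\<^sup>+y. (\<integral>\<^sup>+J. F (J(v := y)) \<partial>?R) \<partial>?P)"
      using measurable_compose[OF upd that] by (subst R.nn_integral_fst[symmetric]) auto
    finally show ?thesis .
  qed
  have GR: "G \<in> borel_measurable ?R"
  proof -
    \<comment> \<open>On the product without \<open>v\<close> an arbitrary value can be filled in at
      \<open>v\<close>, because \<open>G\<close> does not see it.\<close>
    have "(\<lambda>J. G (J(v := undefined))) \<in> borel_measurable ?R"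
      using measurable_compose[OF measurable_Pair1'[of undefined ?P ?R] measurable_compose[OF upd assms(1)]]
      by simp
    then show ?thesis by (simp add: G)
  qed
  have "(\<integral>\<^sup>+J. G J * \<phi> (J v) \<partial>coord_law) = (\<integral>\<^sup>+y. (\<integral>\<^sup>+J. G J * \<phi> y \<partial>?R) \<partial>?P)"
    by (subst int) (auto simp: G)
  also have "\<dots> = (\<integral>\<^sup>+J. G J \<partial>?R) * (\<integral>\<^sup>+y. \<phi> y \<partial>?P)"
    using GR by (simp add: nn_integral_multc nn_integral_cmult)
  also have "(\<integral>\<^sup>+J. G J \<partial>?R) = (\<integral>\<^sup>+J. G J \<partial>coord_law)"
    by (subst int) (auto simp: G measure_pmf.emeasure_space_1)
  finally show ?thesis .
qed

lemma (in quantile_tree) measurable_walk_coord: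
  "(\<lambda>J. walk S x \<rho> z J k) \<in> coord_law \<rightarrow>\<^sub>M count_space UNIV"
proof -
  interpret random_tree coord_law S "\<lambda>_. x" "\<lambda>J. J" "\<lambda>_. \<rho>" "\<lambda>_. z"
  proof
    show "\<rho> h j I < 1" if "I \<subseteq> S" "card I > 2" for h j I
      using \<rho>[OF that, of h j] q by auto
  qed (use finite_S measurable_coord in auto)
  show ?thesis
    by (rule measurable_walk)
qed

text \<open>The draw at the node reached after \<open>k\<close> cuts has not been used on the way to this node, hence is
  independent of it.\<close>

lemma walk_upd_last:
  assumes "walk S x \<rho> z J k = h"
  shows "walk S x \<rho> z (J(map snd h := y)) k = h"
proof -
  let ?J = "J(map snd h := y)"
  have len: "length (walk S x \<rho> z J i) \<le> length (walk S x \<rho> z J l)" if "i \<le> l" for i l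
    using that by (induction rule: dec_induct) (auto simp: Let_def)
  have "walk S x \<rho> z ?J i = walk S x \<rho> z J i" if "i \<le> k" for i
    using that
  proof (induction i)
    case (Suc i)
    let ?h = "walk S x \<rho> z J i"
    show ?case
    proof (cases "card (node_points S x \<rho> ?h) \<ge> 2")
      case True
      then have "length (walk S x \<rho> z J (Suc i)) = Suc (length ?h)"
        by (simp add: Let_def)
      then have "length ?h < length h"
        using len[of "Suc i" k] Suc assms by simp
      then have "map snd ?h \<noteq> map snd h"
        by (metis length_map less_irrefl)
      then show ?thesis
        using Suc by (simp add: Let_def)
    next
      case False
      then show ?thesis using Suc by (simp add: Let_def)
    qed
  qed simp
  then show ?thesis using assms by simp
qed

text \<open>The converse follows by undoing the update, which is again an update at the same
  address. Thus the event that the walk is at \<open>h\<close> has the invariance asked of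
  \<open>G\<close> in \<open>nn_integral_coord_law_split\<close>.\<close>

lemma walk_upd_last_iff: "walk S x \<rho> z (J(map snd h := y)) k = h \<longleftrightarrow> walk S x \<rho> z J k = h"
  using walk_upd_last[of S x \<rho> z J k h y]
    walk_upd_last[of S x \<rho> z "J(map snd h := y)" k h "J (map snd h)"] by auto

lemma length_walk_le: "length (walk S x \<rho> z J k) \<le> k"
  by (induction k) (auto simp: Let_def)

context regular_tree
begin

text \<open>The mean factor for a given side in one cut: with probability 1 / d the side is the one
  that is cut, and it is then multiplied by at most 1 - \<beta> c / C.\<close>

definition "\<gamma> = 1 - \<beta> * c / C / real CARD('d)"

lemma \<gamma>: "0 \<le> \<gamma>" "\<gamma> < 1"
proof -
  have "\<beta> * c / C / real CARD('d) \<le> 1 / 1"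
    using ratio_bounds by (intro frac_le) auto
  then show "0 \<le> \<gamma>" by (simp add: \<gamma>_def)
  have "0 < t / real CARD('d)" if "0 < t" for t :: real
    using that by simp
  from this[OF ratio_bounds(1)] have "0 < \<beta> * c / C / real CARD('d)" .
  then show "\<gamma> < 1" by (simp only: \<gamma>_def diff_less_eq less_add_same_cancel1)
qed

text \<open>A tower argument over the node reached after \<open>k\<close> cuts: given this node the
  next coordinate is still uniform, so one more cut gains a factor \<gamma> in expectation, whatever
  the quantile rule does with the coordinate once it is drawn.\<close>

lemma expected_side:
  assumes "k \<le> K"
  shows "(\<integral>\<^sup>+J. ennreal (side (walk S x \<rho> z J k) j) \<partial>coord_law) \<le> ennreal (\<gamma> ^ k)"
  using assms
proof (induction k)
  case 0
  interpret prob_space "coord_law :: (bool list \<Rightarrow> 'd) measure"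
    by (rule prob_space_coord_law)
  show ?case by (simp add: emeasure_space_1)
next
  case (Suc k)
  let ?w = "\<lambda>J. walk S x \<rho> z J k"
  let ?\<phi> = "\<lambda>i. ennreal (if j = i then 1 - \<beta> * c / C else 1)"
  \<comment> \<open>The walk has finitely many possible values after \<open>k\<close> cuts. Summing
    over them replaces conditioning on the node and makes the side length a constant in each
    summand.\<close>
  define H where "H = {h :: 'd history. length h \<le> k}"
  have H: "finite H"
    unfolding H_def using finite_lists_length_le[of "UNIV :: ('d \<times> bool) set" k] by simp
  have wH: "?w J \<in> H" for J
    by (simp add: H_def length_walk_le)
  note [measurable] = measurable_walk_coord[of z k]
  let ?I = "\<lambda>h J. of_bool (?w J = h) :: ennreal"
  have mI [measurable]: "?I h \<in> borel_measurable coord_law" for h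
    by measurable
  have sumH: "(\<Sum>h\<in>H. ?I h J * f h) = f (?w J)" for f :: "'d history \<Rightarrow> ennreal" and J
    using H wH[of J] by (simp add: of_bool_def if_distrib[of "\<lambda>t. t * _"] sum.If_cases Int_def cong: if_cong)
  \<comment> \<open>The average of d values, one of them 1 - \<beta> c / C and the others 1.\<close>
  have \<phi>: "(\<integral>\<^sup>+i. ?\<phi> i \<partial>measure_pmf (pmf_of_set UNIV)) = ennreal \<gamma>"
  proof -
    have "(\<integral>\<^sup>+i. ?\<phi> i \<partial>measure_pmf (pmf_of_set UNIV)) = (\<Sum>i\<in>(UNIV::'d set). ?\<phi> i) / CARD('d)"
      by (subst nn_integral_pmf_of_set) auto
    also have "(\<Sum>i\<in>(UNIV::'d set). ?\<phi> i) = ennreal (\<Sum>i\<in>(UNIV::'d set). if j = i then 1 - \<beta> * c / C else 1)"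
      using ratio_bounds by (intro sum_ennreal) auto
    also have "(\<Sum>i\<in>(UNIV::'d set). if j = i then 1 - \<beta> * c / C else 1) = (\<Sum>i\<in>(UNIV::'d set). 1 - (if j = i then \<beta> * c / C else 0))"
      by (intro sum.cong) auto
    also have "\<dots> = real CARD('d) - \<beta> * c / C"
      by (simp add: sum_subtractf)
    also have "ennreal (real CARD('d) - \<beta> * c / C) / CARD('d) = ennreal ((real CARD('d) - \<beta> * c / C) / real CARD('d))"
    proof -
      have "1 \<le> real CARD('d)" by (simp add: Suc_le_eq)
      then have "0 \<le> real CARD('d) - \<beta> * c / C"
        using ratio_bounds(2) by linarith
      then show ?thesis
        by (simp add: divide_ennreal ennreal_of_nat_eq_real_of_nat)
    qed
    also have "(real CARD('d) - \<beta> * c / C) / real CARD('d) = \<gamma>"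
      by (simp add: \<gamma>_def diff_divide_distrib)
    finally show ?thesis .
  qed
  have "(\<integral>\<^sup>+J. ennreal (side (walk S x \<rho> z J (Suc k)) j) \<partial>coord_law) \<le>
      (\<integral>\<^sup>+J. ennreal (side (?w J) j) * ?\<phi> (J (map snd (?w J))) \<partial>coord_law)"
  proof (intro nn_integral_mono)
    fix J
    let ?t = "if j = J (map snd (?w J)) then 1 - \<beta> * c / C else 1"
    have "side (walk S x \<rho> z J (Suc k)) j \<le> ?t * side (?w J) j"
      using side_walk_Suc[of k z J j] Suc.prems by simp
    moreover have "0 \<le> ?t"
      using ratio_bounds by simp
    ultimately show "ennreal (side (walk S x \<rho> z J (Suc k)) j) \<le> ennreal (side (?w J) j) * ennreal ?t"
      by (metis ennreal_leI ennreal_mult' mult.commute)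
  qed
  also have "\<dots> = (\<integral>\<^sup>+J. (\<Sum>h\<in>H. ?I h J * (ennreal (side h j) * ?\<phi> (J (map snd h)))) \<partial>coord_law)"
    by (subst sumH) simp
  also have "\<dots> = (\<Sum>h\<in>H. \<integral>\<^sup>+J. ennreal (side h j) * (?I h J * ?\<phi> (J (map snd h))) \<partial>coord_law)"
    by (subst nn_integral_sum) (auto simp: mult_ac)
  also have "\<dots> = (\<Sum>h\<in>H. ennreal (side h j) * (\<integral>\<^sup>+J. ?I h J * ?\<phi> (J (map snd h)) \<partial>coord_law))"
    by (subst nn_integral_cmult) auto
  also have "\<dots> = (\<Sum>h\<in>H. ennreal (side h j) * ((\<integral>\<^sup>+J. ?I h J \<partial>coord_law) * ennreal \<gamma>))"
    by (subst nn_integral_coord_law_split[OF mI]) (auto simp: walk_upd_last_iff \<phi>)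
  also have "\<dots> = (\<Sum>h\<in>H. \<integral>\<^sup>+J. ?I h J * ennreal (side h j) \<partial>coord_law) * ennreal \<gamma>"
    by (simp add: nn_integral_multc sum_distrib_left sum_distrib_right mult_ac)
  also have "(\<Sum>h\<in>H. \<integral>\<^sup>+J. ?I h J * ennreal (side h j) \<partial>coord_law) =
      (\<integral>\<^sup>+J. ennreal (side (?w J) j) \<partial>coord_law)"
    by (subst nn_integral_sum[symmetric]) (auto simp: sumH)
  also have "\<dots> * ennreal \<gamma> \<le> ennreal (\<gamma> ^ k) * ennreal \<gamma>"
    using Suc by (intro mult_right_mono) auto
  also have "\<dots> = ennreal (\<gamma> ^ Suc k)"
    using \<gamma> by (simp add: ennreal_mult'[symmetric] mult.commute)
  finally show ?case .
qed

text \<open>Markov's inequality for each coordinate and a union bound over the d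
  coordinates.\<close>

lemma prob_side:
  assumes "\<eta> > 0"
  shows "emeasure coord_law {J \<in> space coord_law. \<exists>j. \<eta> < side (walk S x \<rho> z J K) j} \<le>
    ennreal (real CARD('d) * \<gamma> ^ K / \<eta>)"
proof -
  note [measurable] = measurable_walk_coord[of z K]
  let ?E = "\<lambda>j. {J \<in> space coord_law. \<eta> < side (walk S x \<rho> z J K) j}"
  have E: "?E j \<in> sets coord_law" for j
    by measurable
  have "emeasure coord_law {J \<in> space coord_law. \<exists>j. \<eta> < side (walk S x \<rho> z J K) j} =
      emeasure coord_law (\<Union>j\<in>UNIV. ?E j)"
    by (intro arg_cong[where f = "emeasure _"]) auto
  also have "\<dots> \<le> (\<Sum>j\<in>UNIV. emeasure coord_law (?E j))"
    by (intro emeasure_subadditive_finite) (auto simp: E)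
  also have "\<dots> \<le> (\<Sum>j\<in>(UNIV::'d set). ennreal (\<gamma> ^ K / \<eta>))"
  proof (intro sum_mono)
    fix j
    have "emeasure coord_law (?E j) = (\<integral>\<^sup>+J. indicator (?E j) J \<partial>coord_law)"
      using E by simp
    also have "\<dots> \<le> (\<integral>\<^sup>+J. ennreal (1 / \<eta>) * ennreal (side (walk S x \<rho> z J K) j) \<partial>coord_law)"
      using assms by (intro nn_integral_mono)
        (auto simp: indicator_def ennreal_mult'[symmetric] field_simps simp flip: ennreal_1)
    also have "\<dots> = ennreal (1 / \<eta>) * (\<integral>\<^sup>+J. ennreal (side (walk S x \<rho> z J K) j) \<partial>coord_law)"
      by (intro nn_integral_cmult) measurable
    also have "\<dots> \<le> ennreal (1 / \<eta>) * ennreal (\<gamma> ^ K)"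
      by (intro mult_left_mono expected_side) auto
    also have "\<dots> = ennreal (\<gamma> ^ K / \<eta>)"
      using assms \<gamma> by (simp add: ennreal_mult'[symmetric])
    finally show "emeasure coord_law (?E j) \<le> ennreal (\<gamma> ^ K / \<eta>)" .
  qed
  also have "\<dots> = ennreal (real CARD('d) * \<gamma> ^ K / \<eta>)"
    using assms \<gamma> by (simp add: ennreal_of_nat_eq_real_of_nat ennreal_mult'[symmetric])
  finally show ?thesis .
qed

end

section \<open>Regularity of the sample\<close>

text \<open>Induction on the variables: the one integrated last is absorbed into the constant
  \<open>b\<close>, which is why \<open>b\<close> is general, and its cross term vanishes since
  \<open>g\<close> is centred. The identity yields both the variance of box counts and the split of
  the risk into bias and noise.\<close>

lemma nn_integral_square_sum:
  assumes P: "prob_space P" and g: "integrable P g" "(\<integral>y. g y \<partial>P) = 0"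
    and v: "(\<integral>\<^sup>+y. ennreal ((g y)\<^sup>2) \<partial>P) = ennreal v" "0 \<le> v" and I: "finite I"
  shows "(\<integral>\<^sup>+y. ennreal ((b + (\<Sum>i\<in>I. w i * g (y i)))\<^sup>2) \<partial>(\<Pi>\<^sub>M i\<in>I. P)) =
    ennreal (b\<^sup>2 + v * (\<Sum>i\<in>I. (w i)\<^sup>2))"
  using I
proof (induction I arbitrary: b)
  case empty
  interpret product_sigma_finite "\<lambda>_. P"
    using P by (simp add: product_sigma_finite_def prob_space_imp_sigma_finite)
  show ?case by (simp add: PiM_empty)
next
  case (insert i I)
  interpret P: prob_space P by fact
  interpret product_sigma_finite "\<lambda>_. P"
    using P by (simp add: product_sigma_finite_def prob_space_imp_sigma_finite)
  have gm [measurable]: "g \<in> borel_measurable P"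
    using g by auto
  have sq: "integrable P (\<lambda>y. (g y)\<^sup>2)" and sqv: "(\<integral>y. (g y)\<^sup>2 \<partial>P) = v"
    using v by (auto intro!: integrableI_nonneg simp: integral_eq_nn_integral)
  let ?k = "v * (\<Sum>i\<in>I. (w i)\<^sup>2)"
  have k: "0 \<le> ?k"
    using v by (simp add: sum_nonneg)
  have [measurable]: "(\<lambda>y. g (y k)) \<in> borel_measurable (\<Pi>\<^sub>M i\<in>insert i I. P)" if "k \<in> insert i I" for k
    using measurable_component_singleton[OF that, of "\<lambda>_. P"] by measurable
  have meas: "(\<lambda>y. ennreal ((b + (\<Sum>k\<in>insert i I. w k * g (y k)))\<^sup>2)) \<in> borel_measurable (\<Pi>\<^sub>M i\<in>insert i I. P)"
    by measurable
  have eq: "b + (\<Sum>k\<in>insert i I. w k * g ((y(i := t)) k)) = (b + w i * g t) + (\<Sum>k\<in>I. w k * g (y k))" for y t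
    using insert by (auto intro!: sum.cong)
  have "(\<integral>\<^sup>+y. ennreal ((b + (\<Sum>k\<in>insert i I. w k * g (y k)))\<^sup>2) \<partial>(\<Pi>\<^sub>M i\<in>insert i I. P)) =
      (\<integral>\<^sup>+t. ennreal ((b + w i * g t)\<^sup>2 + ?k) \<partial>P)"
    using product_nn_integral_insert_rev[OF insert(1,2) meas] unfolding eq by (simp only: insert.IH)
  also have "\<dots> = (\<integral>\<^sup>+t. ennreal ((b\<^sup>2 + ?k) + 2 * b * w i * g t + (w i)\<^sup>2 * (g t)\<^sup>2) \<partial>P)"
    by (intro nn_integral_cong arg_cong[where f = ennreal]) (simp add: power2_eq_square algebra_simps)
  also have "\<dots> = ennreal (\<integral>t. (b\<^sup>2 + ?k) + 2 * b * w i * g t + (w i)\<^sup>2 * (g t)\<^sup>2 \<partial>P)"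
  proof (rule nn_integral_eq_integral)
    have "0 \<le> (b + w i * g t)\<^sup>2 + ?k" for t
      using k by simp
    then show "AE t in P. 0 \<le> (b\<^sup>2 + ?k) + 2 * b * w i * g t + (w i)\<^sup>2 * (g t)\<^sup>2"
      by (simp add: power2_eq_square algebra_simps)
  qed (use g sq in \<open>auto intro!: integrable_add integrable_mult_right\<close>)
  also have "(\<integral>t. (b\<^sup>2 + ?k) + 2 * b * w i * g t + (w i)\<^sup>2 * (g t)\<^sup>2 \<partial>P) = b\<^sup>2 + ?k + (w i)\<^sup>2 * v"
    using g sq sqv by (simp add: P.prob_space)
  also have "\<dots> = b\<^sup>2 + v * (\<Sum>i\<in>insert i I. (w i)\<^sup>2)"
    using insert by (simp add: algebra_simps)
  finally show ?case .
qed

text \<open>Rounding a box with sides at least \<open>s \<ge> 4 / G\<close> to the grid of mesh \<open>1 / G\<close> changes every side by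
  at most half of its length, which costs the factors \<open>1 / 2 ^ d\<close> and \<open>(3 / 2) ^ d\<close>.\<close>

lemma box_regular_of_grid:
  fixes x :: "nat \<Rightarrow> real ^ 'd::finite" and p :: "('d \<Rightarrow> nat) \<Rightarrow> ('d \<Rightarrow> nat) \<Rightarrow> real" and G :: nat
  assumes S: "finite S" and G: "G > 0" "4 / real G \<le> s" and s: "0 < s"
    and cC: "0 < c" "c \<le> C" and \<delta>: "\<delta> \<le> c / 2 * (s / 2) ^ CARD('d)"
    and p: "\<And>k m. (\<And>j. k j \<le> m j \<and> m j \<le> G) \<Longrightarrow>
      c * (\<Prod>j\<in>UNIV. (real (m j) - real (k j)) / real G) \<le> p k m \<and>
      p k m \<le> C * (\<Prod>j\<in>UNIV. (real (m j) - real (k j)) / real G)"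
    and dev: "\<And>k m. (\<And>j. k j \<le> m j \<and> m j \<le> G) \<Longrightarrow>
      \<bar>real (card {i \<in> S. \<forall>j. real (k j) / real G \<le> x i $ j \<and> x i $ j \<le> real (m j) / real G}) - p k m * card S\<bar>
        \<le> \<delta> * real (card S)"
  shows "box_regular S x s (c / 2 / 2 ^ CARD('d)) (2 * C * (3 / 2) ^ CARD('d))"
  unfolding box_regular_def
proof (intro allI impI)
  fix l u :: "'d \<Rightarrow> real"
  assume lu: "\<forall>j. 0 \<le> l j \<and> l j + s \<le> u j \<and> u j \<le> 1"
  let ?d = "CARD('d)" and ?V = "\<Prod>j\<in>UNIV. u j - l j" and ?g = "real G" and ?N = "real (card S)"
  let ?R = "\<lambda>k m. {i \<in> S. \<forall>j. real (k j) / real G \<le> x i $ j \<and> x i $ j \<le> real (m j) / real G}"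
  have g: "?g > 0" using G by simp
  have Gs: "4 \<le> ?g * s"
    using G g by (simp add: field_simps)
  have side: "s \<le> u j - l j" "0 \<le> l j" "u j \<le> 1" for j
    using lu by (auto simp: algebra_simps)
  have gside: "4 \<le> ?g * (u j - l j)" for j
    using Gs side[of j] g by (meson mult_left_mono less_imp_le order_trans)
  have "s ^ ?d = (\<Prod>j\<in>(UNIV::'d set). s)" by simp
  also have "\<dots> \<le> ?V"
    using side s by (intro prod_mono) auto
  finally have V: "s ^ ?d \<le> ?V" .
  \<comment> \<open>Every box under consideration has volume at least s^d, so the deviation \<delta>
    is at most half of the mass guaranteed for the inner grid box. This leaves the factor c / 2
    below; above, \<delta> is absorbed by doubling C.\<close>
  have "c / 2 * (s / 2) ^ ?d \<le> c / 2 * (1 / 2) ^ ?d * ?V"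
    using V cC by (simp add: power_divide divide_right_mono)
  with \<delta> have \<delta>V: "\<delta> \<le> c / 2 * (1 / 2) ^ ?d * ?V" by simp
  have V0: "0 \<le> ?V"
    using V s by (meson zero_le_power less_imp_le order_trans)
  show "c / 2 / 2 ^ ?d * ?V * ?N \<le> real (card {i \<in> S. \<forall>j. l j < x i $ j \<and> x i $ j < u j}) \<and>
      real (card {i \<in> S. \<forall>j. l j \<le> x i $ j \<and> x i $ j \<le> u j}) \<le> 2 * C * (3 / 2) ^ ?d * ?V * ?N"
  proof
    \<comment> \<open>Rounding inwards: floor plus 1 and ceiling minus 1 put the closed grid box
      strictly inside the open box, also when a face lies on the grid. At most two mesh widths are
      lost out of at least four.\<close>
    define k m where "k j = nat (\<lfloor>?g * l j\<rfloor> + 1)" and "m j = nat (\<lceil>?g * u j\<rceil> - 1)" for j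
    have k: "?g * l j < real (k j)" "real (k j) \<le> ?g * l j + 1" for j
    proof -
      have "0 \<le> \<lfloor>?g * l j\<rfloor>" using g side[of j] by simp
      then have "real (k j) = of_int \<lfloor>?g * l j\<rfloor> + 1" by (simp add: k_def)
      then show "?g * l j < real (k j)" "real (k j) \<le> ?g * l j + 1" by linarith+
    qed
    have m: "real (m j) < ?g * u j" "?g * u j - 1 \<le> real (m j)" for j
    proof -
      have "0 \<le> ?g * l j" using g side[of j] by simp
      then have "4 \<le> ?g * u j" using gside[of j] by (simp add: right_diff_distrib)
      then have "real (m j) = of_int \<lceil>?g * u j\<rceil> - 1" by (simp add: m_def)
      then show "real (m j) < ?g * u j" "?g * u j - 1 \<le> real (m j)" by linarith+
    qed
    have km: "k j \<le> m j \<and> m j \<le> G" for j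
    proof -
      have "?g * u j \<le> ?g * 1" using g side[of j] by (intro mult_left_mono) auto
      then show ?thesis
        using k[of j] m[of j] gside[of j] unfolding right_diff_distrib by linarith
    qed
    have half: "(u j - l j) / 2 \<le> (real (m j) - real (k j)) / ?g" for j
      using k(2)[of j] m(2)[of j] gside[of j] g by (simp add: field_simps)
    have "(1 / 2) ^ ?d * ?V = (\<Prod>j\<in>UNIV. (u j - l j) / 2)"
      by (simp add: prod_dividef power_divide)
    also have "\<dots> \<le> (\<Prod>j\<in>UNIV. (real (m j) - real (k j)) / ?g)"
      using half order_trans[OF less_imp_le[OF s] side(1)] by (intro prod_mono) auto
    finally have "c * ((1 / 2) ^ ?d * ?V) \<le> p k m"
      using p[of k m, OF km] cC by (meson mult_left_mono less_imp_le order_trans)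
    then have "c / 2 * (1 / 2) ^ ?d * ?V \<le> p k m - \<delta>"
      using \<delta>V by simp
    then have "c / 2 * (1 / 2) ^ ?d * ?V * ?N \<le> (p k m - \<delta>) * ?N"
      by (intro mult_right_mono) auto
    also have "\<dots> \<le> real (card (?R k m))"
      using dev[of k m, OF km] unfolding left_diff_distrib by linarith
    also have "\<dots> \<le> real (card {i \<in> S. \<forall>j. l j < x i $ j \<and> x i $ j < u j})"
    proof -
      have "l j < real (k j) / ?g" "real (m j) / ?g < u j" for j
        using k[of j] m[of j] g by (auto simp: field_simps)
      then have "?R k m \<subseteq> {i \<in> S. \<forall>j. l j < x i $ j \<and> x i $ j < u j}"
        by (auto intro: less_le_trans le_less_trans)
      then show ?thesis
        using S by (intro of_nat_mono card_mono) auto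
    qed
    finally show "c / 2 / 2 ^ ?d * ?V * ?N \<le> real (card {i \<in> S. \<forall>j. l j < x i $ j \<and> x i $ j < u j})"
      by (simp add: power_divide)
  next
    \<comment> \<open>Rounding outwards: at most two mesh widths are added to at least four.\<close>
    define k m where "k j = nat \<lfloor>?g * l j\<rfloor>" and "m j = nat \<lceil>?g * u j\<rceil>" for j
    have k: "real (k j) \<le> ?g * l j" "?g * l j - 1 \<le> real (k j)" for j
    proof -
      have "0 \<le> \<lfloor>?g * l j\<rfloor>" using g side[of j] by simp
      then have "real (k j) = of_int \<lfloor>?g * l j\<rfloor>" by (simp add: k_def)
      then show "real (k j) \<le> ?g * l j" "?g * l j - 1 \<le> real (k j)" by linarith+
    qed
    have m: "?g * u j \<le> real (m j)" "real (m j) \<le> ?g * u j + 1" "m j \<le> G" for j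
    proof -
      have "0 \<le> ?g * l j" using g side[of j] by simp
      then have "4 \<le> ?g * u j" using gside[of j] by (simp add: right_diff_distrib)
      then have "real (m j) = of_int \<lceil>?g * u j\<rceil>" by (simp add: m_def)
      then show "?g * u j \<le> real (m j)" "real (m j) \<le> ?g * u j + 1" by linarith+
      have "?g * u j \<le> of_int (int G)" using g side[of j] by simp
      then show "m j \<le> G" unfolding m_def by (simp only: nat_le_iff ceiling_le_iff)
    qed
    have km: "k j \<le> m j \<and> m j \<le> G" for j
      using k[of j] m[of j] gside[of j] unfolding right_diff_distrib by linarith
    have half: "(real (m j) - real (k j)) / ?g \<le> 3 / 2 * (u j - l j)" for j
      using k(2)[of j] m(2)[of j] gside[of j] g by (simp add: field_simps)
    have "(\<Prod>j\<in>UNIV. (real (m j) - real (k j)) / ?g) \<le> (\<Prod>j\<in>UNIV. 3 / 2 * (u j - l j))"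
      using half km by (intro prod_mono) auto
    also have "\<dots> = (3 / 2) ^ ?d * ?V"
      by (simp only: prod.distrib prod_constant)
    finally have "p k m \<le> C * ((3 / 2) ^ ?d * ?V)"
      using p[of k m, OF km] cC by (meson mult_left_mono less_imp_le order_trans)
    moreover have "\<delta> \<le> C * ((3 / 2) ^ ?d * ?V)"
    proof -
      have "(1 / 2) ^ ?d \<le> (3 / 2 :: real) ^ ?d"
        by (intro power_mono) auto
      then have "c / 2 * ((1 / 2) ^ ?d * ?V) \<le> C * ((3 / 2) ^ ?d * ?V)"
        using cC V0 by (intro mult_mono) auto
      with \<delta>V show ?thesis by simp
    qed
    ultimately have pd: "p k m + \<delta> \<le> 2 * C * (3 / 2) ^ ?d * ?V"
      by simp
    have "real (card {i \<in> S. \<forall>j. l j \<le> x i $ j \<and> x i $ j \<le> u j}) \<le> real (card (?R k m))"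
    proof -
      have "real (k j) / ?g \<le> l j" "u j \<le> real (m j) / ?g" for j
        using k[of j] m[of j] g by (auto simp: field_simps)
      then have "{i \<in> S. \<forall>j. l j \<le> x i $ j \<and> x i $ j \<le> u j} \<subseteq> ?R k m"
        by (auto intro: order_trans)
      then show ?thesis
        using S by (intro of_nat_mono card_mono) auto
    qed
    also have "\<dots> \<le> (p k m + \<delta>) * ?N"
      using dev[of k m, OF km] unfolding distrib_right by linarith
    also have "\<dots> \<le> 2 * C * (3 / 2) ^ ?d * ?V * ?N"
      using pd by (intro mult_right_mono) auto
    finally show "real (card {i \<in> S. \<forall>j. l j \<le> x i $ j \<and> x i $ j \<le> u j}) \<le> 2 * C * (3 / 2) ^ ?d * ?V * ?N" .
  qed
qed

section \<open>Law of the covariates and concentration of box counts\<close>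

locale covariate_law = prob_space P for P :: "(real ^ 'd::finite) measure" +
  fixes c C :: real
  assumes sets_P [measurable_cong, simp]: "sets P = sets borel"
    and AE_unit: "AE z in P. z \<in> cbox 0 1"
    and c_pos: "0 < c"
    and prob_box: "\<And>l u. (\<And>j. 0 \<le> l $ j \<and> l $ j \<le> u $ j \<and> u $ j \<le> 1) \<Longrightarrow>
      c * (\<Prod>j\<in>UNIV. u $ j - l $ j) \<le> prob (cbox l u) \<and> prob (cbox l u) \<le> C * (\<Prod>j\<in>UNIV. u $ j - l $ j)"
    and null_hyperplane: "\<And>j t. emeasure P {z. z $ j = t} = 0"
begin

lemma c_le_C: "c \<le> C"
  using order_trans[OF conjunct1[OF prob_box[of 0 1]] conjunct2[OF prob_box[of 0 1]]] by simp

lemma space_P [simp]: "space P = UNIV"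
  using sets_eq_imp_space_eq[OF sets_P] by simp

sublocale sample: product_sigma_finite "\<lambda>_ :: nat. P"
  by (simp add: product_sigma_finite_def sigma_finite_measure_axioms)

text \<open>With the other points fixed, a tie in coordinate \<open>j\<close> forces
  \<open>x i\<close> into one hyperplane, which is a null set; there are finitely many pairs and
  coordinates.\<close>

lemma AE_tie_free:
  "AE x in (\<Pi>\<^sub>M i\<in>{..<n}. P). \<forall>j. inj_on (\<lambda>i. x i $ j) {..<n :: nat}"
proof -
  have "AE x in (\<Pi>\<^sub>M i\<in>{..<n}. P). x i $ j \<noteq> x k $ j" if ik: "i < n" "k < n" "i \<noteq> k" for i k j
  proof -
    have [measurable]: "(\<lambda>x. x l) \<in> (\<Pi>\<^sub>M i\<in>{..<n}. P) \<rightarrow>\<^sub>M borel" if "l < n" for l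
      using measurable_component_singleton[of l "{..<n}" "\<lambda>_. P"] that by (simp cong: measurable_cong_sets)
    have ins: "insert i ({..<n} - {i}) = {..<n}"
      using ik by auto
    let ?A = "{x \<in> space (\<Pi>\<^sub>M i\<in>{..<n}. P). x i $ j = x k $ j}"
    have A: "?A \<in> sets (\<Pi>\<^sub>M i\<in>{..<n}. P)"
      using ik by measurable
    have "emeasure (\<Pi>\<^sub>M i\<in>{..<n}. P) ?A = (\<integral>\<^sup>+x. indicator ?A x \<partial>(\<Pi>\<^sub>M i\<in>{..<n}. P))"
      using A by simp
    also have "\<dots> = (\<integral>\<^sup>+x. (\<integral>\<^sup>+y. indicator ?A (x(i := y)) \<partial>P) \<partial>(\<Pi>\<^sub>M i\<in>{..<n} - {i}. P))"
      by (rule sample.product_nn_integral_insert[of "{..<n} - {i}" i "indicator ?A", unfolded ins])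
        (use A in auto)
    also have "\<dots> = (\<integral>\<^sup>+x. 0 \<partial>(\<Pi>\<^sub>M i\<in>{..<n} - {i}. P))"
    proof (intro nn_integral_cong)
      fix x
      have "(\<integral>\<^sup>+y. indicator ?A (x(i := y)) \<partial>P) \<le> (\<integral>\<^sup>+y. indicator {y. y $ j = x k $ j} y \<partial>P)"
        using ik by (intro nn_integral_mono) (auto simp: indicator_def)
      also have "\<dots> = emeasure P {y. y $ j = x k $ j}"
        by (rule nn_integral_indicator) (simp, measurable)
      also have "\<dots> = 0"
        by (rule null_hyperplane)
      finally show "(\<integral>\<^sup>+y. indicator ?A (x(i := y)) \<partial>P) = 0" by simp
    qed
    finally have "emeasure (\<Pi>\<^sub>M i\<in>{..<n}. P) ?A = 0" by simp
    with A show ?thesis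
      by (subst AE_iff_measurable[OF A]) auto
  qed
  then have "AE x in (\<Pi>\<^sub>M i\<in>{..<n}. P). \<forall>j\<in>UNIV. \<forall>i\<in>{..<n}. \<forall>k\<in>{..<n}. i \<noteq> k \<longrightarrow> x i $ j \<noteq> x k $ j"
    by (intro AE_finite_allI) (auto intro: AE_I2)
  then show ?thesis
    by eventually_elim (auto simp: inj_on_def)
qed

lemma AE_sample_unit: "AE x in (\<Pi>\<^sub>M i\<in>{..<n}. P). \<forall>i<n :: nat. x i \<in> cbox 0 1"
proof -
  have "AE x in (\<Pi>\<^sub>M i\<in>{..<n}. P). \<forall>i\<in>{..<n}. x i \<in> cbox 0 1"
    by (intro AE_finite_allI AE_PiM_component AE_unit prob_space_axioms) auto
  then show ?thesis
    by (simp add: Ball_def)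
qed

text \<open>Chebyshev's inequality: the centred indicators are independent with second moment at
  most 1, so the variance of the count is at most \<open>card S\<close>.\<close>

lemma chebyshev_sample:
  fixes n :: nat
  assumes R [measurable]: "R \<in> sets borel" and S: "S \<subseteq> {..<n}" "S \<noteq> {}" and \<delta>: "0 < \<delta>"
  defines "A \<equiv> {x \<in> space (\<Pi>\<^sub>M i\<in>{..<n}. P). \<delta> * real (card S) < \<bar>real (card {i \<in> S. x i \<in> R}) - prob R * card S\<bar>}"
  shows "A \<in> sets (\<Pi>\<^sub>M i\<in>{..<n}. P)" and "emeasure (\<Pi>\<^sub>M i\<in>{..<n}. P) A \<le> ennreal (1 / \<delta>\<^sup>2 / card S)"
proof -
  let ?M = "\<Pi>\<^sub>M i\<in>{..<n}. P" and ?N = "real (card S)"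
  define g where "g y = indicator R y - prob R" for y
  \<comment> \<open>The summand 0 and the 0-1 weights give the deviation the form required by
    \<open>nn_integral_square_sum\<close>, with the integral over the whole sample.\<close>
  define D where "D x = 0 + (\<Sum>i\<in>{..<n}. of_bool (i \<in> S) * g (x i))" for x
  have fS: "finite S"
    using finite_subset[OF S(1)] by simp
  have N: "0 < ?N"
    using S fS by (simp add: card_gt_0_iff)
  have [measurable]: "(\<lambda>x. x l) \<in> ?M \<rightarrow>\<^sub>M borel" if "l < n" for l
    using measurable_component_singleton[of l "{..<n}" "\<lambda>_. P"] that by (simp cong: measurable_cong_sets)
  have [measurable]: "g \<in> borel_measurable borel"
    unfolding g_def by measurable
  have D: "D x = real (card {i \<in> S. x i \<in> R}) - prob R * ?N" for x
  proof -
    have "D x = (\<Sum>i\<in>{..<n}. if i \<in> S then g (x i) else 0)"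
      unfolding D_def add_0_left by (rule sum.cong) auto
    also have "\<dots> = (\<Sum>i\<in>S. g (x i))"
      using S by (subst sum.inter_restrict[symmetric]) (auto simp: Int_absorb1)
    also have "\<dots> = (\<Sum>i\<in>S. indicator R (x i)) - prob R * ?N"
      by (simp add: g_def sum_subtractf)
    also have "(\<Sum>i\<in>S. indicator R (x i)) = real (card {i \<in> S. x i \<in> R})"
      using fS by (simp add: indicator_def sum.If_cases Int_def)
    finally show ?thesis .
  qed
  have Dm [measurable]: "D \<in> borel_measurable ?M"
    unfolding D_def by measurable
  have A: "A = {x \<in> space ?M. \<delta> * ?N < \<bar>D x\<bar>}"
    by (simp add: A_def D)
  show "A \<in> sets ?M"
    unfolding A by measurable
  have gi: "integrable P g"
    unfolding g_def by (intro Bochner_Integration.integrable_diff integrable_real_indicator) (auto simp: emeasure_eq_measure)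
  have g0: "(\<integral>y. g y \<partial>P) = 0"
    unfolding g_def by (subst Bochner_Integration.integral_diff) (auto simp: prob_space[unfolded space_P] emeasure_eq_measure)
  have gb: "(g y)\<^sup>2 \<le> 1" for y
    using abs_le_square_iff[of "g y" 1] by (auto simp: g_def indicator_def)
  have gv: "(\<integral>\<^sup>+y. ennreal ((g y)\<^sup>2) \<partial>P) \<le> 1"
    using nn_integral_mono[of P "\<lambda>y. ennreal ((g y)\<^sup>2)" "\<lambda>_. 1"] gb
    by (simp add: emeasure_space_1[unfolded space_P])
  then obtain v where v: "0 \<le> v" "(\<integral>\<^sup>+y. ennreal ((g y)\<^sup>2) \<partial>P) = ennreal v"
    by (cases "\<integral>\<^sup>+y. ennreal ((g y)\<^sup>2) \<partial>P") (auto simp: top_unique)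
  with gv have v1: "v \<le> 1"
    by simp
  have "(\<Sum>i\<in>{..<n}. (of_bool (i \<in> S))\<^sup>2) = ?N"
    using S by (simp add: of_bool_def if_distrib[of "\<lambda>t. t\<^sup>2"] sum.If_cases Int_absorb1 cong: if_cong)
  then have "(\<integral>\<^sup>+x. ennreal ((D x)\<^sup>2) \<partial>?M) = ennreal (v * ?N)"
    unfolding D_def
    using nn_integral_square_sum[OF prob_space_axioms gi g0 v(2,1), of "{..<n}" 0 "\<lambda>i. of_bool (i \<in> S)"]
    by (simp only: finite_lessThan zero_power2 add_0_left)
  also have "\<dots> \<le> ennreal ?N"
    using v1 N by (intro ennreal_leI) (simp add: mult_left_le_one_le v(1))
  finally have E: "(\<integral>\<^sup>+x. ennreal ((D x)\<^sup>2) \<partial>?M) \<le> ennreal ?N" .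
  have "emeasure ?M A = (\<integral>\<^sup>+x. indicator A x \<partial>?M)"
    using \<open>A \<in> sets ?M\<close> by simp
  also have "\<dots> \<le> (\<integral>\<^sup>+x. ennreal (1 / (\<delta> * ?N)\<^sup>2) * ennreal ((D x)\<^sup>2) \<partial>?M)"
  proof (intro nn_integral_mono)
    fix x
    have "1 \<le> 1 / (\<delta> * ?N)\<^sup>2 * (D x)\<^sup>2" if "\<delta> * ?N < \<bar>D x\<bar>"
    proof -
      have "(\<delta> * ?N)\<^sup>2 \<le> \<bar>D x\<bar>\<^sup>2"
        using that \<delta> N by (intro power_mono) auto
      then show ?thesis using \<delta> N by simp
    qed
    then show "indicator A x \<le> ennreal (1 / (\<delta> * ?N)\<^sup>2) * ennreal ((D x)\<^sup>2)"
      by (auto simp: A indicator_def ennreal_mult'[symmetric] simp flip: ennreal_1 intro!: ennreal_leI)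
  qed
  also have "\<dots> = ennreal (1 / (\<delta> * ?N)\<^sup>2) * (\<integral>\<^sup>+x. ennreal ((D x)\<^sup>2) \<partial>?M)"
    by (intro nn_integral_cmult) measurable
  also have "\<dots> \<le> ennreal (1 / (\<delta> * ?N)\<^sup>2) * ennreal ?N"
    by (intro mult_left_mono E) auto
  also have "\<dots> = ennreal (1 / \<delta>\<^sup>2 / ?N)"
    using N \<delta> by (subst ennreal_mult[symmetric]) (auto simp: power2_eq_square mult.assoc)
  finally show "emeasure ?M A \<le> ennreal (1 / \<delta>\<^sup>2 / ?N)" .
qed

text \<open>A union bound over the finitely many grid boxes. The constant \<open>L\<close> depends
  on \<open>s\<close> but neither on \<open>n\<close> nor on \<open>S\<close>, so the failure
  probability vanishes as the subsample size grows.\<close>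

lemma box_regular_likely:
  assumes s: "0 < s"
  obtains L where "0 \<le> L" and "\<And>n S. S \<subseteq> {..<n} \<Longrightarrow> S \<noteq> {} \<Longrightarrow>
    \<exists>B \<in> sets (\<Pi>\<^sub>M i\<in>{..<n}. P). emeasure (\<Pi>\<^sub>M i\<in>{..<n}. P) B \<le> ennreal (L / real (card S)) \<and>
      (\<forall>x \<in> space (\<Pi>\<^sub>M i\<in>{..<n}. P) - B.
        box_regular S x s (c / 2 / 2 ^ CARD('d)) (2 * C * (3 / 2) ^ CARD('d)))"
proof -
  define G where "G = nat \<lceil>4 / s\<rceil>"
  have "4 / s \<le> real G" "0 < 4 / s"
    using s unfolding G_def by (auto intro: real_nat_ceiling_ge)
  then have G: "0 < real G" "4 / real G \<le> s"
    using s by (linarith, smt (verit) divide_le_eq mult.commute)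
  define \<delta> where "\<delta> = c / 2 * (s / 2) ^ CARD('d)"
  have \<delta>: "0 < \<delta>"
    using s c_pos by (simp add: \<delta>_def)
  define F where "F = {k :: 'd \<Rightarrow> nat. range k \<subseteq> {..G}}"
  have F: "finite F"
    using finite_set_of_finite_funs[of "UNIV :: 'd set" "{..G}"] by (auto simp: F_def image_subset_iff)
  define R :: "('d \<Rightarrow> nat) \<Rightarrow> ('d \<Rightarrow> nat) \<Rightarrow> (real ^ 'd) set"
    where "R k m = cbox (\<chi> j. real (k j) / real G) (\<chi> j. real (m j) / real G)" for k m
  \<comment> \<open>All pairs of corners are counted, including those that span no box; this only
    enlarges \<open>L\<close>.\<close>
  define L where "L = real (card (F \<times> F)) / \<delta>\<^sup>2"
  show thesis
  proof
    show "0 \<le> L"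
      by (simp add: L_def)
    fix n and S :: "nat set" assume S: "S \<subseteq> {..<n}" "S \<noteq> {}"
    let ?M = "\<Pi>\<^sub>M i\<in>{..<n}. P"
    define A where "A = (\<lambda>(k, m). {x \<in> space ?M.
      \<delta> * real (card S) < \<bar>real (card {i \<in> S. x i \<in> R k m}) - prob (R k m) * card S\<bar>})"
    have R: "R k m \<in> sets borel" for k m
      by (simp add: R_def)
    have A: "A e \<in> sets ?M" "emeasure ?M (A e) \<le> ennreal (1 / \<delta>\<^sup>2 / card S)" for e
      using chebyshev_sample[OF R S \<delta>, of "fst e" "snd e"] unfolding A_def split_beta by (simp_all only:)
    show "\<exists>B \<in> sets ?M. emeasure ?M B \<le> ennreal (L / real (card S)) \<and>
      (\<forall>x \<in> space ?M - B. box_regular S x s (c / 2 / 2 ^ CARD('d)) (2 * C * (3 / 2) ^ CARD('d)))"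
    proof (intro bexI conjI ballI)
      show "(\<Union>e\<in>F \<times> F. A e) \<in> sets ?M"
        using F A by auto
      have "emeasure ?M (\<Union>e\<in>F \<times> F. A e) \<le> (\<Sum>e\<in>F \<times> F. emeasure ?M (A e))"
        using F A by (intro emeasure_subadditive_finite) auto
      also have "\<dots> \<le> (\<Sum>e\<in>F \<times> F. ennreal (1 / \<delta>\<^sup>2 / card S))"
        by (intro sum_mono A)
      also have "\<dots> = ennreal (L / real (card S))"
        by (simp add: L_def ennreal_of_nat_eq_real_of_nat ennreal_mult'[symmetric])
      finally show "emeasure ?M (\<Union>e\<in>F \<times> F. A e) \<le> ennreal (L / real (card S))" .
      fix x assume x: "x \<in> space ?M - (\<Union>e\<in>F \<times> F. A e)"
      show "box_regular S x s (c / 2 / 2 ^ CARD('d)) (2 * C * (3 / 2) ^ CARD('d))"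
      proof (rule box_regular_of_grid[where G = G and \<delta> = \<delta> and p = "\<lambda>k m. prob (R k m)"])
        fix k m :: "'d \<Rightarrow> nat"
        assume km: "\<And>j. k j \<le> m j \<and> m j \<le> G"
        show "c * (\<Prod>j\<in>UNIV. (real (m j) - real (k j)) / real G) \<le> prob (R k m) \<and>
            prob (R k m) \<le> C * (\<Prod>j\<in>UNIV. (real (m j) - real (k j)) / real G)"
          using prob_box[of "\<chi> j. real (k j) / real G" "\<chi> j. real (m j) / real G"] km G(1)
          by (simp add: R_def divide_right_mono diff_divide_distrib)
        have kmF: "(k, m) \<in> F \<times> F"
          using km by (auto simp: F_def intro: order_trans)
        have "{i \<in> S. x i \<in> R k m} =
          {i \<in> S. \<forall>j. real (k j) / real G \<le> x i $ j \<and> x i $ j \<le> real (m j) / real G}"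
          by (auto simp: R_def mem_box_cart)
        moreover have "x \<notin> A (k, m)"
          using x kmF by blast
        ultimately show "\<bar>real (card {i \<in> S. \<forall>j. real (k j) / real G \<le> x i $ j \<and> x i $ j \<le> real (m j) / real G})
            - prob (R k m) * card S\<bar> \<le> \<delta> * real (card S)"
          using x by (auto simp: A_def not_less)
      qed (use S G s c_pos c_le_C finite_subset \<delta>_def in auto)
    qed
  qed
qed

end

section \<open>Weights and bias of the infinite forest\<close>

locale quantile_forest =
  fixes n a :: nat and q :: real and Q :: "'u measure" and \<kappa> :: "('u, 'd::finite) quantile_rule"
  assumes a: "1 \<le> a" "a \<le> n" and q: "1/2 \<le> q" "q < 1" and Q: "prob_space Q"
    and admissible: "admissible_rule q n Q \<kappa>"
begin

definition "subsamples = {S. S \<subseteq> {..<n} \<and> card S = a}"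

abbreviation "\<Theta> \<equiv> theta_law n a Q :: (nat set \<times> (bool list \<Rightarrow> 'd) \<times> 'u) measure"

abbreviation sample_space :: "(nat \<Rightarrow> real ^ 'd) measure" where
  "sample_space \<equiv> \<Pi>\<^sub>M i\<in>{..<n}. borel"

definition selected ::
    "nat set \<times> (bool list \<Rightarrow> 'd) \<times> 'u \<Rightarrow> (nat \<Rightarrow> real ^ 'd) \<Rightarrow> real ^ 'd \<Rightarrow> nat set" where
  "selected \<theta> x z = (case \<theta> of (S, J, u) \<Rightarrow> final_points S x J (\<kappa> u S (restrict x S)) z)"

definition weight :: "nat \<Rightarrow> (nat \<Rightarrow> real ^ 'd) \<Rightarrow> real ^ 'd \<Rightarrow> real" where
  "weight i x z = measure \<Theta> {\<theta> \<in> space \<Theta>. selected \<theta> x z = {i}}"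

lemma theta_law_eq: "\<Theta> = uniform_count_measure subsamples \<Otimes>\<^sub>M (coord_law \<Otimes>\<^sub>M Q)"
  by (simp add: theta_law_def subsamples_def)

lemma finite_subsamples: "finite subsamples"
  by (rule finite_subset[of _ "Pow {..<n}"]) (auto simp: subsamples_def)

lemma card_subsamples: "card subsamples = n choose a"
  using n_subsets[of "{..<n}" a] by (simp add: subsamples_def)

lemma subsamples_nonempty: "subsamples \<noteq> {}"
  using card_subsamples a by (metis binomial_eq_0_iff card.empty not_le)

lemma prob_space_subsamples: "prob_space (uniform_count_measure subsamples)"
  by (intro prob_space_uniform_count_measure finite_subsamples subsamples_nonempty)

lemma prob_space_tree_randomness: "prob_space ((coord_law :: (bool list \<Rightarrow> 'd) measure) \<Otimes>\<^sub>M Q)"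
proof -
  interpret pair_prob_space "coord_law :: (bool list \<Rightarrow> 'd) measure" Q
    by (simp add: pair_prob_space_def pair_sigma_finite_def Q prob_space_coord_law prob_space_imp_sigma_finite)
  show ?thesis by unfold_locales
qed

lemma prob_space_theta: "prob_space \<Theta>"
proof -
  interpret pair_prob_space "uniform_count_measure subsamples" "(coord_law :: (bool list \<Rightarrow> 'd) measure) \<Otimes>\<^sub>M Q"
    by (simp add: pair_prob_space_def pair_sigma_finite_def prob_space_subsamples prob_space_tree_randomness prob_space_imp_sigma_finite)
  show ?thesis unfolding theta_law_eq by unfold_locales
qed

lemma rule_bounds:
  assumes "S \<in> subsamples" "I \<subseteq> S" "card I > 2" "u \<in> space Q"
  shows "\<kappa> u S (restrict x S) h j I \<in> {1 - q..q} \<inter> {1 / real (card I)<..<1 - 1 / real (card I)}"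
proof -
  have "restrict x S \<in> space (\<Pi>\<^sub>M i\<in>S. borel)"
    by (simp add: space_PiM)
  with assms admissible show ?thesis
    unfolding admissible_rule_def subsamples_def by blast
qed

lemma quantile_tree_rule:
  assumes "S \<in> subsamples" "u \<in> space Q"
  shows "quantile_tree S (\<kappa> u S (restrict x S)) q"
proof
  show "finite S"
    using assms by (auto simp: subsamples_def intro: finite_subset)
  show "\<kappa> u S (restrict x S) h j I \<in> {1 - q..q} \<inter> {1 / real (card I)<..<1 - 1 / real (card I)}"
    if "I \<subseteq> S" "card I > 2" for h j I
    by (rule rule_bounds[OF assms(1) that assms(2)])
qed (fact q)+

lemma measurable_final_points_subsample:
  assumes S: "S \<in> subsamples"
  shows "(\<lambda>((J, u), x, z). final_points S x J (\<kappa> u S (restrict x S)) z) \<in>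
    (coord_law \<Otimes>\<^sub>M Q) \<Otimes>\<^sub>M (sample_space \<Otimes>\<^sub>M borel) \<rightarrow>\<^sub>M count_space UNIV"
proof -
  let ?N = "((coord_law :: (bool list \<Rightarrow> 'd) measure) \<Otimes>\<^sub>M Q) \<Otimes>\<^sub>M (sample_space \<Otimes>\<^sub>M (borel :: (real ^ 'd) measure))"
  have S': "S \<subseteq> {..<n}"
    using S by (simp add: subsamples_def)
  have x: "(\<lambda>w. fst (snd w) i) \<in> ?N \<rightarrow>\<^sub>M borel" if "i \<in> S" for i
  proof -
    have "(\<lambda>x. x i) \<in> sample_space \<rightarrow>\<^sub>M borel"
      using that S' by (intro measurable_component_singleton) auto
    moreover have "(\<lambda>w. fst (snd w)) \<in> ?N \<rightarrow>\<^sub>M sample_space"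
      by measurable
    ultimately show ?thesis
      by (rule measurable_compose[rotated])
  qed
  interpret random_tree ?N S "\<lambda>w. fst (snd w)" "\<lambda>w. fst (fst w)"
    "\<lambda>w. \<kappa> (snd (fst w)) S (restrict (fst (snd w)) S)" "\<lambda>w. snd (snd w)"
  proof
    show "finite S"
      using S' finite_subset by auto
    show "(\<lambda>w. fst (snd w) i) \<in> ?N \<rightarrow>\<^sub>M borel" if "i \<in> S" for i
      using x that .
    show "(\<lambda>w. fst (fst w) v) \<in> ?N \<rightarrow>\<^sub>M count_space UNIV" for v
      by (rule measurable_compose[OF _ measurable_coord]) simp
    show "(\<lambda>w. snd (snd w)) \<in> borel_measurable ?N"
      by simp
    fix h j I assume I: "I \<subseteq> S" "card I > 2"
    have "(\<lambda>w. (snd (fst w), restrict (fst (snd w)) S)) \<in> ?N \<rightarrow>\<^sub>M Q \<Otimes>\<^sub>M (\<Pi>\<^sub>M i\<in>S. borel)"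
      using x by (intro measurable_Pair measurable_restrict) auto
    moreover have "(\<lambda>(u, x). \<kappa> u S x h j I) \<in> borel_measurable (Q \<Otimes>\<^sub>M (\<Pi>\<^sub>M i\<in>S. borel))"
      using admissible S' I unfolding admissible_rule_def by blast
    ultimately show "(\<lambda>w. \<kappa> (snd (fst w)) S (restrict (fst (snd w)) S) h j I) \<in> borel_measurable ?N"
      using measurable_compose by fastforce
    show "\<kappa> (snd (fst w)) S (restrict (fst (snd w)) S) h j I < 1" if "w \<in> space ?N" for w
      using rule_bounds[OF S I, of "snd (fst w)" "fst (snd w)" h j] that q
      by (auto simp: space_pair_measure)
  qed
  have "(\<lambda>w. final_points S (fst (snd w)) (fst (fst w)) (\<kappa> (snd (fst w)) S (restrict (fst (snd w)) S)) (snd (snd w)))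
      \<in> ?N \<rightarrow>\<^sub>M count_space UNIV"
    by (rule measurable_compose[OF measurable_final_points]) simp
  then show ?thesis
    by (simp add: split_beta')
qed

text \<open>The subsample takes finitely many values, so joint measurability reduces to a fixed
  subsample. The query point is included because the risk integrates over it.\<close>

lemma measurable_selected:
  "(\<lambda>(\<theta>, x, z). selected \<theta> x z) \<in> \<Theta> \<Otimes>\<^sub>M (sample_space \<Otimes>\<^sub>M borel) \<rightarrow>\<^sub>M count_space UNIV"
proof -
  let ?T = "(coord_law :: (bool list \<Rightarrow> 'd) measure) \<Otimes>\<^sub>M Q"
  let ?X = "sample_space \<Otimes>\<^sub>M (borel :: (real ^ 'd) measure)"
  let ?f = "\<lambda>(S, (J, u), x, z). final_points S x J (\<kappa> u S (restrict x S)) z"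
  have f: "?f \<in> count_space subsamples \<Otimes>\<^sub>M (?T \<Otimes>\<^sub>M ?X) \<rightarrow>\<^sub>M count_space UNIV"
    by (rule measurable_pair_measure_countable1)
      (use finite_subsamples measurable_final_points_subsample in \<open>auto simp: countable_finite\<close>)
  have "(\<lambda>w. (fst (fst w), (snd (fst w), snd w))) \<in>
      (count_space subsamples \<Otimes>\<^sub>M ?T) \<Otimes>\<^sub>M ?X \<rightarrow>\<^sub>M count_space subsamples \<Otimes>\<^sub>M (?T \<Otimes>\<^sub>M ?X)"
    by measurable
  from measurable_compose[OF this f]
  have "(\<lambda>(\<theta>, x, z). selected \<theta> x z) \<in> (count_space subsamples \<Otimes>\<^sub>M ?T) \<Otimes>\<^sub>M ?X \<rightarrow>\<^sub>M count_space UNIV"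
    by (simp add: selected_def split_beta')
  also have "(count_space subsamples \<Otimes>\<^sub>M ?T) \<Otimes>\<^sub>M ?X \<rightarrow>\<^sub>M count_space UNIV = \<Theta> \<Otimes>\<^sub>M ?X \<rightarrow>\<^sub>M count_space UNIV"
    unfolding theta_law_eq
    by (intro measurable_cong_sets sets_pair_measure_cong refl) (simp add: sets_uniform_count_measure_count_space)
  finally show ?thesis .
qed

lemma selected_cong:
  assumes "\<theta> \<in> space \<Theta>"
  shows "selected \<theta> x z = selected \<theta> (restrict x {..<n}) z"
proof -
  obtain S J u where \<theta>: "\<theta> = (S, J, u)"
    by (cases \<theta>)
  have S: "S \<subseteq> {..<n}"
    using assms by (auto simp: \<theta> theta_law_eq space_pair_measure space_uniform_count_measure subsamples_def)
  then have "restrict x S = restrict (restrict x {..<n}) S"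
    by (auto simp: restrict_def fun_eq_iff)
  then show ?thesis
    using S by (auto simp: \<theta> selected_def intro!: final_points_cong)
qed

lemma measurable_selected_theta: "(\<lambda>\<theta>. selected \<theta> x z) \<in> \<Theta> \<rightarrow>\<^sub>M count_space UNIV"
proof -
  have "(restrict x {..<n}, z) \<in> space (sample_space \<Otimes>\<^sub>M borel)"
    by (simp add: space_pair_measure space_PiM)
  from measurable_compose[OF measurable_Pair2'[OF this] measurable_selected]
  have "(\<lambda>\<theta>. selected \<theta> (restrict x {..<n}) z) \<in> \<Theta> \<rightarrow>\<^sub>M count_space UNIV"
    by simp
  then show ?thesis
    by (subst measurable_cong[OF selected_cong])
qed

lemma pred_selected_theta [measurable]: "Measurable.pred \<Theta> (\<lambda>\<theta>. selected \<theta> x z = {i})"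
  using measurable_compose[OF measurable_selected_theta, of "\<lambda>A. A = {i}" "count_space UNIV"] by simp

lemma weight_eq: "weight i x z = (\<integral>\<theta>. of_bool (selected \<theta> x z = {i}) \<partial>\<Theta>)"
proof -
  have "weight i x z = (\<integral>\<theta>. indicator {\<theta> \<in> space \<Theta>. selected \<theta> x z = {i}} \<theta> \<partial>\<Theta>)"
    unfolding weight_def by (subst Bochner_Integration.integral_indicator) (auto intro!: arg_cong[where f = "measure _"])
  also have "\<dots> = (\<integral>\<theta>. of_bool (selected \<theta> x z = {i}) \<partial>\<Theta>)"
    by (intro Bochner_Integration.integral_cong) (auto simp: indicator_def)
  finally show ?thesis .
qed

lemma weight_cong: "weight i x z = weight i (restrict x {..<n}) z"
  unfolding weight_def using selected_cong[of _ x z] by (metis (no_types, lifting))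

lemma weight_eqI:
  assumes "\<And>i. i < n \<Longrightarrow> x i = x' i"
  shows "weight k x z = weight k x' z"
proof -
  have "restrict x {..<n} = restrict x' {..<n}"
    using assms by (auto simp: restrict_def)
  then show ?thesis
    using weight_cong[of k x z] weight_cong[of k x' z] by simp
qed

lemma integrable_selected: "integrable \<Theta> (\<lambda>\<theta>. of_bool (selected \<theta> x z = {i}) * (t :: real))"
proof -
  interpret prob_space \<Theta> by (rule prob_space_theta)
  show ?thesis
    by (rule integrable_const_bound[where B = "\<bar>t\<bar>"]) auto
qed

lemma measurable_weight [measurable]:
  "(\<lambda>(x, z). weight i x z) \<in> borel_measurable (sample_space \<Otimes>\<^sub>M borel)"
proof -
  interpret prob_space \<Theta> by (rule prob_space_theta)
  let ?X = "sample_space \<Otimes>\<^sub>M (borel :: (real ^ 'd) measure)"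
  have "(\<lambda>w. (snd w, fst w)) \<in> ?X \<Otimes>\<^sub>M \<Theta> \<rightarrow>\<^sub>M \<Theta> \<Otimes>\<^sub>M ?X"
    by measurable
  from measurable_compose[OF measurable_compose[OF this measurable_selected], of "\<lambda>A. A = {i}" "count_space UNIV"]
  have "Measurable.pred (?X \<Otimes>\<^sub>M \<Theta>) (\<lambda>w. selected (snd w) (fst (fst w)) (snd (fst w)) = {i})"
    by (simp add: split_beta')
  then have "(\<lambda>(w, \<theta>). of_bool (selected \<theta> (fst w) (snd w) = {i}) :: real) \<in> borel_measurable (?X \<Otimes>\<^sub>M \<Theta>)"
    by (simp add: split_beta')
  from borel_measurable_lebesgue_integral[OF this]
  have "(\<lambda>w. \<integral>\<theta>. (of_bool (selected \<theta> (fst w) (snd w) = {i}) :: real) \<partial>\<Theta>) \<in> borel_measurable ?X" .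
  then show ?thesis
    by (simp add: weight_eq split_beta')
qed

lemma weight_nonneg: "0 \<le> weight i x z"
  by (simp add: weight_def)

lemma selected_subset:
  assumes "\<theta> \<in> space \<Theta>"
  shows "selected \<theta> x z \<subseteq> fst \<theta>" "fst \<theta> \<in> subsamples"
  using assms
  by (auto simp: selected_def final_points_def theta_law_eq space_pair_measure space_uniform_count_measure
      dest: subsetD[OF node_points_subset])

lemma weight_le: "weight i x z \<le> real a / real n"
proof -
  interpret prob_space \<Theta> by (rule prob_space_theta)
  interpret T: prob_space "(coord_law :: (bool list \<Rightarrow> 'd) measure) \<Otimes>\<^sub>M Q"
    by (rule prob_space_tree_randomness)
  let ?A = "{S \<in> subsamples. i \<in> S}"
  have A: "?A \<in> sets (uniform_count_measure subsamples)"
    by (auto simp: sets_uniform_count_measure)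
  have "{\<theta> \<in> space \<Theta>. selected \<theta> x z = {i}} \<subseteq> ?A \<times> space (coord_law \<Otimes>\<^sub>M Q)"
    using selected_subset by (fastforce simp: theta_law_eq space_pair_measure)
  then have "weight i x z \<le> measure \<Theta> (?A \<times> space (coord_law \<Otimes>\<^sub>M Q))"
    unfolding weight_def using A by (intro finite_measure_mono) (auto simp: theta_law_eq intro!: pair_measureI)
  also have "\<dots> = measure (uniform_count_measure subsamples) ?A"
    unfolding theta_law_eq measure_def using A
    by (subst T.emeasure_pair_measure_Times) (auto simp: T.emeasure_space_1)
  also have "\<dots> = real (card ?A) / real (n choose a)"
    by (subst measure_uniform_count_measure) (auto simp: finite_subsamples card_subsamples)
  also have "\<dots> \<le> real a / real n"
  proof (cases "i < n")
    case True
    \<comment> \<open>The subsamples containing \<open>i\<close> are the sets of a - 1 other indices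
      with \<open>i\<close> added. Since n (n - 1 choose a - 1) = a (n choose a), their proportion
      is a / n.\<close>
    have "bij_betw (insert i) {T. T \<subseteq> {..<n} - {i} \<and> card T = a - 1} ?A"
    proof (rule bij_betwI[where g = "\<lambda>S. S - {i}"])
      show "insert i \<in> {T. T \<subseteq> {..<n} - {i} \<and> card T = a - 1} \<rightarrow> ?A"
      proof
        fix T assume T: "T \<in> {T. T \<subseteq> {..<n} - {i} \<and> card T = a - 1}"
        then have "finite T" "i \<notin> T"
          by (auto intro: finite_subset)
        with T a True show "insert i T \<in> ?A"
          by (auto simp: subsamples_def)
      qed
    qed (use True in \<open>auto simp: subsamples_def card_Diff_singleton\<close>)
    from bij_betw_same_card[OF this] have "card ?A = (n - 1) choose (a - 1)"
      using n_subsets[of "{..<n} - {i}" "a - 1"] True by (simp add: card_Diff_singleton)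
    then have "n * card ?A = a * (n choose a)"
      using times_binomial_minus1_eq[of a n] a by simp
    then have "real n * real (card ?A) = real a * real (n choose a)"
      by (metis of_nat_mult)
    moreover have "0 < real (n choose a)"
      using a by simp
    ultimately show ?thesis
      using a by (simp add: field_simps)
  next
    case False
    then have "?A = {}"
      by (auto simp: subsamples_def)
    then show ?thesis
      by (metis card.empty divide_nonneg_nonneg div_0 of_nat_0 of_nat_0_le_iff)
  qed
  finally show ?thesis .
qed

lemma sum_selected_le_1: "(\<Sum>i<n. of_bool (selected \<theta> x z = {i})) \<le> (1 :: real)"
proof (cases "\<exists>i<n. selected \<theta> x z = {i}")
  case True
  then obtain i where "i < n" "selected \<theta> x z = {i}" by auto
  then have "(\<Sum>k<n. of_bool (selected \<theta> x z = {k})) = (\<Sum>k<n. if k = i then 1 else 0 :: real)"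
    by (intro sum.cong) auto
  with \<open>i < n\<close> show ?thesis by simp
qed (auto intro: order_trans[OF eq_refl[OF sum.neutral]])

lemma sum_weight_le_1: "(\<Sum>i<n. weight i x z) \<le> 1"
proof -
  interpret prob_space \<Theta> by (rule prob_space_theta)
  have int: "integrable \<Theta> (\<lambda>\<theta>. of_bool (selected \<theta> x z = {i}) :: real)" for i
    using integrable_selected[where t = 1] by simp
  have "(\<Sum>i<n. weight i x z) = (\<integral>\<theta>. (\<Sum>i<n. of_bool (selected \<theta> x z = {i})) \<partial>\<Theta>)"
    unfolding weight_eq using int by (rule Bochner_Integration.integral_sum[symmetric])
  also have "\<dots> \<le> (\<integral>\<theta>. 1 \<partial>\<Theta>)"
    by (rule integral_mono) (rule Bochner_Integration.integrable_sum, rule int, simp, rule sum_selected_le_1)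
  finally show ?thesis by (simp add: prob_space)
qed

text \<open>Largest weight times total weight.\<close>

lemma sum_weight_square_le: "(\<Sum>i<n. (weight i x z)\<^sup>2) \<le> real a / real n"
proof -
  have "(\<Sum>i<n. (weight i x z)\<^sup>2) \<le> (\<Sum>i<n. real a / real n * weight i x z)"
    unfolding power2_eq_square by (intro sum_mono mult_right_mono weight_le weight_nonneg)
  also have "\<dots> \<le> real a / real n * 1"
    unfolding sum_distrib_left[symmetric] by (intro mult_left_mono sum_weight_le_1) auto
  finally show ?thesis by simp
qed

text \<open>A finite sum of bounded functions of \<theta> is integrated term by term, so the formula
  holds for every data set, with or without ties.\<close>

lemma infinite_forest_eq:
  assumes z: "z \<in> cbox 0 1"
  shows "infinite_forest n a Q \<kappa> D z = (\<Sum>i<n. weight i (\<lambda>i. fst (D i)) z * snd (D i))"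
proof -
  let ?x = "\<lambda>i. fst (D i)"
  have "infinite_forest n a Q \<kappa> D z = (\<integral>\<theta>. (\<Sum>i<n. of_bool (selected \<theta> ?x z = {i}) * snd (D i)) \<partial>\<Theta>)"
    unfolding infinite_forest_def
  proof (rule Bochner_Integration.integral_cong[OF refl])
    fix \<theta> assume \<theta>: "\<theta> \<in> space \<Theta>"
    obtain S J u where eq: "\<theta> = (S, J, u)"
      by (cases \<theta>)
    have S: "S \<in> subsamples" "u \<in> space Q"
      using \<theta> by (auto simp: eq theta_law_eq space_pair_measure space_uniform_count_measure)
    have "tree_estimate S D J (\<kappa> u S (restrict ?x S)) z = (\<Sum>i\<in>S. of_bool (selected \<theta> ?x z = {i}) * snd (D i))"
      using tree_estimate_eq_sum[OF quantile_tree_rule[OF S] z] by (simp add: eq selected_def)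
    also have "\<dots> = (\<Sum>i<n. of_bool (selected \<theta> ?x z = {i}) * snd (D i))"
      using S(1) selected_subset(1)[OF \<theta>, of ?x z] by (intro sum.mono_neutral_left) (auto simp: subsamples_def eq)
    finally show "(case \<theta> of (S, J, u) \<Rightarrow> tree_estimate S D J (\<kappa> u S (restrict ?x S)) z) =
        (\<Sum>i<n. of_bool (selected \<theta> ?x z = {i}) * snd (D i))"
      by (simp add: eq)
  qed
  also have "\<dots> = (\<Sum>i<n. (\<integral>\<theta>. of_bool (selected \<theta> ?x z = {i}) * snd (D i) \<partial>\<Theta>))"
    by (intro Bochner_Integration.integral_sum integrable_selected)
  also have "\<dots> = (\<Sum>i<n. weight i ?x z * snd (D i))"
    by (simp add: weight_eq)
  finally show ?thesis .
qed

end

section \<open>Bias of the forest on an independent sample\<close>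

locale forest_on_law = quantile_forest n a q Q \<kappa> + covariate_law P c C
  for n a :: nat and q :: real and Q :: "'u measure" and \<kappa> :: "('u, 'd::finite) quantile_rule"
    and P :: "(real ^ 'd) measure" and c C :: real
begin

text \<open>The complement of the good event that a single point is selected and lies near
  \<open>z\<close>. It includes the case that no point is selected, so the default value of the
  estimate is covered by the same bound.\<close>

definition far where
  "far \<eta> \<theta> x z \<longleftrightarrow> \<not> (\<exists>i<n. selected \<theta> x z = {i} \<and> (\<forall>j. \<bar>x i $ j - z $ j\<bar> \<le> \<eta>))"

lemma pred_far [measurable]: "Measurable.pred \<Theta> (\<lambda>\<theta>. far \<eta> \<theta> x z)"
  unfolding far_def by measurable

definition "c' = c / 2 / 2 ^ CARD('d)"

definition "C' = 2 * C * (3 / 2) ^ CARD('d)"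

text \<open>The factor \<gamma> of \<open>regular_tree\<close> at the constants \<open>c'\<close>
  and \<open>C'\<close>; it is the same for all samples, subsamples and randomisations.\<close>

definition "contraction = 1 - (1 - q) / 2 * c' / C' / real CARD('d)"

lemma c'C': "0 < c'" "0 < C'"
  using c_pos c_le_C by (auto simp: c'_def C'_def)

text \<open>Sample, subsample and randomisation are fixed, only the coordinates are drawn. Without
  ties exactly one point is selected, and if it is far from \<open>z\<close>, the cell at depth
  \<open>K\<close> has a side longer than \<eta>.\<close>

lemma prob_far_coord:
  assumes S: "S \<in> subsamples" and u: "u \<in> space Q"
    and reg: "box_regular S x s c' C'" and inj: "\<forall>j. inj_on (\<lambda>i. x i $ j) {..<n}"
    and x01: "\<forall>i<n. x i \<in> cbox 0 1" and z: "z \<in> cbox 0 1"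
    and s: "0 < s" "s \<le> 1" "C' * s < ((1 - q) / 2) ^ K"
    and K: "K \<le> a" "2 / (1 - q) \<le> ((1 - q) / 2) ^ K * real a" and \<eta>: "0 < \<eta>"
  shows "emeasure coord_law {J \<in> space coord_law. far \<eta> (S, J, u) x z} \<le>
    ennreal (real CARD('d) * contraction ^ K / \<eta>)"
proof -
  have S': "S \<subseteq> {..<n}" "card S = a"
    using S by (auto simp: subsamples_def)
  interpret quantile_tree S x "\<kappa> u S (restrict x S)" q
    by (rule quantile_tree_rule[OF S u])
  interpret regular_tree S x "\<kappa> u S (restrict x S)" q s c' C' K
  proof
    show "inj_on (\<lambda>i. x i $ j) S" for j
      using inj S' inj_on_subset by blast
    show "0 \<le> x i $ j \<and> x i $ j \<le> 1" if "i \<in> S" for i j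
      using x01 S' that by (auto simp: mem_box_cart)
  qed (use reg s K S' c'C' in auto)
  have "{J \<in> space coord_law. far \<eta> (S, J, u) x z} \<subseteq>
      {J \<in> space coord_law. \<exists>j. \<eta> < side (walk S x (\<kappa> u S (restrict x S)) z J K) j}"
  proof safe
    fix J assume far: "far \<eta> (S, J, u) x z"
    have "S \<noteq> {}"
      using S' a by auto
    then obtain i where i: "i \<in> S" "final_points S x J (\<kappa> u S (restrict x S)) z = {i}"
      using final_points_singleton by blast
    then have "i < n" "selected (S, J, u) x z = {i}"
      using S' by (auto simp: selected_def)
    with far obtain j where "\<eta> < \<bar>x i $ j - z $ j\<bar>"
      by (auto simp: far_def not_le)
    with final_points_near[OF z, of i J j] i K S'
    show "\<exists>j. \<eta> < side (walk S x (\<kappa> u S (restrict x S)) z J K) j"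
      by (auto intro: less_le_trans)
  qed
  moreover have "{J \<in> space coord_law. \<exists>j. \<eta> < side (walk S x (\<kappa> u S (restrict x S)) z J K) j} \<in> sets coord_law"
    using measurable_compose[OF measurable_walk_coord, of "\<lambda>h. \<exists>j. \<eta> < side h j" "count_space UNIV"]
    by (simp add: pred_def)
  ultimately have "emeasure coord_law {J \<in> space coord_law. far \<eta> (S, J, u) x z} \<le>
      emeasure coord_law {J \<in> space coord_law. \<exists>j. \<eta> < side (walk S x (\<kappa> u S (restrict x S)) z J K) j}"
    by (rule emeasure_mono)
  also have "\<dots> \<le> ennreal (real CARD('d) * \<gamma> ^ K / \<eta>)"
    by (rule prob_side[OF \<eta>])
  finally show ?thesis
    by (simp only: \<gamma>_def contraction_def)
qed

text \<open>The coordinate draws are integrated innermost, since their bound holds for each fixed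
  \<open>S\<close> and \<open>u\<close>.\<close>

lemma nn_integral_theta:
  assumes [measurable]: "f \<in> borel_measurable \<Theta>"
  shows "(\<integral>\<^sup>+\<theta>. f \<theta> \<partial>\<Theta>) = (\<Sum>S\<in>subsamples. \<integral>\<^sup>+u. (\<integral>\<^sup>+J. f (S, J, u) \<partial>coord_law) \<partial>Q) / of_nat (card subsamples)"
proof -
  interpret T: prob_space "(coord_law :: (bool list \<Rightarrow> 'd) measure) \<Otimes>\<^sub>M Q"
    by (rule prob_space_tree_randomness)
  interpret CQ: pair_prob_space "coord_law :: (bool list \<Rightarrow> 'd) measure" Q
    by (simp add: pair_prob_space_def pair_sigma_finite_def Q prob_space_coord_law prob_space_imp_sigma_finite)
  have f: "f \<in> borel_measurable (uniform_count_measure subsamples \<Otimes>\<^sub>M (coord_law \<Otimes>\<^sub>M Q))"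
    using assms by (simp add: theta_law_eq)
  have inv: "ennreal (1 / real (card subsamples)) = inverse (of_nat (card subsamples))"
    using finite_subsamples subsamples_nonempty
    by (simp add: card_gt_0_iff divide_inverse inverse_ennreal[symmetric] ennreal_of_nat_eq_real_of_nat)
  have "(\<integral>\<^sup>+\<theta>. f \<theta> \<partial>\<Theta>) = (\<integral>\<^sup>+S. (\<integral>\<^sup>+t. f (S, t) \<partial>(coord_law \<Otimes>\<^sub>M Q)) \<partial>uniform_count_measure subsamples)"
    unfolding theta_law_eq by (rule T.nn_integral_fst[OF f, symmetric])
  also have "\<dots> = (\<Sum>S\<in>subsamples. (\<integral>\<^sup>+t. f (S, t) \<partial>(coord_law \<Otimes>\<^sub>M Q))) / of_nat (card subsamples)"
    unfolding uniform_count_measure_def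
    by (subst nn_integral_point_measure_finite)
      (simp_all add: finite_subsamples inv divide_ennreal_def sum_distrib_left[symmetric] mult.commute)
  also have "(\<Sum>S\<in>subsamples. (\<integral>\<^sup>+t. f (S, t) \<partial>(coord_law \<Otimes>\<^sub>M Q))) =
      (\<Sum>S\<in>subsamples. \<integral>\<^sup>+u. (\<integral>\<^sup>+J. f (S, J, u) \<partial>coord_law) \<partial>Q)"
  proof (intro sum.cong refl)
    fix S assume "S \<in> subsamples"
    then have "(\<lambda>t. f (S, t)) \<in> borel_measurable (coord_law \<Otimes>\<^sub>M Q)"
      using measurable_compose[OF measurable_Pair1' f] by (simp add: space_uniform_count_measure)
    from CQ.nn_integral_snd[OF this]
    show "(\<integral>\<^sup>+t. f (S, t) \<partial>(coord_law \<Otimes>\<^sub>M Q)) = (\<integral>\<^sup>+u. (\<integral>\<^sup>+J. f (S, J, u) \<partial>coord_law) \<partial>Q)"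
      by simp
  qed
  finally show ?thesis .
qed

text \<open>The function \<open>h\<close> is the average over \<open>S\<close> of the coordinate
  bound plus the indicator of the bad set \<open>B S\<close>. It is measurable in the sample and
  does not depend on \<open>z\<close>. Its integral involves the average of the bad probabilities,
  not their sum.\<close>

lemma prob_far:
  assumes B: "\<And>S. S \<in> subsamples \<Longrightarrow> B S \<in> sets (\<Pi>\<^sub>M i\<in>{..<n}. P)"
      "\<And>S. S \<in> subsamples \<Longrightarrow> emeasure (\<Pi>\<^sub>M i\<in>{..<n}. P) (B S) \<le> ennreal \<delta>"
      "\<And>S x. S \<in> subsamples \<Longrightarrow> x \<in> space (\<Pi>\<^sub>M i\<in>{..<n}. P) - B S \<Longrightarrow> box_regular S x s c' C'"
    and \<delta>: "0 \<le> \<delta>"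
    and s: "0 < s" "s \<le> 1" "C' * s < ((1 - q) / 2) ^ K"
    and K: "K \<le> a" "2 / (1 - q) \<le> ((1 - q) / 2) ^ K * real a" and \<eta>: "0 < \<eta>"
  obtains h where "h \<in> borel_measurable (\<Pi>\<^sub>M i\<in>{..<n}. P)"
    and "AE x in (\<Pi>\<^sub>M i\<in>{..<n}. P). \<forall>z \<in> cbox 0 1. emeasure \<Theta> {\<theta> \<in> space \<Theta>. far \<eta> \<theta> x z} \<le> h x"
    and "(\<integral>\<^sup>+x. h x \<partial>(\<Pi>\<^sub>M i\<in>{..<n}. P)) \<le> ennreal (real CARD('d) * contraction ^ K / \<eta>) + ennreal \<delta>"
proof -
  interpret Q: prob_space Q by (rule Q)
  interpret coord: prob_space "coord_law :: (bool list \<Rightarrow> 'd) measure"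
    by (rule prob_space_coord_law)
  let ?MX = "\<Pi>\<^sub>M i\<in>{..<n}. P"
  interpret MX: prob_space ?MX
    by (intro prob_space_PiM prob_space_axioms)
  let ?e = "ennreal (real CARD('d) * contraction ^ K / \<eta>)"
  let ?N = "of_nat (card subsamples) :: ennreal"
  have N: "?N \<noteq> 0" "?N \<noteq> \<top>"
    using finite_subsamples subsamples_nonempty by (auto simp: card_gt_0_iff)
  have avg: "(\<Sum>S\<in>subsamples. t) / ?N = t" for t :: ennreal
    using N by (simp add: mult_divide_eq_ennreal mult.commute[of ?N])
  have pt: "emeasure \<Theta> {\<theta> \<in> space \<Theta>. far \<eta> \<theta> x z} \<le> (\<Sum>S\<in>subsamples. ?e + indicator (B S) x) / ?N"
    if x: "x \<in> space ?MX" "\<forall>j. inj_on (\<lambda>i. x i $ j) {..<n}" "\<forall>i<n. x i \<in> cbox 0 1"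
      and z: "z \<in> cbox 0 1" for x z
  proof -
    have "emeasure \<Theta> {\<theta> \<in> space \<Theta>. far \<eta> \<theta> x z} = (\<integral>\<^sup>+\<theta>. indicator {\<theta> \<in> space \<Theta>. far \<eta> \<theta> x z} \<theta> \<partial>\<Theta>)"
      by simp
    also have "\<dots> = (\<Sum>S\<in>subsamples. \<integral>\<^sup>+u. (\<integral>\<^sup>+J. indicator {\<theta> \<in> space \<Theta>. far \<eta> \<theta> x z} (S, J, u) \<partial>coord_law) \<partial>Q) / ?N"
      by (rule nn_integral_theta) measurable
    also have "\<dots> \<le> (\<Sum>S\<in>subsamples. ?e + indicator (B S) x) / ?N"
    proof (intro divide_right_mono_ennreal sum_mono)
      fix S assume S: "S \<in> subsamples"
      have "(\<integral>\<^sup>+J. indicator {\<theta> \<in> space \<Theta>. far \<eta> \<theta> x z} (S, J, u) \<partial>coord_law) \<le> ?e + indicator (B S) x"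
        if u: "u \<in> space Q" for u
      proof (cases "x \<in> B S")
        case True
        have "(\<integral>\<^sup>+J. indicator {\<theta> \<in> space \<Theta>. far \<eta> \<theta> x z} (S, J, u) \<partial>coord_law) \<le>
            (\<integral>\<^sup>+J. 1 \<partial>(coord_law :: (bool list \<Rightarrow> 'd) measure))"
          by (intro nn_integral_mono) (auto simp: indicator_def)
        also have "\<dots> = 1"
          by (simp add: coord.emeasure_space_1)
        also have "\<dots> \<le> ?e + indicator (B S) x"
          using True by simp
        finally show ?thesis .
      next
        case False
        let ?F = "{J \<in> space coord_law. far \<eta> (S, J, u) x z}"
        have F: "?F \<in> sets coord_law"
        proof -
          have "(\<lambda>J. (S, J, u)) \<in> coord_law \<rightarrow>\<^sub>M \<Theta>"
            using S u unfolding theta_law_eq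
            by (intro measurable_Pair measurable_const) (auto simp: space_uniform_count_measure)
          from measurable_compose[OF this pred_far] show ?thesis
            by (simp add: pred_def)
        qed
        have "(\<integral>\<^sup>+J. indicator {\<theta> \<in> space \<Theta>. far \<eta> \<theta> x z} (S, J, u) \<partial>coord_law) \<le> (\<integral>\<^sup>+J. indicator ?F J \<partial>coord_law)"
          by (intro nn_integral_mono) (auto simp: indicator_def)
        also have "\<dots> = emeasure coord_law ?F"
          using F by simp
        also have "\<dots> \<le> ?e"
          using False x by (intro prob_far_coord[OF S u B(3)[OF S] x(2,3) z s K \<eta>]) auto
        finally show ?thesis
          using False by simp
      qed
      then have "(\<integral>\<^sup>+u. (\<integral>\<^sup>+J. indicator {\<theta> \<in> space \<Theta>. far \<eta> \<theta> x z} (S, J, u) \<partial>coord_law) \<partial>Q) \<le>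
          (\<integral>\<^sup>+u. ?e + indicator (B S) x \<partial>Q)"
        by (intro nn_integral_mono)
      then show "(\<integral>\<^sup>+u. (\<integral>\<^sup>+J. indicator {\<theta> \<in> space \<Theta>. far \<eta> \<theta> x z} (S, J, u) \<partial>coord_law) \<partial>Q) \<le> ?e + indicator (B S) x"
        by (simp add: Q.emeasure_space_1)
    qed
    finally show ?thesis .
  qed
  show thesis
  proof
    show "(\<lambda>x. (\<Sum>S\<in>subsamples. ?e + indicator (B S) x) / ?N) \<in> borel_measurable ?MX"
      using B(1) by (intro borel_measurable_divide_ennreal borel_measurable_sum borel_measurable_add) auto
    show "AE x in ?MX. \<forall>z \<in> cbox 0 1. emeasure \<Theta> {\<theta> \<in> space \<Theta>. far \<eta> \<theta> x z} \<le>
        (\<Sum>S\<in>subsamples. ?e + indicator (B S) x) / ?N"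
      using AE_space AE_tie_free AE_sample_unit by eventually_elim (use pt in blast)
    have "(\<integral>\<^sup>+x. (\<Sum>S\<in>subsamples. ?e + indicator (B S) x) / ?N \<partial>?MX) =
        (\<Sum>S\<in>subsamples. (\<integral>\<^sup>+x. ?e + indicator (B S) x \<partial>?MX)) / ?N"
      using B(1) by (simp add: nn_integral_divide nn_integral_sum)
    also have "\<dots> \<le> (\<Sum>S\<in>subsamples. ?e + ennreal \<delta>) / ?N"
      using B(1,2) by (intro divide_right_mono_ennreal sum_mono) (simp add: nn_integral_add MX.emeasure_space_1)
    finally show "(\<integral>\<^sup>+x. (\<Sum>S\<in>subsamples. ?e + indicator (B S) x) / ?N \<partial>?MX) \<le> ?e + ennreal \<delta>"
      by (simp only: avg)
  qed
qed

text \<open>One factor of the square is bounded by 2 b, the other by the mean error of a single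
  tree: \<delta> if the selected point is near, 2 b otherwise. Weights that sum to less than 1 do no
  harm, as an empty selection counts as far.\<close>

lemma bias_le:
  assumes m: "\<And>x. x \<in> cbox 0 1 \<Longrightarrow> \<bar>m x\<bar> \<le> (b :: real)"
    and mod: "\<And>x y. x \<in> cbox 0 1 \<Longrightarrow> y \<in> cbox 0 1 \<Longrightarrow> (\<forall>j. \<bar>x $ j - y $ j\<bar> \<le> \<eta>) \<Longrightarrow> \<bar>m x - m y\<bar> \<le> \<delta>"
    and \<delta>: "0 \<le> \<delta>" and x: "\<And>i. i < n \<Longrightarrow> x i \<in> cbox 0 1" and z: "z \<in> cbox 0 1"
  shows "((\<Sum>i<n. weight i x z * m (x i)) - m z)\<^sup>2 \<le>
    2 * b * (\<delta> + 2 * b * measure \<Theta> {\<theta> \<in> space \<Theta>. far \<eta> \<theta> x z})"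
proof -
  interpret Th: prob_space \<Theta> by (rule prob_space_theta)
  let ?b = "(\<Sum>i<n. weight i x z * m (x i)) - m z"
  let ?\<Phi> = "\<lambda>\<theta>. (\<Sum>i<n. of_bool (selected \<theta> x z = {i}) * m (x i)) - m z"
  have b: "0 \<le> b"
    using m[OF z] by simp
  have "\<bar>\<Sum>i<n. weight i x z * m (x i)\<bar> \<le> (\<Sum>i<n. \<bar>weight i x z * m (x i)\<bar>)"
    by (rule sum_abs)
  also have "\<dots> \<le> (\<Sum>i<n. weight i x z * b)"
    using m[OF x] weight_nonneg by (intro sum_mono) (auto simp: abs_mult intro!: mult_left_mono)
  also have "\<dots> \<le> 1 * b"
    unfolding sum_distrib_right[symmetric] by (intro mult_right_mono sum_weight_le_1 b)
  finally have b2: "\<bar>?b\<bar> \<le> 2 * b"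
    using m[OF z] by linarith
  have int: "integrable \<Theta> (\<lambda>\<theta>. \<Sum>i<n. of_bool (selected \<theta> x z = {i}) * m (x i))"
    by (intro Bochner_Integration.integrable_sum integrable_selected)
  have "(\<integral>\<theta>. (\<Sum>i<n. of_bool (selected \<theta> x z = {i}) * m (x i)) \<partial>\<Theta>) = (\<Sum>i<n. weight i x z * m (x i))"
    by (subst Bochner_Integration.integral_sum) (rule integrable_selected, simp add: weight_eq)
  then have "?b = (\<integral>\<theta>. ?\<Phi> \<theta> \<partial>\<Theta>)"
    using int by (subst Bochner_Integration.integral_diff) (auto simp: Th.prob_space)
  also have "\<bar>\<dots>\<bar> \<le> (\<integral>\<theta>. \<bar>?\<Phi> \<theta>\<bar> \<partial>\<Theta>)"
    by (rule integral_abs_bound)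
  also have "\<dots> \<le> (\<integral>\<theta>. \<delta> + 2 * b * indicator {\<theta> \<in> space \<Theta>. far \<eta> \<theta> x z} \<theta> \<partial>\<Theta>)"
  proof (rule integral_mono)
    show "integrable \<Theta> (\<lambda>\<theta>. \<bar>?\<Phi> \<theta>\<bar>)"
      using int by (intro integrable_abs Bochner_Integration.integrable_diff) auto
    show "integrable \<Theta> (\<lambda>\<theta>. \<delta> + 2 * b * indicator {\<theta> \<in> space \<Theta>. far \<eta> \<theta> x z} \<theta>)"
      by (intro Bochner_Integration.integrable_add integrable_mult_right integrable_real_indicator)
        (auto simp: Th.emeasure_eq_measure)
    fix \<theta> assume \<theta>: "\<theta> \<in> space \<Theta>"
    show "\<bar>?\<Phi> \<theta>\<bar> \<le> \<delta> + 2 * b * indicator {\<theta> \<in> space \<Theta>. far \<eta> \<theta> x z} \<theta>"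
    proof (cases "\<exists>i<n. selected \<theta> x z = {i}")
      case True
      then obtain i where i: "i < n" "selected \<theta> x z = {i}" by auto
      have "(\<Sum>k<n. of_bool (selected \<theta> x z = {k}) * m (x k)) = (\<Sum>k<n. if k = i then m (x k) else 0)"
        using i by (intro sum.cong) auto
      then have "?\<Phi> \<theta> = m (x i) - m z"
        using i by simp
      moreover have "\<bar>m (x i) - m z\<bar> \<le> 2 * b"
        using m[OF x[OF i(1)]] m[OF z] by linarith
      moreover have "\<bar>m (x i) - m z\<bar> \<le> \<delta>" if "\<not> far \<eta> \<theta> x z"
        using that i by (intro mod x z) (auto simp: far_def)
      ultimately show ?thesis
        using \<delta> \<theta> by (auto simp: indicator_def)
    next
      case False
      then have "far \<eta> \<theta> x z" "?\<Phi> \<theta> = - m z"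
        by (auto simp: far_def)
      then show ?thesis
        using m[OF z] \<theta> \<delta> b by simp
    qed
  qed
  also have "\<dots> = \<delta> + 2 * b * measure \<Theta> {\<theta> \<in> space \<Theta>. far \<eta> \<theta> x z}"
    by (subst Bochner_Integration.integral_add)
      (auto simp: Th.prob_space Th.emeasure_eq_measure intro!: integrable_mult_right integrable_real_indicator)
  finally have "\<bar>?b\<bar> \<le> \<delta> + 2 * b * measure \<Theta> {\<theta> \<in> space \<Theta>. far \<eta> \<theta> x z}" .
  then have "\<bar>?b\<bar> * \<bar>?b\<bar> \<le> 2 * b * (\<delta> + 2 * b * measure \<Theta> {\<theta> \<in> space \<Theta>. far \<eta> \<theta> x z})"
    using b2 b by (intro mult_mono) auto
  then show ?thesis
    by (simp add: power2_eq_square abs_mult_self_eq)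
qed

text \<open>The majorant \<open>h\<close> of the far probability is valid for all queries in the
  cube at once, so integrating over the query keeps the bound and only the sample is left.\<close>

lemma nn_integral_bias_le:
  assumes m: "\<And>x. x \<in> cbox 0 1 \<Longrightarrow> \<bar>m x\<bar> \<le> (b :: real)"
    and mod: "\<And>x y. x \<in> cbox 0 1 \<Longrightarrow> y \<in> cbox 0 1 \<Longrightarrow> (\<forall>j. \<bar>x $ j - y $ j\<bar> \<le> \<eta>) \<Longrightarrow> \<bar>m x - m y\<bar> \<le> \<delta>"
    and \<delta>: "0 \<le> \<delta>" and \<epsilon>: "0 \<le> \<epsilon>"
    and h [measurable]: "h \<in> borel_measurable (\<Pi>\<^sub>M i\<in>{..<n}. P)"
    and far: "AE x in (\<Pi>\<^sub>M i\<in>{..<n}. P). \<forall>z \<in> cbox 0 1. emeasure \<Theta> {\<theta> \<in> space \<Theta>. far \<eta> \<theta> x z} \<le> h x"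
    and h_le: "(\<integral>\<^sup>+x. h x \<partial>(\<Pi>\<^sub>M i\<in>{..<n}. P)) \<le> ennreal \<epsilon>"
  shows "(\<integral>\<^sup>+x. (\<integral>\<^sup>+z. ennreal (((\<Sum>i<n. weight i x z * m (x i)) - m z)\<^sup>2) \<partial>P) \<partial>(\<Pi>\<^sub>M i\<in>{..<n}. P)) \<le>
    ennreal (2 * b * (\<delta> + 2 * b * \<epsilon>))"
proof -
  interpret Th: prob_space \<Theta> by (rule prob_space_theta)
  let ?MX = "\<Pi>\<^sub>M i\<in>{..<n}. P"
  interpret MX: prob_space ?MX
    by (intro prob_space_PiM prob_space_axioms)
  have b: "0 \<le> b"
    using m[of 0] by (simp add: mem_box_cart)
  let ?h = "\<lambda>x. ennreal (2 * b * \<delta>) + ennreal (4 * b\<^sup>2) * h x"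
  have "(\<integral>\<^sup>+x. (\<integral>\<^sup>+z. ennreal (((\<Sum>i<n. weight i x z * m (x i)) - m z)\<^sup>2) \<partial>P) \<partial>?MX) \<le> (\<integral>\<^sup>+x. ?h x \<partial>?MX)"
  proof (rule nn_integral_mono_AE)
    show "AE x in ?MX. (\<integral>\<^sup>+z. ennreal (((\<Sum>i<n. weight i x z * m (x i)) - m z)\<^sup>2) \<partial>P) \<le> ?h x"
      using far AE_sample_unit
    proof eventually_elim
      case (elim x)
      have "ennreal (((\<Sum>i<n. weight i x z * m (x i)) - m z)\<^sup>2) \<le> ?h x" if z: "z \<in> cbox 0 1" for z
      proof -
        let ?F = "{\<theta> \<in> space \<Theta>. far \<eta> \<theta> x z}"
        have "ennreal (((\<Sum>i<n. weight i x z * m (x i)) - m z)\<^sup>2) \<le>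
            ennreal (2 * b * (\<delta> + 2 * b * measure \<Theta> ?F))"
          using elim by (intro ennreal_leI bias_le[OF m mod \<delta> _ z]) auto
        also have "2 * b * (\<delta> + 2 * b * measure \<Theta> ?F) = 2 * b * \<delta> + 4 * b\<^sup>2 * measure \<Theta> ?F"
          by (simp add: power2_eq_square algebra_simps)
        also have "ennreal \<dots> = ennreal (2 * b * \<delta>) + ennreal (4 * b\<^sup>2) * emeasure \<Theta> ?F"
          using b \<delta> by (simp add: Th.emeasure_eq_measure ennreal_mult)
        also have "\<dots> \<le> ?h x"
          using elim z by (intro add_left_mono mult_left_mono) auto
        finally show ?thesis .
      qed
      then have "(\<integral>\<^sup>+z. ennreal (((\<Sum>i<n. weight i x z * m (x i)) - m z)\<^sup>2) \<partial>P) \<le> (\<integral>\<^sup>+z. ?h x \<partial>P)"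
        using AE_unit by (intro nn_integral_mono_AE) (auto elim!: eventually_mono)
      then show ?case
        by (simp add: emeasure_space_1[unfolded space_P])
    qed
  qed
  also have "\<dots> = ennreal (2 * b * \<delta>) + ennreal (4 * b\<^sup>2) * (\<integral>\<^sup>+x. h x \<partial>?MX)"
    by (simp add: nn_integral_add nn_integral_cmult MX.emeasure_space_1)
  also have "\<dots> \<le> ennreal (2 * b * \<delta>) + ennreal (4 * b\<^sup>2) * ennreal \<epsilon>"
    by (intro add_left_mono mult_left_mono h_le) auto
  also have "\<dots> = ennreal (2 * b * \<delta> + 4 * b\<^sup>2 * \<epsilon>)"
    using b \<delta> \<epsilon> by (simp add: ennreal_mult)
  also have "2 * b * \<delta> + 4 * b\<^sup>2 * \<epsilon> = 2 * b * (\<delta> + 2 * b * \<epsilon>)"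
    by (simp add: power2_eq_square algebra_simps)
  finally show ?thesis .
qed

end

section \<open>Independence and the risk\<close>

text \<open>Independent pairs with independent components arise by pairing two independent samples.
  This allows the noise to be integrated with all covariates fixed. The two measures are compared on
  product sets.\<close>

lemma PiM_pair_eq_distr:
  assumes P: "prob_space P" and E: "prob_space E" and I: "finite I"
  shows "distr ((\<Pi>\<^sub>M i\<in>I. P) \<Otimes>\<^sub>M (\<Pi>\<^sub>M i\<in>I. E)) (\<Pi>\<^sub>M i\<in>I. P \<Otimes>\<^sub>M E) (\<lambda>(x, e). \<lambda>i\<in>I. (x i, e i)) =
    (\<Pi>\<^sub>M i\<in>I. P \<Otimes>\<^sub>M E)"
proof -
  interpret P: prob_space P by fact
  interpret E: prob_space E by fact
  interpret PE: pair_prob_space P E ..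
  interpret prodP: product_sigma_finite "\<lambda>_. P"
    by (simp add: product_sigma_finite_def P.sigma_finite_measure_axioms)
  interpret prodE: product_sigma_finite "\<lambda>_. E"
    by (simp add: product_sigma_finite_def E.sigma_finite_measure_axioms)
  interpret prodPE: product_sigma_finite "\<lambda>_. P \<Otimes>\<^sub>M E"
    by (simp add: product_sigma_finite_def PE.P.sigma_finite_measure_axioms)
  interpret XE: prob_space "\<Pi>\<^sub>M i\<in>I. E"
    by (intro prob_space_PiM E)
  let ?X = "\<Pi>\<^sub>M i\<in>I. P" and ?E = "\<Pi>\<^sub>M i\<in>I. E" and ?f = "\<lambda>(x, e). \<lambda>i\<in>I. (x i, e i)"
  have f: "?f \<in> ?X \<Otimes>\<^sub>M ?E \<rightarrow>\<^sub>M (\<Pi>\<^sub>M i\<in>I. P \<Otimes>\<^sub>M E)"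
    unfolding split_beta'
  proof (rule measurable_restrict)
    fix i assume i: "i \<in> I"
    have "(\<lambda>x. x i) \<in> ?X \<rightarrow>\<^sub>M P" "(\<lambda>x. x i) \<in> ?E \<rightarrow>\<^sub>M E"
      using i by (auto intro: measurable_component_singleton)
    then show "(\<lambda>w. (fst w i, snd w i)) \<in> ?X \<Otimes>\<^sub>M ?E \<rightarrow>\<^sub>M P \<Otimes>\<^sub>M E"
      by (intro measurable_Pair) (auto intro: measurable_compose[OF measurable_fst] measurable_compose[OF measurable_snd])
  qed
  show ?thesis
  proof (rule prodPE.PiM_eqI[OF I])
    fix A assume A: "\<And>i. i \<in> I \<Longrightarrow> A i \<in> sets (P \<Otimes>\<^sub>M E)"
    have PiA: "Pi\<^sub>E I A \<in> sets (\<Pi>\<^sub>M i\<in>I. P \<Otimes>\<^sub>M E)"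
      using I A by (rule sets_PiM_I_finite)
    have "emeasure (distr (?X \<Otimes>\<^sub>M ?E) (\<Pi>\<^sub>M i\<in>I. P \<Otimes>\<^sub>M E) ?f) (Pi\<^sub>E I A) =
        (\<integral>\<^sup>+w. indicator (Pi\<^sub>E I A) (?f w) \<partial>(?X \<Otimes>\<^sub>M ?E))"
      using f PiA by (subst nn_integral_distr[symmetric, OF f]) auto
    also have "\<dots> = (\<integral>\<^sup>+x. (\<integral>\<^sup>+e. indicator (Pi\<^sub>E I A) (?f (x, e)) \<partial>?E) \<partial>?X)"
      using measurable_compose[OF f, of "indicator (Pi\<^sub>E I A)" borel] PiA
      by (intro XE.nn_integral_fst[symmetric]) auto
    also have "\<dots> = (\<integral>\<^sup>+x. (\<integral>\<^sup>+e. (\<Prod>i\<in>I. indicator (A i) (x i, e i)) \<partial>?E) \<partial>?X)"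
    proof (intro nn_integral_cong)
      fix x e
      show "indicator (Pi\<^sub>E I A) (?f (x, e)) = (\<Prod>i\<in>I. indicator (A i) (x i, e i) :: ennreal)"
      proof (cases "\<forall>i\<in>I. (x i, e i) \<in> A i")
        case False
        then obtain i where "i \<in> I" "(x i, e i) \<notin> A i" by auto
        then show ?thesis
          using I by (auto simp: prod_zero_iff PiE_iff indicator_def intro!: exI[of _ i])
      qed (auto simp: PiE_iff)
    qed
    also have "\<dots> = (\<integral>\<^sup>+x. (\<Prod>i\<in>I. (\<integral>\<^sup>+e. indicator (A i) (x i, e) \<partial>E)) \<partial>?X)"
      using A by (intro nn_integral_cong prodE.product_nn_integral_prod I)
        (auto simp: space_PiM intro!: measurable_compose[OF measurable_Pair1'])
    also have "\<dots> = (\<Prod>i\<in>I. (\<integral>\<^sup>+x. (\<integral>\<^sup>+e. indicator (A i) (x, e) \<partial>E) \<partial>P))"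
      using A by (intro prodP.product_nn_integral_prod I E.borel_measurable_nn_integral) (auto simp: split_beta')
    also have "\<dots> = (\<Prod>i\<in>I. emeasure (P \<Otimes>\<^sub>M E) (A i))"
      using A by (intro prod.cong refl) (auto simp: E.nn_integral_fst)
    finally show "emeasure (distr (?X \<Otimes>\<^sub>M ?E) (\<Pi>\<^sub>M i\<in>I. P \<Otimes>\<^sub>M E) ?f) (Pi\<^sub>E I A) =
        (\<Prod>i\<in>I. emeasure (P \<Otimes>\<^sub>M E) (A i))" .
  qed simp
qed

lemma independent_prob:
  assumes M: "prob_space M" and ind: "independent M N U N' V" and "A \<in> sets N" "B \<in> sets N'"
  shows "measure M ((U -` A \<inter> space M) \<inter> (V -` B \<inter> space M)) =
    measure M (U -` A \<inter> space M) * measure M (V -` B \<inter> space M)"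
proof -
  interpret prob_space M by fact
  have "indep_set (sets (vimage_algebra (space M) U N)) (sets (vimage_algebra (space M) V N'))"
    using ind by (simp add: independent_def)
  then show ?thesis
    by (rule indep_setD) (use assms in \<open>auto intro: in_vimage_algebra\<close>)
qed

lemma independent_distr:
  assumes M: "prob_space M" and ind: "independent M N U N' V"
  shows "distr M (N \<Otimes>\<^sub>M N') (\<lambda>w. (U w, V w)) = distr M N U \<Otimes>\<^sub>M distr M N' V"
proof -
  interpret prob_space M by fact
  have U [measurable]: "U \<in> M \<rightarrow>\<^sub>M N" and V [measurable]: "V \<in> M \<rightarrow>\<^sub>M N'"
    using ind by (auto simp: independent_def)
  show ?thesis
  proof (rule pair_measure_eqI[symmetric])
    show "sigma_finite_measure (distr M N U)" "sigma_finite_measure (distr M N' V)"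
      by (auto intro!: prob_space_imp_sigma_finite prob_space_distr)
    fix A B assume "A \<in> sets (distr M N U)" "B \<in> sets (distr M N' V)"
    then have AB [measurable]: "A \<in> sets N" "B \<in> sets N'" by auto
    have "(\<lambda>w. (U w, V w)) -` (A \<times> B) \<inter> space M = (U -` A \<inter> space M) \<inter> (V -` B \<inter> space M)"
      by auto
    then show "emeasure (distr M N U) A * emeasure (distr M N' V) B =
        emeasure (distr M (N \<Otimes>\<^sub>M N') (\<lambda>w. (U w, V w))) (A \<times> B)"
      using independent_prob[OF M ind AB]
      by (simp add: emeasure_distr emeasure_eq_measure ennreal_mult)
  qed (simp cong: sets_pair_measure_cong)
qed

text \<open>Every event of the composed variables is an event of \<open>U\<close> or of
  \<open>V\<close>, so the product formula carries over.\<close>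

lemma independent_compose:
  assumes M: "prob_space M" and ind: "independent M N U N' V"
    and f [measurable]: "f \<in> N \<rightarrow>\<^sub>M K" and g [measurable]: "g \<in> N' \<rightarrow>\<^sub>M K'"
  shows "independent M K (\<lambda>w. f (U w)) K' (\<lambda>w. g (V w))"
proof -
  interpret prob_space M by fact
  have U [measurable]: "U \<in> M \<rightarrow>\<^sub>M N" and V [measurable]: "V \<in> M \<rightarrow>\<^sub>M N'"
    using ind by (auto simp: independent_def)
  have fU: "(\<lambda>w. f (U w)) \<in> M \<rightarrow>\<^sub>M K" and gV: "(\<lambda>w. g (V w)) \<in> M \<rightarrow>\<^sub>M K'"
    by measurable
  have s: "sets (vimage_algebra (space M) (\<lambda>w. f (U w)) K) = {(\<lambda>w. f (U w)) -` A \<inter> space M | A. A \<in> sets K}"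
    "sets (vimage_algebra (space M) (\<lambda>w. g (V w)) K') = {(\<lambda>w. g (V w)) -` A \<inter> space M | A. A \<in> sets K'}"
    using measurable_space[OF fU] measurable_space[OF gV] by (auto intro!: sets_vimage_algebra2)
  have "prob (((\<lambda>w. f (U w)) -` A \<inter> space M) \<inter> ((\<lambda>w. g (V w)) -` B \<inter> space M)) =
      prob ((\<lambda>w. f (U w)) -` A \<inter> space M) * prob ((\<lambda>w. g (V w)) -` B \<inter> space M)"
    if A: "A \<in> sets K" and B: "B \<in> sets K'" for A B
  proof -
    have "(\<lambda>w. f (U w)) -` A \<inter> space M = U -` (f -` A \<inter> space N) \<inter> space M"
      "(\<lambda>w. g (V w)) -` B \<inter> space M = V -` (g -` B \<inter> space N') \<inter> space M"
      using measurable_space[OF U] measurable_space[OF V] by auto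
    then show ?thesis
      using independent_prob[OF M ind measurable_sets[OF f A] measurable_sets[OF g B]] by simp
  qed
  then have "indep_set (sets (vimage_algebra (space M) (\<lambda>w. f (U w)) K)) (sets (vimage_algebra (space M) (\<lambda>w. g (V w)) K'))"
    unfolding indep_sets2_eq s using measurable_sets[OF fU] measurable_sets[OF gV] by auto
  with fU gV show ?thesis
    by (simp add: independent_def)
qed

lemma independent_commute:
  assumes M: "prob_space M" and ind: "independent M N U N' V"
  shows "independent M N' V N U"
proof -
  interpret prob_space M by fact
  show ?thesis
    using ind unfolding independent_def indep_sets2_eq by (metis Int_commute mult.commute)
qed

section \<open>Bounding the risk by bias plus noise\<close>

context forest_on_law
begin

text \<open>In the variables covariate and noise, data and query have a product law by
  \<open>law\<close>. Given all covariates and the query the weights are constants, so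
  \<open>nn_integral_square_sum\<close> gives the squared bias plus \<open>v\<close> times the sum
  of the squared weights.\<close>

lemma forest_risk_le:
  fixes M :: "'w measure" and E :: "real measure" and v :: real
    and D :: "nat \<Rightarrow> 'w \<Rightarrow> (real ^ 'd) \<times> real"
  assumes M: "prob_space M" and E: "prob_space E" and sets_E: "sets E = sets borel"
    and E1: "integrable E (\<lambda>e. e)" "(\<integral>e. e \<partial>E) = 0"
    and E2: "(\<integral>\<^sup>+e. ennreal (e\<^sup>2) \<partial>E) = ennreal v" "0 \<le> v"
    and m: "m \<in> borel_measurable borel"
    and X: "X \<in> M \<rightarrow>\<^sub>M borel" "\<And>\<omega>. \<omega> \<in> space M \<Longrightarrow> X \<omega> \<in> cbox 0 1"
    and V: "\<And>i. (\<lambda>\<omega>. (fst (D i \<omega>), snd (D i \<omega>) - m (fst (D i \<omega>)))) \<in> M \<rightarrow>\<^sub>M P \<Otimes>\<^sub>M E"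
    and law: "distr M ((\<Pi>\<^sub>M i\<in>{..<n}. P \<Otimes>\<^sub>M E) \<Otimes>\<^sub>M P)
        (\<lambda>\<omega>. (\<lambda>i\<in>{..<n}. (fst (D i \<omega>), snd (D i \<omega>) - m (fst (D i \<omega>))), X \<omega>)) =
      (\<Pi>\<^sub>M i\<in>{..<n}. P \<Otimes>\<^sub>M E) \<Otimes>\<^sub>M P"
  shows "forest_risk M D X m n a Q \<kappa> \<le>
    (\<integral>\<^sup>+x. (\<integral>\<^sup>+z. ennreal (((\<Sum>i<n. weight i x z * m (x i)) - m z)\<^sup>2) \<partial>P) \<partial>(\<Pi>\<^sub>M i\<in>{..<n}. P)) +
      ennreal (v * real a / real n)"
proof -
  interpret E: prob_space E by (rule E)
  let ?MX = "\<Pi>\<^sub>M i\<in>{..<n}. P" and ?ME = "\<Pi>\<^sub>M i\<in>{..<n}. E" and ?MV = "\<Pi>\<^sub>M i\<in>{..<n}. P \<Otimes>\<^sub>M E"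
  interpret PE: pair_prob_space P E ..
  interpret MX: prob_space ?MX
    by (intro prob_space_PiM prob_space_axioms)
  interpret ME: prob_space ?ME
    by (intro prob_space_PiM E)
  interpret MV: prob_space ?MV
    by (intro prob_space_PiM PE.P.prob_space_axioms)
  interpret MVP: pair_prob_space ?MV P ..
  interpret MXP: pair_prob_space ?MX P ..
  note [measurable_cong] = sets_E
  note [measurable] = m
  have sets_X: "sets ?MX = sets sample_space" by (intro sets_PiM_cong) auto
  have wm: "(\<lambda>w. weight i (fst w) (snd w)) \<in> borel_measurable (?MX \<Otimes>\<^sub>M P)" for i
    using measurable_weight[of i] sets_X by (simp add: split_beta' cong: measurable_cong_sets sets_pair_measure_cong)
  have comp_V: "(\<lambda>v. v i) \<in> ?MV \<rightarrow>\<^sub>M P \<Otimes>\<^sub>M E" and comp_X: "(\<lambda>x. x i) \<in> ?MX \<rightarrow>\<^sub>M borel" if "i < n" for i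
    using measurable_component_singleton[of i "{..<n}" "\<lambda>_. P \<Otimes>\<^sub>M E"]
      measurable_component_singleton[of i "{..<n}" "\<lambda>_. P"] that by (auto cong: measurable_cong_sets)
  \<comment> \<open>The integrand in terms of covariates and noise: the response is \<open>m\<close>
    of the covariate plus the noise.\<close>
  define F where "F v z = ennreal (((\<Sum>i<n. weight i (\<lambda>i. fst (v i)) z * (m (fst (v i)) + snd (v i))) - m z)\<^sup>2)"
    for v :: "nat \<Rightarrow> (real ^ 'd) \<times> real" and z
  have Fm: "(\<lambda>(v, z). F v z) \<in> borel_measurable (?MV \<Otimes>\<^sub>M P)"
  proof -
    \<comment> \<open>A weight reads the sample only at indices below \<open>n\<close>, so the
      restricted sample gives the same value and measurability of the weights can be pulled back
      along this map.\<close>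
    have "(\<lambda>w. (\<lambda>i\<in>{..<n}. fst (fst w i), snd w)) \<in> ?MV \<Otimes>\<^sub>M P \<rightarrow>\<^sub>M ?MX \<Otimes>\<^sub>M P"
    proof (intro measurable_Pair measurable_restrict)
      fix i assume "i \<in> {..<n}"
      then show "(\<lambda>w. fst (fst w i)) \<in> ?MV \<Otimes>\<^sub>M P \<rightarrow>\<^sub>M P"
        using measurable_compose[OF measurable_compose[OF measurable_fst comp_V] measurable_fst] by simp
    qed simp
    from measurable_compose[OF this wm]
    have w: "(\<lambda>w. weight i (\<lambda>i. fst (fst w i)) (snd w)) \<in> borel_measurable (?MV \<Otimes>\<^sub>M P)" for i
      by (simp add: weight_cong[of i "\<lambda>i. fst (fst _ i)"])
    have c: "(\<lambda>w. m (fst (fst w i)) + snd (fst w i)) \<in> borel_measurable (?MV \<Otimes>\<^sub>M P)" if "i < n" for i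
    proof -
      have "(\<lambda>w. m (fst w) + snd w) \<in> borel_measurable (P \<Otimes>\<^sub>M E)"
        by measurable
      from measurable_compose[OF measurable_compose[OF measurable_fst comp_V[OF that]] this] show ?thesis .
    qed
    have "(\<lambda>w. (\<Sum>i<n. weight i (\<lambda>i. fst (fst w i)) (snd w) * (m (fst (fst w i)) + snd (fst w i))) - m (snd w))
        \<in> borel_measurable (?MV \<Otimes>\<^sub>M P)"
      using w c by (intro borel_measurable_diff borel_measurable_sum borel_measurable_times) auto
    then show ?thesis
      unfolding F_def split_beta' by measurable
  qed
  let ?V = "\<lambda>\<omega>. \<lambda>i\<in>{..<n}. (fst (D i \<omega>), snd (D i \<omega>) - m (fst (D i \<omega>)))"
  have VX: "(\<lambda>\<omega>. (?V \<omega>, X \<omega>)) \<in> M \<rightarrow>\<^sub>M ?MV \<Otimes>\<^sub>M P"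
    using V X(1) by (intro measurable_Pair measurable_restrict) (auto cong: measurable_cong_sets)
  \<comment> \<open>The noise is integrated for a fixed query; Fubini then exchanges query and
    sample, because the bias is controlled sample by sample.\<close>
  have meas: "(\<integral>\<^sup>+z. (\<integral>\<^sup>+x. ennreal (((\<Sum>i<n. weight i x z * m (x i)) - m z)\<^sup>2) + ennreal (v * real a / real n) \<partial>?MX) \<partial>P) =
      (\<integral>\<^sup>+x. (\<integral>\<^sup>+z. ennreal (((\<Sum>i<n. weight i x z * m (x i)) - m z)\<^sup>2) + ennreal (v * real a / real n) \<partial>P) \<partial>?MX)"
    "(\<lambda>x. \<integral>\<^sup>+z. ennreal (((\<Sum>i<n. weight i x z * m (x i)) - m z)\<^sup>2) \<partial>P) \<in> borel_measurable ?MX"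
    "\<And>x. x \<in> space ?MX \<Longrightarrow> (\<lambda>z. ennreal (((\<Sum>i<n. weight i x z * m (x i)) - m z)\<^sup>2)) \<in> borel_measurable P"
  proof -
    have c: "(\<lambda>w. m (fst w i)) \<in> borel_measurable (?MX \<Otimes>\<^sub>M P)" if "i < n" for i
      using measurable_compose[OF measurable_compose[OF measurable_fst comp_X[OF that]] m] .
    have "(\<lambda>w. (\<Sum>i<n. weight i (fst w) (snd w) * m (fst w i)) - m (snd w)) \<in> borel_measurable (?MX \<Otimes>\<^sub>M P)"
      using wm c by (intro borel_measurable_diff borel_measurable_sum borel_measurable_times) auto
    then have b [measurable]: "(\<lambda>(x, z). ennreal (((\<Sum>i<n. weight i x z * m (x i)) - m z)\<^sup>2)) \<in> borel_measurable (?MX \<Otimes>\<^sub>M P)"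
      unfolding split_beta' by measurable
    show "(\<integral>\<^sup>+z. (\<integral>\<^sup>+x. ennreal (((\<Sum>i<n. weight i x z * m (x i)) - m z)\<^sup>2) + ennreal (v * real a / real n) \<partial>?MX) \<partial>P) =
      (\<integral>\<^sup>+x. (\<integral>\<^sup>+z. ennreal (((\<Sum>i<n. weight i x z * m (x i)) - m z)\<^sup>2) + ennreal (v * real a / real n) \<partial>P) \<partial>?MX)"
      by (rule MXP.Fubini') measurable
    show "(\<lambda>x. \<integral>\<^sup>+z. ennreal (((\<Sum>i<n. weight i x z * m (x i)) - m z)\<^sup>2) \<partial>P) \<in> borel_measurable ?MX"
      using b by (rule borel_measurable_nn_integral)
    show "(\<lambda>z. ennreal (((\<Sum>i<n. weight i x z * m (x i)) - m z)\<^sup>2)) \<in> borel_measurable P" if "x \<in> space ?MX" for x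
      using measurable_compose[OF measurable_Pair1'[OF that] b] by simp
  qed
  have "forest_risk M D X m n a Q \<kappa> = (\<integral>\<^sup>+\<omega>. F (?V \<omega>) (X \<omega>) \<partial>M)"
    unfolding forest_risk_def F_def
  proof (intro nn_integral_cong arg_cong[where f = ennreal] arg_cong[where f = "\<lambda>t. t\<^sup>2"] arg_cong2[where f = "(-)"] refl)
    fix \<omega> assume "\<omega> \<in> space M"
    then have "infinite_forest n a Q \<kappa> (\<lambda>i. D i \<omega>) (X \<omega>) =
        (\<Sum>i<n. weight i (\<lambda>i. fst (D i \<omega>)) (X \<omega>) * snd (D i \<omega>))"
      using infinite_forest_eq[OF X(2)] by simp
    also have "\<dots> = (\<Sum>i<n. weight i (\<lambda>i. fst (?V \<omega> i)) (X \<omega>) * (m (fst (?V \<omega> i)) + snd (?V \<omega> i)))"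
    proof (intro sum.cong refl)
      fix i assume "i \<in> {..<n}"
      have "weight i (\<lambda>i. fst (D i \<omega>)) (X \<omega>) = weight i (\<lambda>i. fst (?V \<omega> i)) (X \<omega>)"
        by (rule weight_eqI) simp
      with \<open>i \<in> {..<n}\<close> show "weight i (\<lambda>i. fst (D i \<omega>)) (X \<omega>) * snd (D i \<omega>) =
          weight i (\<lambda>i. fst (?V \<omega> i)) (X \<omega>) * (m (fst (?V \<omega> i)) + snd (?V \<omega> i))"
        by simp
    qed
    finally show "infinite_forest n a Q \<kappa> (\<lambda>i. D i \<omega>) (X \<omega>) =
        (\<Sum>i<n. weight i (\<lambda>i. fst (?V \<omega> i)) (X \<omega>) * (m (fst (?V \<omega> i)) + snd (?V \<omega> i)))" .
  qed
  also have "\<dots> = (\<integral>\<^sup>+w. (case w of (v, z) \<Rightarrow> F v z) \<partial>(?MV \<Otimes>\<^sub>M P))"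
    using Fm by (subst law[symmetric], subst nn_integral_distr[OF VX]) (auto simp: law)
  also have "\<dots> = (\<integral>\<^sup>+z. (\<integral>\<^sup>+v. F v z \<partial>?MV) \<partial>P)"
    using MVP.nn_integral_snd[OF Fm] by simp
  also have "\<dots> \<le> (\<integral>\<^sup>+z. (\<integral>\<^sup>+x. ennreal (((\<Sum>i<n. weight i x z * m (x i)) - m z)\<^sup>2) + ennreal (v * real a / real n) \<partial>?MX) \<partial>P)"
  proof (rule nn_integral_mono)
    fix z
    let ?zip = "\<lambda>(x, e). \<lambda>i\<in>{..<n}. (x i, e i)"
    let ?b = "\<lambda>x. (\<Sum>i<n. weight i x z * m (x i)) - m z"
    have zip: "?zip \<in> ?MX \<Otimes>\<^sub>M ?ME \<rightarrow>\<^sub>M ?MV"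
      unfolding split_beta'
    proof (intro measurable_restrict measurable_Pair)
      fix i assume "i \<in> {..<n}"
      then show "(\<lambda>w. fst w i) \<in> ?MX \<Otimes>\<^sub>M ?ME \<rightarrow>\<^sub>M P" "(\<lambda>w. snd w i) \<in> ?MX \<Otimes>\<^sub>M ?ME \<rightarrow>\<^sub>M E"
        by (auto intro: measurable_compose[OF measurable_fst] measurable_compose[OF measurable_snd] measurable_component_singleton)
    qed
    have Fz: "(\<lambda>v. F v z) \<in> borel_measurable ?MV"
      using measurable_compose[OF measurable_Pair2' Fm, of z] by simp
    have "(\<integral>\<^sup>+v. F v z \<partial>?MV) = (\<integral>\<^sup>+w. F (?zip w) z \<partial>(?MX \<Otimes>\<^sub>M ?ME))"
      using Fz by (subst PiM_pair_eq_distr[OF prob_space_axioms E finite_lessThan, symmetric],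
        subst nn_integral_distr[OF zip]) (auto simp: PiM_pair_eq_distr[OF prob_space_axioms E finite_lessThan])
    also have "\<dots> = (\<integral>\<^sup>+x. (\<integral>\<^sup>+e. F (?zip (x, e)) z \<partial>?ME) \<partial>?MX)"
      using measurable_compose[OF zip Fz] by (subst ME.nn_integral_fst) auto
    also have "\<dots> \<le> (\<integral>\<^sup>+x. ennreal ((?b x)\<^sup>2) + ennreal (v * real a / real n) \<partial>?MX)"
    proof (rule nn_integral_mono)
      fix x
      have "F (?zip (x, e)) z = ennreal ((?b x + (\<Sum>i<n. weight i x z * e i))\<^sup>2)" for e
      proof -
        have w: "weight i (\<lambda>i. fst (?zip (x, e) i)) z = weight i x z" for i
          by (rule weight_eqI) simp
        have "(\<Sum>i<n. weight i (\<lambda>i. fst (?zip (x, e) i)) z * (m (fst (?zip (x, e) i)) + snd (?zip (x, e) i))) =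
            (\<Sum>i<n. weight i x z * m (x i)) + (\<Sum>i<n. weight i x z * e i)"
          unfolding w sum.distrib[symmetric] by (intro sum.cong) (auto simp: distrib_left)
        then show ?thesis
          unfolding F_def by (intro arg_cong[where f = "\<lambda>t. ennreal (t\<^sup>2)"]) linarith
      qed
      then have "(\<integral>\<^sup>+e. F (?zip (x, e)) z \<partial>?ME) = ennreal ((?b x)\<^sup>2 + v * (\<Sum>i<n. (weight i x z)\<^sup>2))"
        using nn_integral_square_sum[OF E E1 E2 finite_lessThan, where b = "?b x" and w = "\<lambda>i. weight i x z"] by simp
      also have "\<dots> \<le> ennreal ((?b x)\<^sup>2 + v * (real a / real n))"
        by (intro ennreal_leI add_left_mono mult_left_mono sum_weight_square_le E2)
      also have "\<dots> = ennreal ((?b x)\<^sup>2) + ennreal (v * real a / real n)"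
        using E2 by simp
      finally show "(\<integral>\<^sup>+e. F (?zip (x, e)) z \<partial>?ME) \<le> ennreal ((?b x)\<^sup>2) + ennreal (v * real a / real n)" .
    qed
    finally show "(\<integral>\<^sup>+v. F v z \<partial>?MV) \<le> (\<integral>\<^sup>+x. ennreal ((?b x)\<^sup>2) + ennreal (v * real a / real n) \<partial>?MX)" .
  qed
  also note meas(1)
  also have "(\<integral>\<^sup>+x. (\<integral>\<^sup>+z. ennreal (((\<Sum>i<n. weight i x z * m (x i)) - m z)\<^sup>2) + ennreal (v * real a / real n) \<partial>P) \<partial>?MX) =
      (\<integral>\<^sup>+x. (\<integral>\<^sup>+z. ennreal (((\<Sum>i<n. weight i x z * m (x i)) - m z)\<^sup>2) \<partial>P) + ennreal (v * real a / real n) \<partial>?MX)"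
    using meas(3) by (intro nn_integral_cong) (simp add: nn_integral_add emeasure_space_1[unfolded space_P])
  also have "\<dots> = (\<integral>\<^sup>+x. (\<integral>\<^sup>+z. ennreal (((\<Sum>i<n. weight i x z * m (x i)) - m z)\<^sup>2) \<partial>P) \<partial>?MX) + ennreal (v * real a / real n)"
    using meas(2) by (simp add: nn_integral_add MX.emeasure_space_1)
  finally show ?thesis .
qed

end

section \<open>From the regression model to the abstract setting\<close>

lemma covariate_law_density:
  fixes f :: "real ^ 'd::finite \<Rightarrow> real"
  assumes M: "prob_space M" and X [measurable]: "X \<in> M \<rightarrow>\<^sub>M borel"
    and X01: "\<And>\<omega>. \<omega> \<in> space M \<Longrightarrow> X \<omega> \<in> cbox 0 1"
    and D: "distributed M lborel X (\<lambda>z. ennreal (f z))"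
    and c: "c > 0" and f: "\<And>z. z \<in> cbox 0 1 \<Longrightarrow> c \<le> f z \<and> f z \<le> C"
  shows "covariate_law (distr M borel X) c C"
proof -
  interpret prob_space M by fact
  let ?P = "distr M borel X"
  have fm [measurable]: "(\<lambda>z. ennreal (f z)) \<in> borel_measurable lborel"
    using D by (rule distributed_borel_measurable)
  have P: "?P = density lborel (\<lambda>z. ennreal (f z))"
    using distributed_distr_eq_density[OF D] by (subst distr_cong[of M M _ lborel X X]) auto
  interpret P: prob_space ?P
    using X by (rule prob_space_distr)
  show ?thesis
  proof
    show "sets ?P = sets borel" by simp
    show "AE z in ?P. z \<in> cbox 0 1"
      using X01 by (subst AE_distr_iff) auto
    show "0 < c" by fact
    fix l u :: "real ^ 'd"
    assume lu: "\<And>j. 0 \<le> l $ j \<and> l $ j \<le> u $ j \<and> u $ j \<le> 1"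
    let ?V = "\<Prod>j\<in>UNIV. u $ j - l $ j"
    have ne: "cbox l u \<noteq> {}" and sub: "cbox l u \<subseteq> cbox 0 1"
      using lu by (auto simp: interval_ne_empty_cart subset_interval_cart)
    have V: "emeasure lborel (cbox l u) = ennreal ?V" "0 \<le> ?V"
    proof -
      have "emeasure lborel (cbox l u) = ennreal (measure lborel (cbox l u))"
        using emeasure_lborel_cbox_finite[of l u] by (intro emeasure_eq_ennreal_measure) auto
      then show "emeasure lborel (cbox l u) = ennreal ?V"
        by (simp only: content_cbox_cart[OF ne])
      show "0 \<le> ?V"
        using lu by (intro prod_nonneg) auto
    qed
    have e: "emeasure ?P (cbox l u) = (\<integral>\<^sup>+z. ennreal (f z) * indicator (cbox l u) z \<partial>lborel)"
      unfolding P by (intro emeasure_density) auto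
    have C: "0 \<le> C"
      using f[of 0] c by (auto simp: mem_box_cart)
    have "ennreal (c * ?V) = (\<integral>\<^sup>+z. ennreal c * indicator (cbox l u) z \<partial>lborel)"
      using V c by (simp add: nn_integral_cmult_indicator ennreal_mult)
    also have "\<dots> \<le> emeasure ?P (cbox l u)"
      unfolding e using f sub by (intro nn_integral_mono) (auto simp: indicator_def intro!: ennreal_leI)
    finally have lower: "ennreal (c * ?V) \<le> ennreal (P.prob (cbox l u))"
      by (simp add: P.emeasure_eq_measure)
    have "emeasure ?P (cbox l u) \<le> (\<integral>\<^sup>+z. ennreal C * indicator (cbox l u) z \<partial>lborel)"
      unfolding e using f sub by (intro nn_integral_mono) (auto simp: indicator_def intro!: ennreal_leI)
    also have "\<dots> = ennreal (C * ?V)"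
      using V C by (simp add: nn_integral_cmult_indicator ennreal_mult)
    finally have upper: "ennreal (P.prob (cbox l u)) \<le> ennreal (C * ?V)"
      by (simp add: P.emeasure_eq_measure)
    show "c * ?V \<le> P.prob (cbox l u) \<and> P.prob (cbox l u) \<le> C * ?V"
      using lower upper V C by (simp add: ennreal_le_iff)
  next
    fix j :: 'd and t :: real
    let ?H = "{z :: real ^ 'd. z $ j = t}"
    have H: "?H \<in> sets borel"
      by measurable
    \<comment> \<open>A hyperplane is a Lebesgue null set, and a law with a density is absolutely
      continuous.\<close>
    have "negligible {z :: real ^ 'd. z \<bullet> axis j 1 = t}"
      by (rule negligible_standard_hyperplane) (simp add: axis_in_Basis_iff)
    then have "?H \<in> null_sets lebesgue"
      by (simp add: negligible_iff_null_sets inner_axis)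
    then have "?H \<in> null_sets lborel"
      using H by (simp add: null_sets_def)
    then have "?H \<in> null_sets ?P"
      unfolding P using absolutely_continuousI_density[OF fm] by (auto simp: absolutely_continuous_def)
    then show "emeasure ?P ?H = 0" by auto
  qed
qed

lemma centred_gaussian_expectation:
  assumes "prob_space M" "\<sigma> \<ge> 0" "centred_gaussian M \<epsilon> \<sigma>"
  shows "(\<integral>\<omega>. \<epsilon> \<omega> \<partial>M) = 0"
proof -
  interpret prob_space M by fact
  show ?thesis
  proof (cases "\<sigma> = 0")
    case True
    then have "AE \<omega> in M. \<epsilon> \<omega> = 0"
      using assms(3) by (simp add: centred_gaussian_def)
    then show ?thesis
      by (rule integral_eq_zero_AE)
  next
    case False
    then show ?thesis
      using assms by (intro normal_distributed_expectation[of \<sigma>]) (auto simp: centred_gaussian_def)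
  qed
qed

lemma cbox_uniform_modulus:
  fixes m :: "real ^ 'd::finite \<Rightarrow> real"
  assumes m: "continuous_on (cbox 0 1) m" and \<delta>: "0 < \<delta>"
  obtains \<eta> where "0 < \<eta>" and "\<And>x y. x \<in> cbox 0 1 \<Longrightarrow> y \<in> cbox 0 1 \<Longrightarrow>
    (\<forall>j. \<bar>x $ j - y $ j\<bar> \<le> \<eta>) \<Longrightarrow> \<bar>m x - m y\<bar> \<le> \<delta>"
proof -
  obtain r where r: "0 < r" "\<And>x y. x \<in> cbox 0 1 \<Longrightarrow> y \<in> cbox 0 1 \<Longrightarrow> dist y x < r \<Longrightarrow> dist (m y) (m x) < \<delta>"
    using compact_uniformly_continuous[OF m compact_cbox] \<delta> unfolding uniformly_continuous_on_def by metis
  \<comment> \<open>If all d coordinates of a difference are at most \<eta> in absolute value, its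
    l1 norm is at most r / 2, which leaves room for the strict inequality.\<close>
  define \<eta> where "\<eta> = r / (2 * real CARD('d))"
  show thesis
  proof
    show "0 < \<eta>" using r by (simp add: \<eta>_def)
    fix x y :: "real ^ 'd"
    assume xy: "x \<in> cbox 0 1" "y \<in> cbox 0 1" "\<forall>j. \<bar>x $ j - y $ j\<bar> \<le> \<eta>"
    have "dist x y \<le> (\<Sum>j\<in>UNIV. \<bar>(x - y) $ j\<bar>)"
      unfolding dist_norm by (rule norm_le_l1_cart)
    also have "\<dots> \<le> (\<Sum>j\<in>(UNIV :: 'd set). \<eta>)"
      using xy by (intro sum_mono) auto
    also have "\<dots> < r"
      using r by (simp add: \<eta>_def)
    finally show "\<bar>m x - m y\<bar> \<le> \<delta>"
      using r(2)[OF xy(2,1)] by (simp add: dist_real_def less_imp_le)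
  qed
qed

section \<open>Choice of the parameters and consistency\<close>

theorem theorem4p2:
  fixes M :: "'w measure"
    and D :: "nat \<Rightarrow> 'w \<Rightarrow> (real ^ 'd::finite) \<times> real"
    and X :: "'w \<Rightarrow> real ^ 'd" and Y \<epsilon> :: "'w \<Rightarrow> real"
    and m f :: "real ^ 'd \<Rightarrow> real"
    and q \<sigma> c C :: real
    and a :: "nat \<Rightarrow> nat"
    and Q :: "nat \<Rightarrow> 'u measure"
    and \<kappa> :: "nat \<Rightarrow> ('u, 'd) quantile_rule"
  assumes "prob_space M"
    \<comment> \<open>the pair \<open>(X, Y)\<close>, the sample, and the independence of \<open>X\<close> from the sample\<close>
    and "X \<in> M \<rightarrow>\<^sub>M borel" and "Y \<in> M \<rightarrow>\<^sub>M borel"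
    and "\<And>\<omega>. \<omega> \<in> space M \<Longrightarrow> X \<omega> \<in> cbox 0 1"
    and "\<And>i \<omega>. \<omega> \<in> space M \<Longrightarrow> fst (D i \<omega>) \<in> cbox 0 1"
    and "integrable M (\<lambda>\<omega>. (Y \<omega>)\<^sup>2)"
    and "prob_space.indep_vars M (\<lambda>_. borel) D UNIV"
    and "\<And>i. distr M borel (D i) = distr M borel (\<lambda>\<omega>. (X \<omega>, Y \<omega>))"
    and "independent M (\<Pi>\<^sub>M i\<in>UNIV. borel) (\<lambda>\<omega> i. D i \<omega>) borel X"
    \<comment> \<open>the regression model\<close>
    and "regression_function M X Y m"
    and "AE \<omega> in M. Y \<omega> = m (X \<omega>) + \<epsilon> \<omega>"
    and "\<sigma> \<ge> 0" and "centred_gaussian M \<epsilon> \<sigma>"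
    and "independent M borel \<epsilon> borel X"
    and "distributed M lborel X (\<lambda>z. ennreal (f z))"
    and "c > 0" and "\<And>z. z \<in> cbox 0 1 \<Longrightarrow> c \<le> f z \<and> f z \<le> C"
    and "\<And>z. z \<notin> cbox 0 1 \<Longrightarrow> f z = 0"
    and "continuous_on (cbox 0 1) m"
    \<comment> \<open>the forest\<close>
    and "q \<in> {1/2..<1}"
    and "\<And>n. prob_space (Q n)"
    and "\<And>n. admissible_rule q n (Q n) (\<kappa> n)"
    and "\<And>n. n \<ge> 1 \<Longrightarrow> a n \<in> {1..n}"
    and "filterlim a at_top sequentially"
    and "(\<lambda>n. real (a n) / real n) \<longlonglongrightarrow> 0"
  shows "(\<lambda>n. forest_risk M D X m n (a n) (Q n) (\<kappa> n)) \<longlonglongrightarrow> 0"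
proof -
  interpret M: prob_space M by (rule assms(1))
  note X = assms(2) and Y = assms(3) and X01 = assms(4)
  note [measurable] = X Y
  let ?P = "distr M borel X" and ?E = "distr M borel \<epsilon>"
  have cov: "covariate_law ?P c C"
    by (rule covariate_law_density[OF assms(1,2,4,15,16)]) (use assms(17) in auto)
  interpret cov: covariate_law ?P c C by (rule cov)
  have \<epsilon> [measurable]: "\<epsilon> \<in> M \<rightarrow>\<^sub>M borel"
    using assms(14) by (simp add: independent_def)
  have E: "prob_space ?E"
    by (rule M.prob_space_distr) measurable
  \<comment> \<open>nothing is known about \<open>m\<close> outside the cube, not even measurability\<close>
  define m' where "m' z = (if z \<in> cbox 0 1 then m z else 0)" for z
  have m' [measurable]: "m' \<in> borel_measurable borel"
    using borel_measurable_continuous_on_if[of "cbox 0 1" m "\<lambda>_. 0"] assms(19) by (simp add: m'_def[abs_def])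
  obtain b where b: "\<And>x. x \<in> cbox 0 1 \<Longrightarrow> \<bar>m x\<bar> \<le> b" "0 \<le> b"
  proof -
    have "bounded (m ` cbox 0 1)"
      using assms(19) by (intro compact_imp_bounded compact_continuous_image compact_cbox)
    then show thesis
      using that by (auto simp: bounded_pos) (meson less_imp_le)
  qed
  have noise: "AE \<omega> in M. \<epsilon> \<omega> = Y \<omega> - m' (X \<omega>)"
    using assms(11) AE_space by eventually_elim (use X01 in \<open>auto simp: m'_def\<close>)

  \<comment> \<open>From \<open>Y\<close> in L^2 and bounded \<open>m'\<close>, by (u - w)^2 \<le> 2
    u^2 + 2 w^2; this treats \<sigma> = 0 and \<sigma> > 0 alike.\<close>
  have sq: "integrable M (\<lambda>\<omega>. (\<epsilon> \<omega>)\<^sup>2)"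
  proof (rule Bochner_Integration.integrable_bound)
    show "integrable M (\<lambda>\<omega>. 2 * (Y \<omega>)\<^sup>2 + 2 * b\<^sup>2)"
      using assms(6) by simp
    show "AE \<omega> in M. norm ((\<epsilon> \<omega>)\<^sup>2) \<le> norm (2 * (Y \<omega>)\<^sup>2 + 2 * b\<^sup>2)"
      using noise AE_space
    proof eventually_elim
      case (elim \<omega>)
      have "(m' (X \<omega>))\<^sup>2 \<le> b\<^sup>2"
        using b X01[OF elim(2)] by (auto simp: m'_def abs_le_square_iff[symmetric])
      moreover have "(\<epsilon> \<omega>)\<^sup>2 \<le> 2 * (Y \<omega>)\<^sup>2 + 2 * (m' (X \<omega>))\<^sup>2"
        using zero_le_power2[of "Y \<omega> + m' (X \<omega>)"] unfolding elim(1)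
        by (simp add: power2_eq_square algebra_simps)
      ultimately show ?case by simp
    qed
  qed measurable
  have int: "integrable M \<epsilon>"
    by (rule M.square_integrable_imp_integrable[OF \<epsilon> sq])
  have E1: "integrable ?E (\<lambda>e. e)" "(\<integral>e. e \<partial>?E) = 0"
    using int centred_gaussian_expectation[OF assms(1,12,13)]
    by (simp_all add: integrable_distr_eq integral_distr)
  define v where "v = (\<integral>\<omega>. (\<epsilon> \<omega>)\<^sup>2 \<partial>M)"
  have v: "(\<integral>\<^sup>+e. ennreal (e\<^sup>2) \<partial>?E) = ennreal v" "0 \<le> v"
    using sq by (simp_all add: v_def nn_integral_distr nn_integral_eq_integral)

  \<comment> \<open>Passes from a data pair to covariate and noise. As \<open>D i\<close> is
    distributed as (X, Y), its image is distributed as (X, \<epsilon>), which has a product law by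
    independence. So the sample gets its own noise variables although only the one of
    \<open>Y\<close> is given.\<close>
  define \<psi> where "\<psi> d = (fst d, snd d - m' (fst d))" for d :: "(real ^ 'd) \<times> real"
  have \<psi> [measurable]: "\<psi> \<in> borel \<rightarrow>\<^sub>M ?P \<Otimes>\<^sub>M ?E"
    unfolding \<psi>_def borel_prod[symmetric] by measurable
  have D_indep: "M.indep_vars (\<lambda>_. ?P \<Otimes>\<^sub>M ?E) (\<lambda>i \<omega>. \<psi> (D i \<omega>)) UNIV"
    by (rule M.indep_vars_compose2[OF assms(7)]) measurable
  have D [measurable]: "D i \<in> M \<rightarrow>\<^sub>M borel" for i
    using assms(7) by (simp add: M.indep_vars_def)
  have law1: "distr M (?P \<Otimes>\<^sub>M ?E) (\<lambda>\<omega>. \<psi> (D i \<omega>)) = ?P \<Otimes>\<^sub>M ?E" for i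
  proof -
    have XY: "(\<lambda>\<omega>. (X \<omega>, Y \<omega>)) \<in> M \<rightarrow>\<^sub>M borel"
      unfolding borel_prod[symmetric] by measurable
    have "distr M (?P \<Otimes>\<^sub>M ?E) (\<lambda>\<omega>. \<psi> (D i \<omega>)) = distr (distr M borel (D i)) (?P \<Otimes>\<^sub>M ?E) \<psi>"
      by (subst distr_distr) (auto simp: comp_def)
    also have "\<dots> = distr M (?P \<Otimes>\<^sub>M ?E) (\<lambda>\<omega>. \<psi> (X \<omega>, Y \<omega>))"
      unfolding assms(8) using XY by (subst distr_distr) (auto simp: comp_def)
    also have "\<dots> = distr M (borel \<Otimes>\<^sub>M borel) (\<lambda>\<omega>. (X \<omega>, \<epsilon> \<omega>))"
    proof (rule distr_cong_AE)
      show "AE \<omega> in M. \<psi> (X \<omega>, Y \<omega>) = (X \<omega>, \<epsilon> \<omega>)"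
        using noise by eventually_elim (simp add: \<psi>_def)
      show "(\<lambda>\<omega>. \<psi> (X \<omega>, Y \<omega>)) \<in> M \<rightarrow>\<^sub>M ?P \<Otimes>\<^sub>M ?E"
        using measurable_compose[OF XY \<psi>] .
      show "sets (?P \<Otimes>\<^sub>M ?E) = sets (borel \<Otimes>\<^sub>M borel)"
        by (intro sets_pair_measure_cong) auto
    qed (rule refl, measurable)
    also have "\<dots> = ?P \<Otimes>\<^sub>M ?E"
      by (rule independent_distr[OF assms(1) independent_commute[OF assms(1,14)]])
    finally show ?thesis .
  qed
  have PX: "distr M ?P X = ?P"
    by (rule distr_cong) simp_all
  let ?V = "\<lambda>n \<omega>. \<lambda>i\<in>{..<n}. \<psi> (D i \<omega>)"
  have law: "distr M ((\<Pi>\<^sub>M i\<in>{..<n}. ?P \<Otimes>\<^sub>M ?E) \<Otimes>\<^sub>M ?P) (\<lambda>\<omega>. (?V n \<omega>, X \<omega>)) =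
      (\<Pi>\<^sub>M i\<in>{..<n}. ?P \<Otimes>\<^sub>M ?E) \<Otimes>\<^sub>M ?P" if "n \<ge> 1" for n
  proof -
    \<comment> \<open>Independence of the data points gives the product over the sample;
      independence of \<open>X\<close> from the whole sequence then adds the query.\<close>
    have "distr M (\<Pi>\<^sub>M i\<in>{..<n}. ?P \<Otimes>\<^sub>M ?E) (?V n) = (\<Pi>\<^sub>M i\<in>{..<n}. distr M (?P \<Otimes>\<^sub>M ?E) (\<lambda>\<omega>. \<psi> (D i \<omega>)))"
      using M.indep_vars_subset[OF D_indep, of "{..<n}"] that
      by (subst M.indep_vars_iff_distr_eq_PiM'[symmetric]) (auto simp: lessThan_empty_iff)
    then have V: "distr M (\<Pi>\<^sub>M i\<in>{..<n}. ?P \<Otimes>\<^sub>M ?E) (?V n) = (\<Pi>\<^sub>M i\<in>{..<n}. ?P \<Otimes>\<^sub>M ?E)"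
      by (simp add: law1)
    have comp: "(\<lambda>s. \<lambda>i\<in>{..<n}. \<psi> (s i)) \<in> (\<Pi>\<^sub>M i\<in>UNIV. borel) \<rightarrow>\<^sub>M (\<Pi>\<^sub>M i\<in>{..<n}. ?P \<Otimes>\<^sub>M ?E)"
      by measurable
    have id: "(\<lambda>x. x) \<in> borel \<rightarrow>\<^sub>M ?P"
      by simp
    from independent_compose[OF assms(1,9) comp id]
    have "independent M (\<Pi>\<^sub>M i\<in>{..<n}. ?P \<Otimes>\<^sub>M ?E) (?V n) ?P X"
      by simp
    from independent_distr[OF assms(1) this] show ?thesis
      unfolding V by (simp add: PX)
  qed

  have risk_m': "forest_risk M D X m n (a n) (Q n) (\<kappa> n) = forest_risk M D X m' n (a n) (Q n) (\<kappa> n)" for n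
    unfolding forest_risk_def using X01 by (intro nn_integral_cong) (simp add: m'_def)
  have forest: "forest_on_law n (a n) q (Q n) (\<kappa> n) ?P c C" if "n \<ge> 1" for n
    using assms(20-23) that by (intro forest_on_law.intro quantile_forest.intro cov) auto

  have bound: "eventually (\<lambda>n. forest_risk M D X m n (a n) (Q n) (\<kappa> n) \<le> ennreal e) sequentially"
    if e: "0 < e" for e :: real
  proof -
    \<comment> \<open>The error e is split into four quarters: modulus of continuity, contraction of
      the cells, irregular samples, noise. The summand 1 in b + 1 avoids a division by 0.\<close>
    define \<delta> where "\<delta> = e / (8 * (b + 1))"
    have \<delta>: "0 < \<delta>" "2 * b * \<delta> \<le> e / 4"
      using e b by (auto simp: \<delta>_def field_simps)
    obtain \<eta> where \<eta>: "0 < \<eta>" "\<And>x y. x \<in> cbox 0 1 \<Longrightarrow> y \<in> cbox 0 1 \<Longrightarrow>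
        (\<forall>j. \<bar>x $ j - y $ j\<bar> \<le> \<eta>) \<Longrightarrow> \<bar>m x - m y\<bar> \<le> \<delta>"
      using cbox_uniform_modulus[OF assms(19) \<delta>(1)] by metis
    let ?c' = "c / 2 / 2 ^ CARD('d)" and ?C' = "2 * C * (3 / 2) ^ CARD('d)"
    let ?\<beta> = "(1 - q) / 2"
    define r where "r = 1 - ?\<beta> * ?c' / ?C' / real CARD('d)"
    have \<beta>: "0 < ?\<beta>" "?\<beta> < 1"
      using assms(20) by auto
    have C: "0 < C"
      using cov.c_le_C assms(16) by simp
    have "?c' \<le> c / 2 / 1"
      using assms(16) by (intro divide_left_mono) auto
    also have "\<dots> \<le> 2 * C * 1"
      using cov.c_le_C assms(16) by simp
    also have "\<dots> \<le> ?C'"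
      using C by (intro mult_left_mono) auto
    finally have c'C': "0 < ?c'" "0 < ?C'" "?c' \<le> ?C'"
      using assms(16) C by auto
    have r: "0 \<le> r" "r < 1"
    proof -
      have "?\<beta> * ?c' \<le> 1 * ?C'"
        using \<beta> c'C' by (intro mult_mono) auto
      then have "?\<beta> * ?c' / ?C' \<le> 1"
        using c'C'(2) by (simp only: pos_divide_le_eq)
      then have "?\<beta> * ?c' / ?C' / real CARD('d) \<le> 1 / 1"
        by (intro frac_le) (auto simp: Suc_le_eq)
      then show "0 \<le> r"
        unfolding r_def by linarith
      have "0 < ?\<beta> * ?c' / ?C' / real CARD('d)"
        by (intro divide_pos_pos[OF divide_pos_pos[OF mult_pos_pos[OF \<beta>(1) c'C'(1)] c'C'(2)]]) simp
      then show "r < 1"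
        unfolding r_def by linarith
    qed
    obtain \<epsilon>\<^sub>1 where \<epsilon>\<^sub>1: "0 < \<epsilon>\<^sub>1" "4 * b\<^sup>2 * \<epsilon>\<^sub>1 \<le> e / 4"
    proof
      have t: "0 < b\<^sup>2 + 1"
        by (simp add: add_nonneg_pos)
      then show "0 < e / (16 * (b\<^sup>2 + 1))"
        using e by simp
      show "4 * b\<^sup>2 * (e / (16 * (b\<^sup>2 + 1))) \<le> e / 4"
        using e t by (simp add: divide_le_eq)
    qed
    have "(\<lambda>K. real CARD('d) * r ^ K / \<eta>) \<longlonglongrightarrow> real CARD('d) * 0 / \<eta>"
      using r \<eta>(1) by (intro tendsto_intros LIMSEQ_realpow_zero) auto
    then have "eventually (\<lambda>K. real CARD('d) * r ^ K / \<eta> < \<epsilon>\<^sub>1) sequentially"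
      using \<epsilon>\<^sub>1 by (intro order_tendstoD(2)) auto
    then obtain K where K: "real CARD('d) * r ^ K / \<eta> < \<epsilon>\<^sub>1"
      by (auto simp: eventually_sequentially)
    \<comment> \<open>The depth \<open>K\<close> is fixed before \<open>s\<close>. Half of the
      threshold \<beta>^K / C' gives the strict inequality, and the minimum with 1 keeps
      \<open>s\<close> a possible side length in the cube.\<close>
    define s where "s = min 1 (?\<beta> ^ K / (2 * ?C'))"
    have \<beta>K: "0 < ?\<beta> ^ K"
      using \<beta>(1) by (rule zero_less_power)
    have "?C' * s \<le> ?C' * (?\<beta> ^ K / (2 * ?C'))"
      unfolding s_def using c'C'(2) by (intro mult_left_mono) auto
    also have "\<dots> = ?\<beta> ^ K / 2"
      using C by simp
    also have "\<dots> < ?\<beta> ^ K"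
      using \<beta>K by linarith
    finally have s: "0 < s" "s \<le> 1" "?C' * s < ?\<beta> ^ K"
      using \<beta>K c'C'(2) by (auto simp only: s_def min_less_iff_conj min.cobounded1 intro!: divide_pos_pos)
    obtain L where L: "0 \<le> L" "\<And>n S. S \<subseteq> {..<n} \<Longrightarrow> S \<noteq> {} \<Longrightarrow>
      \<exists>B \<in> sets (\<Pi>\<^sub>M i\<in>{..<n}. ?P). emeasure (\<Pi>\<^sub>M i\<in>{..<n}. ?P) B \<le> ennreal (L / real (card S)) \<and>
        (\<forall>x \<in> space (\<Pi>\<^sub>M i\<in>{..<n}. ?P) - B. box_regular S x s ?c' ?C')"
      using cov.box_regular_likely[OF s(1)] by metis
    have a_real: "filterlim (\<lambda>n. real (a n)) at_top sequentially"
      using assms(24) by (rule filterlim_compose[OF filterlim_real_sequentially])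
    have "eventually (\<lambda>n. 2 / (1 - q) / ?\<beta> ^ K \<le> real (a n)) sequentially"
      "eventually (\<lambda>n. K \<le> a n) sequentially"
      using a_real assms(24) by (auto simp: filterlim_at_top)
    moreover have "eventually (\<lambda>n. 4 * b\<^sup>2 * (L / real (a n)) < e / 4) sequentially"
    proof -
      have "(\<lambda>n. 4 * b\<^sup>2 * (L / real (a n))) \<longlonglongrightarrow> 4 * b\<^sup>2 * 0"
        using a_real by (intro tendsto_intros tendsto_divide_0[OF tendsto_const] filterlim_at_top_imp_at_infinity)
      then show ?thesis using e by (intro order_tendstoD(2)) auto
    qed
    moreover have "eventually (\<lambda>n. v * real (a n) / real n < e / 4) sequentially"
    proof -
      have "(\<lambda>n. v * (real (a n) / real n)) \<longlonglongrightarrow> v * 0"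
        by (intro tendsto_intros assms(25))
      then have "eventually (\<lambda>n. v * (real (a n) / real n) < e / 4) sequentially"
        using e by (intro order_tendstoD(2)) auto
      then show ?thesis by simp
    qed
    ultimately show ?thesis
      using eventually_ge_at_top[of 1]
    proof eventually_elim
      case (elim n)
      interpret forest_on_law n "a n" q "Q n" "\<kappa> n" ?P c C
        by (rule forest) (use elim in simp)
      let ?MX = "\<Pi>\<^sub>M i\<in>{..<n}. ?P"
      have "\<exists>B. \<forall>S\<in>subsamples. B S \<in> sets ?MX \<and> emeasure ?MX (B S) \<le> ennreal (L / real (a n)) \<and>
          (\<forall>x \<in> space ?MX - B S. box_regular S x s c' C')"
      proof (rule bchoice, intro ballI)
        fix S assume "S \<in> subsamples"
        then have "S \<subseteq> {..<n}" "card S = a n" "S \<noteq> {}"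
          using a by (auto simp: subsamples_def)
        then show "\<exists>B. B \<in> sets ?MX \<and> emeasure ?MX B \<le> ennreal (L / real (a n)) \<and>
            (\<forall>x \<in> space ?MX - B. box_regular S x s c' C')"
          using L(2)[of S n] by (auto simp: c'_def C'_def)
      qed
      then obtain B where B: "\<And>S. S \<in> subsamples \<Longrightarrow> B S \<in> sets ?MX"
          "\<And>S. S \<in> subsamples \<Longrightarrow> emeasure ?MX (B S) \<le> ennreal (L / real (a n))"
          "\<And>S x. S \<in> subsamples \<Longrightarrow> x \<in> space ?MX - B S \<Longrightarrow> box_regular S x s c' C'"
        by metis
      have contr: "contraction = r"
        by (simp add: contraction_def r_def c'_def C'_def)
      have La: "0 \<le> L / real (a n)"
        using L(1) by simp
      have s': "C' * s < ?\<beta> ^ K"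
        using s(3) by (simp add: C'_def)
      have K2: "2 / (1 - q) \<le> ?\<beta> ^ K * real (a n)"
        using elim(1) zero_less_power[OF \<beta>(1), of K] by (simp only: pos_divide_le_eq mult.commute)
      obtain h where h: "h \<in> borel_measurable ?MX"
        "AE x in ?MX. \<forall>z \<in> cbox 0 1. emeasure \<Theta> {\<theta> \<in> space \<Theta>. far \<eta> \<theta> x z} \<le> h x"
        "(\<integral>\<^sup>+x. h x \<partial>?MX) \<le> ennreal (real CARD('d) * contraction ^ K / \<eta>) + ennreal (L / real (a n))"
        by (rule prob_far[OF B La s(1,2) s' elim(2) K2 \<eta>(1)])
      have h_le: "(\<integral>\<^sup>+x. h x \<partial>?MX) \<le> ennreal (\<epsilon>\<^sub>1 + L / real (a n))"
      proof -
        note h(3)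
        also have "ennreal (real CARD('d) * contraction ^ K / \<eta>) + ennreal (L / real (a n)) \<le>
            ennreal \<epsilon>\<^sub>1 + ennreal (L / real (a n))"
          using K unfolding contr by (intro add_right_mono ennreal_leI) simp
        also have "\<dots> = ennreal (\<epsilon>\<^sub>1 + L / real (a n))"
          using La \<epsilon>\<^sub>1 by (intro ennreal_plus[symmetric]) auto
        finally show ?thesis .
      qed
      have "(\<integral>\<^sup>+x. (\<integral>\<^sup>+z. ennreal (((\<Sum>i<n. weight i x z * m' (x i)) - m' z)\<^sup>2) \<partial>?P) \<partial>?MX) \<le>
          ennreal (2 * b * (\<delta> + 2 * b * (\<epsilon>\<^sub>1 + L / real (a n))))"
        using b \<eta>(2) \<delta> \<epsilon>\<^sub>1 La h(1,2) h_le
        by (intro nn_integral_bias_le[where \<eta> = \<eta> and h = h]) (auto simp: m'_def)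
      moreover have "forest_risk M D X m' n (a n) (Q n) (\<kappa> n) \<le>
          (\<integral>\<^sup>+x. (\<integral>\<^sup>+z. ennreal (((\<Sum>i<n. weight i x z * m' (x i)) - m' z)\<^sup>2) \<partial>?P) \<partial>?MX) +
          ennreal (v * real (a n) / real n)"
      proof (rule forest_risk_le[OF assms(1) E _ E1 v m' X X01])
        show "(\<lambda>\<omega>. (fst (D i \<omega>), snd (D i \<omega>) - m' (fst (D i \<omega>)))) \<in> M \<rightarrow>\<^sub>M ?P \<Otimes>\<^sub>M ?E" for i
          using measurable_compose[OF D \<psi>, of i] by (simp add: \<psi>_def)
        show "distr M ((\<Pi>\<^sub>M i\<in>{..<n}. ?P \<Otimes>\<^sub>M ?E) \<Otimes>\<^sub>M ?P)
            (\<lambda>\<omega>. (\<lambda>i\<in>{..<n}. (fst (D i \<omega>), snd (D i \<omega>) - m' (fst (D i \<omega>))), X \<omega>)) =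
          (\<Pi>\<^sub>M i\<in>{..<n}. ?P \<Otimes>\<^sub>M ?E) \<Otimes>\<^sub>M ?P"
          using law[of n] elim by (simp add: \<psi>_def)
      qed simp
      ultimately have "forest_risk M D X m' n (a n) (Q n) (\<kappa> n) \<le>
          ennreal (2 * b * (\<delta> + 2 * b * (\<epsilon>\<^sub>1 + L / real (a n)))) + ennreal (v * real (a n) / real n)"
        by (meson add_right_mono order_trans)
      also have "\<dots> = ennreal (2 * b * (\<delta> + 2 * b * (\<epsilon>\<^sub>1 + L / real (a n))) + v * real (a n) / real n)"
        using b \<delta> \<epsilon>\<^sub>1 La v by (intro ennreal_plus[symmetric]) auto
      also have "\<dots> \<le> ennreal e"
      proof (rule ennreal_leI)
        have "2 * b * (\<delta> + 2 * b * (\<epsilon>\<^sub>1 + L / real (a n))) = 2 * b * \<delta> + 4 * b\<^sup>2 * \<epsilon>\<^sub>1 + 4 * b\<^sup>2 * (L / real (a n))"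
          by (simp add: power2_eq_square algebra_simps)
        then show "2 * b * (\<delta> + 2 * b * (\<epsilon>\<^sub>1 + L / real (a n))) + v * real (a n) / real n \<le> e"
          using \<delta>(2) \<epsilon>\<^sub>1(2) elim by linarith
      qed
      finally show ?case
        by (simp only: risk_m')
    qed
  qed
  show ?thesis
  proof (rule order_tendstoI)
    fix t :: ennreal assume "0 < t"
    then obtain e where e: "0 < e" "ennreal e < t"
      by (metis ennreal_less_zero_iff dense ennreal_cases not_top_less top.not_eq_extremum less_top order_less_le_trans ennreal_neq_top)
    then show "eventually (\<lambda>n. forest_risk M D X m n (a n) (Q n) (\<kappa> n) < t) sequentially"
      using bound[OF e(1)] by (auto elim!: eventually_mono)
  qed simp
qed

end
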